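(* Let $\vec p=(p_{\mathsf F},p_{\mathsf S},p_{\mathsf d},p_{\mathsf e})\in\mathcal P$ with $p_{\mathsf F}=0$ and $p_{\mathsf S}=1$ (so that $y=0$, while $z$ is arbitrary). Then, as $n\to\infty$, $Z^n\to Z$ in law in the topology of uniform convergence on compact subsets of $\mathbb R$, where $Z=(U,V)$ is a two-sided correlated two-dimensional Brownian motion with $Z(0)=0$ and $$\operatorname{Var}(U(t))=\operatorname{Var}(V(t))=\frac{(1+z)|t|}{2}\quad\text{and}\quad \operatorname{Cov}(U(t),V(t))=-\frac{z|t|}{2},\qquad\forall t\in\mathbb R .$$
   Context: Words. Let $\Theta_0=\{\mathsf h,\mathsf c,\mathsf H,\mathsf C\}$ (hamburger, cheeseburger, hamburger order, cheeseburger order) and $\Theta=\Theta_0\cup\{\mathsf d,\mathsf e,\mathsf F,\mathsf S\}$ (duplicate burger, opposite burger, flexible order, stale order). Burgers are $\mathsf h,\mathsf c,\mathsf d,\mathsf e$; orders are $\mathsf H,\mathsf C,\mathsf F,\mathsf S$. Finite words in $\Theta$ are considered modulo the relations $\mathsf c\mathsf C=\mathsf h\mathsf H=\emptyset$, $\mathsf c\mathsf H=\mathsf H\mathsf c$, $\mathsf h\mathsf C=\mathsf C\mathsf h$, $\mathsf h\mathsf F=\mathsf h\mathsf H=\emptyset$, $\mathsf c\mathsf F=\mathsf c\mathsf C=\emptyset$, $\mathsf h\mathsf S=\mathsf h\mathsf C$, $\mathsf c\mathsf S=\mathsf c\mathsf H$, $\mathsf h\mathsf d=\mathsf h\mathsf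 h$, $\mathsf c\mathsf d=\mathsf c\mathsf c$, $\mathsf h\mathsf e=\mathsf h\mathsf c$, $\mathsf c\mathsf e=\mathsf c\mathsf h$. A word is reduced if all of its orders, $\mathsf d$'s and $\mathsf e$'s lie to the left of all of its $\mathsf h$'s and $\mathsf c$'s; every finite word $x$ is equivalent to a unique reduced word $\mathcal R(x)$. Identification. In a word $x_1\cdots x_m$, a symbol $x_i\in\{\mathsf d,\mathsf e,\mathsf F,\mathsf S\}$ is identified if $\mathcal R(x_1\cdots x_{i-1})$ contains an $\mathsf h$ or $\mathsf c$; it is then identified as the element of $\Theta_0$ that replaces it under the relations above when it is placed to the right of the rightmost $\mathsf h$ or $\mathsf c$ of $\mathcal R(x_1\cdots x_{i-1})$ (so $\mathsf d$ becomes a burger of the same type, $\mathsf e$ a burger of the opposite type, $\mathsf F$ an order of the same type, $\mathsf S$ an order of the opposite type). Symbols of $\Theta_0$ are identified as themselves. Random word. $\mathcal P=\{(p_{\mathsf F},p_{\mathsf S},p_{\mathsf d},p_{\mathsf e})\in[0,1]^4: p_{\mathsf F}+p_{\mathsf S}\le 1,\ p_{\mathsf d}+p_{\mathsf e}<1\}$. For $\vec p\in\mathcal P$ let $X=\cdots X_{-1}X_0X_1\cdots$ be a bi-infinite word of i.i.d. symbols with $\mathbb P(\mathsf F)=p_{\mathsf F}/2$, $\mathbb P(\mathsf S)=p_{\mathsf S}/2$, $\mathbb P(\mathsf H)=\mathbb P(\mathsf C)=(1-p_{\mathsf F}-p_{\mathsf S})/4$, $\mathbb P(\mathsf d)=p_{\mathsf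 d}/2$, $\mathbb P(\mathsf e)=p_{\mathsf e}/2$, $\mathbb P(\mathsf h)=\mathbb P(\mathsf c)=(1-p_{\mathsf d}-p_{\mathsf e})/4$. Almost surely every $X_i$ is identified in $X_{-m}\cdots X_i$ for all large enough $m$ (with an identification not depending on such $m$); $X'_i\in\Theta_0$ denotes this identification and $X'=\cdots X'_{-1}X'_0X'_1\cdots$. For integers $a\le b$ write $X'(a,b)=\mathcal R(X'_a\cdots X'_b)$. Parameters: $y=\dfrac{1+p_{\mathsf F}-p_{\mathsf S}}{1-p_{\mathsf F}+p_{\mathsf S}}$ and $z=\dfrac{1+p_{\mathsf d}-p_{\mathsf e}}{1-p_{\mathsf d}+p_{\mathsf e}}$. Walk. For a word $x$, let $d(x)$ be the number of $\mathsf h$'s minus the number of $\mathsf H$'s in $x$, and $d^*(x)$ the number of $\mathsf c$'s minus the number of $\mathsf C$'s in $x$. For $i\in\mathbb Z$ set $d(i)=d(X'(1,i))$ if $i\ge1$, $d(0)=0$, $d(i)=d(X'(i+1,0))$ if $i\le-1$; define $d^*(i)$ in the same way from $d^*$. Extend $d,d^*$ to $\mathbb R$ by linear interpolation, and for $n\in\mathbb N$, $t\in\mathbb R$ set $U^n(t)=n^{-1/2}d(nt)$, $V^n(t)=n^{-1/2}d^*(nt)$, $Z^n(t)=(U^n(t),V^n(t))$. *)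

theory Defs
  imports "HOL-Probability.Probability"
begin

section \<open>Words\<close>

text \<open>Constructors in the order h, c, H, C, d, e, F, S.\<close>

datatype symbol = Ham | Chs | HamOrd | ChsOrd | Dup | Opp | Flex | Stale

definition Theta0 :: "symbol set" where
  "Theta0 = {Ham, Chs, HamOrd, ChsOrd}"

inductive word_relation :: "symbol list \<Rightarrow> symbol list \<Rightarrow> bool" where
  "word_relation [Chs, ChsOrd] []"
| "word_relation [Ham, HamOrd] []"
| "word_relation [Chs, HamOrd] [HamOrd, Chs]"
| "word_relation [Ham, ChsOrd] [ChsOrd, Ham]"
| "word_relation [Ham, Flex] [Ham, HamOrd]"
| "word_relation [Chs, Flex] [Chs, ChsOrd]"
| "word_relation [Ham, Stale] [Ham, ChsOrd]"
| "word_relation [Chs, Stale] [Chs, HamOrd]"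
| "word_relation [Ham, Dup] [Ham, Ham]"
| "word_relation [Chs, Dup] [Chs, Chs]"
| "word_relation [Ham, Opp] [Ham, Chs]"
| "word_relation [Chs, Opp] [Chs, Ham]"

definition word_equiv :: "symbol list \<Rightarrow> symbol list \<Rightarrow> bool" where
  "word_equiv = equivclp (\<lambda>u v. \<exists>a b l r. word_relation l r \<and> u = a @ l @ b \<and> v = a @ r @ b)"

definition reduced :: "symbol list \<Rightarrow> bool" where
  "reduced w \<longleftrightarrow> (\<forall>i < length w. \<forall>j < length w.
     w ! i \<notin> {Ham, Chs} \<and> w ! j \<in> {Ham, Chs} \<longrightarrow> i < j)"

definition reduce :: "symbol list \<Rightarrow> symbol list" where
  "reduce w = (THE r. reduced r \<and> word_equiv w r)"

definition ham_count :: "symbol list \<Rightarrow> int" where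
  "ham_count w = int (count_list w Ham) - int (count_list w HamOrd)"

definition chs_count :: "symbol list \<Rightarrow> int" where
  "chs_count w = int (count_list w Chs) - int (count_list w ChsOrd)"

section \<open>Identification\<close>

text \<open>The element of \<open>Theta0\<close> replacing the second symbol when it stands immediately to the
  right of the first one, which is meant to be \<open>Ham\<close> or \<open>Chs\<close>.\<close>

definition replacement :: "symbol \<Rightarrow> symbol \<Rightarrow> symbol" where
  "replacement b s = (case s of
     Dup \<Rightarrow> b
   | Opp \<Rightarrow> (if b = Ham then Chs else Ham)
   | Flex \<Rightarrow> (if b = Ham then HamOrd else ChsOrd)
   | Stale \<Rightarrow> (if b = Ham then ChsOrd else HamOrd)
   | _ \<Rightarrow> s)"

text \<open>Identification of \<open>s\<close> in the word \<open>w @ [s]\<close>; \<open>None\<close> if \<open>s\<close> is not identified.\<close>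

definition identification :: "symbol list \<Rightarrow> symbol \<Rightarrow> symbol option" where
  "identification w s =
    (if s \<in> Theta0 then Some s
     else let bs = filter (\<lambda>b. b \<in> {Ham, Chs}) (reduce w) in
       if bs = [] then None else Some (replacement (last bs) s))"

text \<open>Identification in a bi-infinite word: the common value of the identifications of \<open>x i\<close> in
  \<open>x (-m) \<dots> x i\<close> for all large \<open>m\<close>. In the random word below such a value exists
  almost surely.\<close>

definition identified_word :: "(int \<Rightarrow> symbol) \<Rightarrow> int \<Rightarrow> symbol" where
  "identified_word x i =
    (THE s. \<forall>\<^sub>F m in sequentially. identification (map x [- int m..i - 1]) (x i) = Some s)"

section \<open>The random word\<close>

definition param_set :: "(real \<times> real \<times> real \<times> real) set" where
  "param_set = {(pF, pS, pd, pe). pF \<in> {0..1} \<and> pS \<in> {0..1} \<and> pd \<in> {0..1} \<and> pe \<in> {0..1}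
     \<and> pF + pS \<le> 1 \<and> pd + pe < 1}"

fun symbol_prob :: "real \<times> real \<times> real \<times> real \<Rightarrow> symbol \<Rightarrow> real" where
  "symbol_prob (pF, pS, pd, pe) Flex = pF / 2"
| "symbol_prob (pF, pS, pd, pe) Stale = pS / 2"
| "symbol_prob (pF, pS, pd, pe) HamOrd = (1 - pF - pS) / 4"
| "symbol_prob (pF, pS, pd, pe) ChsOrd = (1 - pF - pS) / 4"
| "symbol_prob (pF, pS, pd, pe) Dup = pd / 2"
| "symbol_prob (pF, pS, pd, pe) Opp = pe / 2"
| "symbol_prob (pF, pS, pd, pe) Ham = (1 - pd - pe) / 4"
| "symbol_prob (pF, pS, pd, pe) Chs = (1 - pd - pe) / 4"

definition iid_word ::
  "'a measure \<Rightarrow> real \<times> real \<times> real \<times> real \<Rightarrow> (int \<Rightarrow> 'a \<Rightarrow> symbol) \<Rightarrow> bool" where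
  "iid_word M p X \<longleftrightarrow> prob_space M \<and>
     prob_space.indep_vars M (\<lambda>_. count_space UNIV) X UNIV \<and>
     (\<forall>i s. measure M {\<omega> \<in> space M. X i \<omega> = s} = symbol_prob p s)"

definition z_param :: "real \<Rightarrow> real \<Rightarrow> real" where
  "z_param pd pe = (1 + pd - pe) / (1 - pd + pe)"

section \<open>The walk\<close>

text \<open>\<open>D\<close> is \<open>ham_count\<close> or \<open>chs_count\<close>, and \<open>x'\<close> is an identified word.\<close>

definition walk :: "(symbol list \<Rightarrow> int) \<Rightarrow> (int \<Rightarrow> symbol) \<Rightarrow> int \<Rightarrow> int" where
  "walk D x' i =
    (if i \<ge> 1 then D (reduce (map x' [1..i]))
     else if i = 0 then 0
     else D (reduce (map x' [i + 1..0])))"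

definition interpolate :: "(int \<Rightarrow> int) \<Rightarrow> real \<Rightarrow> real" where
  "interpolate f t = (1 - frac t) * of_int (f \<lfloor>t\<rfloor>) + frac t * of_int (f (\<lfloor>t\<rfloor> + 1))"

definition scaled_walk :: "nat \<Rightarrow> (int \<Rightarrow> symbol) \<Rightarrow> real \<Rightarrow> real \<times> real" where
  "scaled_walk n x' t =
    (real n powr (-1/2) * interpolate (walk ham_count x') (real n * t),
     real n powr (-1/2) * interpolate (walk chs_count x') (real n * t))"

section \<open>Convergence in law\<close>

text \<open>Uniform convergence on compact sets, on the space of continuous functions.\<close>

definition compact_convergence :: "('a::topological_space \<Rightarrow> 'b::metric_space) topology" where
  "compact_convergence = topology (\<lambda>U. U \<subseteq> {f. continuous_on UNIV f} \<and>
     (\<forall>f\<in>U. \<exists>K \<epsilon>. compact K \<and> \<epsilon> > 0 \<and>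
        {g. continuous_on UNIV g \<and> (\<forall>t\<in>K. dist (f t) (g t) < \<epsilon>)} \<subseteq> U))"

lemma openin_compact_convergence:
  "openin compact_convergence U \<longleftrightarrow> U \<subseteq> {f. continuous_on UNIV f} \<and>
     (\<forall>f\<in>U. \<exists>K \<epsilon>. compact K \<and> \<epsilon> > 0 \<and>
        {g. continuous_on UNIV g \<and> (\<forall>t\<in>K. dist (f t) (g t) < \<epsilon>)} \<subseteq> U)"
proof -
  let ?N = "\<lambda>f K \<epsilon>. {g. continuous_on UNIV g \<and> (\<forall>t\<in>K. dist (f t) (g t) < \<epsilon>)}"
  let ?P = "\<lambda>U::('a \<Rightarrow> 'b) set. U \<subseteq> {f. continuous_on UNIV f} \<and>
     (\<forall>f\<in>U. \<exists>K \<epsilon>. compact K \<and> \<epsilon> > (0::real) \<and> ?N f K \<epsilon> \<subseteq> U)"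
  have "istopology ?P"
    unfolding istopology_def
  proof (intro conjI allI impI)
    fix S T assume S: "?P S" and T: "?P T"
    show "S \<inter> T \<subseteq> {f. continuous_on UNIV f}" using S by blast
    show "\<forall>f\<in>S \<inter> T. \<exists>K \<epsilon>. compact K \<and> \<epsilon> > 0 \<and> ?N f K \<epsilon> \<subseteq> S \<inter> T"
    proof
      fix f assume f: "f \<in> S \<inter> T"
      then have "f \<in> S" "f \<in> T" by simp_all
      obtain K1 e1 where 1: "compact K1" "e1 > 0" "?N f K1 e1 \<subseteq> S"
        using bspec[OF conjunct2[OF S] \<open>f \<in> S\<close>] by (elim exE conjE)
      obtain K2 e2 where 2: "compact K2" "e2 > 0" "?N f K2 e2 \<subseteq> T"
        using bspec[OF conjunct2[OF T] \<open>f \<in> T\<close>] by (elim exE conjE)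
      have "?N f (K1 \<union> K2) (min e1 e2) \<subseteq> ?N f K1 e1 \<inter> ?N f K2 e2" by auto
      also have "\<dots> \<subseteq> S \<inter> T" using 1(3) 2(3) by (rule Int_mono)
      finally have "?N f (K1 \<union> K2) (min e1 e2) \<subseteq> S \<inter> T" .
      moreover have "compact (K1 \<union> K2)" "min e1 e2 > 0"
        using 1(1,2) 2(1,2) by (simp_all add: compact_Un)
      ultimately show "\<exists>K \<epsilon>. compact K \<and> \<epsilon> > 0 \<and> ?N f K \<epsilon> \<subseteq> S \<inter> T"
        by (intro exI conjI)
    qed
  next
    fix \<K> assume A: "\<forall>U\<in>\<K>. ?P U"
    show "\<Union>\<K> \<subseteq> {f. continuous_on UNIV f}" using A by blast
    show "\<forall>f\<in>\<Union>\<K>. \<exists>K \<epsilon>. compact K \<and> \<epsilon> > 0 \<and> ?N f K \<epsilon> \<subseteq> \<Union>\<K>"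
    proof
      fix f assume "f \<in> \<Union>\<K>"
      then obtain U where U: "U \<in> \<K>" "f \<in> U" by blast
      obtain K e where K: "compact K" "e > 0" "?N f K e \<subseteq> U"
        using bspec[OF conjunct2[OF bspec[OF A U(1)]] U(2)] by (elim exE conjE)
      have "?N f K e \<subseteq> \<Union>\<K>" using K(3) Union_upper[OF U(1)] by (rule subset_trans)
      with K(1,2) show "\<exists>K \<epsilon>. compact K \<and> \<epsilon> > 0 \<and> ?N f K \<epsilon> \<subseteq> \<Union>\<K>"
        by (intro exI conjI)
    qed
  qed
  then show ?thesis
    unfolding compact_convergence_def by (simp add: topology_inverse')
qed

lemma topspace_compact_convergence: "topspace compact_convergence = {f. continuous_on UNIV f}"
proof (rule subset_antisym)
  show "topspace compact_convergence \<subseteq> {f :: 'a \<Rightarrow> 'b. continuous_on UNIV f}"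
    using openin_topspace openin_compact_convergence by (rule conjunct1[OF iffD1[rotated]])
  have "openin compact_convergence {f :: 'a \<Rightarrow> 'b. continuous_on UNIV f}"
    unfolding openin_compact_convergence
  proof (intro conjI ballI exI)
    show "compact ({} :: 'a set)" "(0::real) < 1" by simp_all
  qed blast+
  then show "{f :: 'a \<Rightarrow> 'b. continuous_on UNIV f} \<subseteq> topspace compact_convergence"
    by (rule openin_subset)
qed

definition borel_sets_of :: "'s topology \<Rightarrow> 's measure" where
  "borel_sets_of T = sigma (topspace T) {U. openin T U}"

definition converges_in_law ::
  "'s topology \<Rightarrow> 'a measure \<Rightarrow> (nat \<Rightarrow> 'a \<Rightarrow> 's) \<Rightarrow> 'b measure \<Rightarrow> ('b \<Rightarrow> 's) \<Rightarrow> bool" where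
  "converges_in_law T M Zn N Z \<longleftrightarrow>
     (\<forall>n. Zn n \<in> measurable M (borel_sets_of T)) \<and> Z \<in> measurable N (borel_sets_of T) \<and>
     (\<forall>\<Phi> :: 's \<Rightarrow> real. continuous_map T euclideanreal \<Phi> \<and> bounded (\<Phi> ` topspace T) \<longrightarrow>
        (\<lambda>n. \<integral>\<omega>. \<Phi> (Zn n \<omega>) \<partial>M) \<longlonglongrightarrow> (\<integral>\<omega>. \<Phi> (Z \<omega>) \<partial>N))"

section \<open>Two-sided correlated Brownian motion\<close>

definition covariance :: "'b measure \<Rightarrow> ('b \<Rightarrow> real) \<Rightarrow> ('b \<Rightarrow> real) \<Rightarrow> real" where
  "covariance N A B = prob_space.expectation N
     (\<lambda>\<omega>. (A \<omega> - prob_space.expectation N A) * (B \<omega> - prob_space.expectation N B))"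

text \<open>Centred normal law of variance \<open>v\<close>, including the point mass at 0 for \<open>v = 0\<close>.\<close>

definition centred_normal :: "'b measure \<Rightarrow> ('b \<Rightarrow> real) \<Rightarrow> real \<Rightarrow> bool" where
  "centred_normal N A v \<longleftrightarrow> A \<in> borel_measurable N \<and>
     (v = 0 \<and> (AE \<omega> in N. A \<omega> = 0) \<or>
      v > 0 \<and> distributed N lborel A (normal_density 0 (sqrt v)))"

text \<open>A continuous process on the whole real line with independent increments, such that
  \<open>Z t - Z s\<close> (for \<open>s < t\<close>) is a centred Gaussian vector with covariance matrix \<open>t - s\<close> times
  a fixed matrix with rows \<open>(q11, q12)\<close> and \<open>(q12, q22)\<close>. Gaussianity of a vector is expressed
  through its linear combinations.\<close>

definition two_sided_BM2 :: "'b measure \<Rightarrow> ('b \<Rightarrow> real \<Rightarrow> real \<times> real) \<Rightarrow> bool" where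
  "two_sided_BM2 N Z \<longleftrightarrow> prob_space N \<and>
     (\<forall>t. (\<lambda>\<omega>. Z \<omega> t) \<in> borel_measurable N) \<and>
     (\<forall>\<omega>\<in>space N. continuous_on UNIV (Z \<omega>)) \<and>
     (\<forall>k (t :: nat \<Rightarrow> real). (\<forall>i<k. t i < t (Suc i)) \<longrightarrow>
        prob_space.indep_vars N (\<lambda>_. borel) (\<lambda>i \<omega>. Z \<omega> (t (Suc i)) - Z \<omega> (t i)) {..<k}) \<and>
     (\<exists>q11 q12 q22. \<forall>s t a b. s < t \<longrightarrow>
        centred_normal N
          (\<lambda>\<omega>. a * fst (Z \<omega> t - Z \<omega> s) + b * snd (Z \<omega> t - Z \<omega> s))
          ((t - s) * (a\<^sup>2 * q11 + 2 * a * b * q12 + b\<^sup>2 * q22)))"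

end

(*
  With p_S = 1 every order is stale. A stale order consumes a burger of the type that is not on top of
  the stack, so the type of the top burger only depends on the burger symbols: writing it as a sign,
  h and c set it to 1 and - 1, d and S keep it, and e flips it. Moreover the difference of the two
  coordinates of the walk increases by exactly this sign at every step, while their sum is a simple
  random walk. So the walk is an additive functional of a two-state Markov chain.

  Its joint characteristic functions are computed with an explicit corrector for the transfer operator.
  Tightness follows from an exponential maximal inequality for two martingales with bounded increments.
  Convergence of all finite-dimensional characteristic functions together with tightness gives convergence
  in law without Prokhorov's theorem, because the limit process is given: on a compact set of equicontinuous
  paths, trigonometric polynomials of evaluations approximate any continuous functional (Stone-Weierstrass).
*)
theory Submission
  imports Defs
begin

section \<open>Measurability of continuous processes\<close>

text \<open>Write \<mu> = (1 + p_d - p_e) / 2 for the probability that a burger symbol keeps the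
  type of the top burger. An order always keeps it, so the sign is a symmetric chain with one-step
  autocorrelation 1/2 + (2 \<mu> - 1)/2 = \<mu>, and its sum has variance rate 1 + 2 (\<mu> +
  \<mu>^2 + ...) = (1 + \<mu>)/(1 - \<mu>) = 1 + 2 z, because z = \<mu>/(1 - \<mu>). The sum of the
  coordinates has rate 1, and sign symmetry makes the two uncorrelated in the limit, whence (1 + 1 +
  2 z)/4 = (1 + z)/2 and (1 - (1 + 2 z))/4 = - z/2. Two obstacles shape the proof. Increments over
  successive intervals are dependent through the sign, so every one-interval estimate carries an
  arbitrary bounded factor measurable with respect to the past; intervals are then split off one at
  a time. And steps left of the origin are counted with the same sign as those on the right, so 0 is
  made a point of every time grid and no interval straddles it; the quadratic limit does not see the
  remaining sign.\<close>

lemma rational_between_dist: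
  fixes x :: "real \<times> real" assumes "e > 0"
  obtains a b :: rat where "dist x (real_of_rat a, real_of_rat b) < e"
proof -
  have "e / 2 > 0" using assms by simp
  then obtain a b where ab: "a \<in> \<rat>" "fst x - e / 2 < a" "a < fst x + e / 2"
    "b \<in> \<rat>" "snd x - e / 2 < b" "b < snd x + e / 2"
    using Rats_dense_in_real[of "fst x - e / 2" "fst x + e / 2"]
      Rats_dense_in_real[of "snd x - e / 2" "snd x + e / 2"] by auto
  then obtain p q where pq: "a = real_of_rat p" "b = real_of_rat q" by (auto elim!: Rats_cases)
  have "dist x (a, b) \<le> dist (fst x) a + dist (snd x) b"
    by (cases x) (simp add: dist_Pair_Pair sqrt_sum_squares_le_sum)
  also have "\<dots> < e" using ab by (auto simp: dist_real_def abs_if)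
  finally show thesis using that pq by blast
qed

text \<open>The list \<open>qs\<close> holds the values of a step function on the cells of length \<open>1 / m\<close>, starting
  at \<open>- k\<close>. The centres need not be continuous, so rational step functions replace a countable dense set
  of paths.\<close>

definition step_set :: "nat \<times> nat \<times> nat \<times> (rat \<times> rat) list \<Rightarrow> (real \<Rightarrow> real \<times> real) set" where
  "step_set = (\<lambda>(k, m, r, qs). {g. continuous_on UNIV g \<and> (\<forall>t\<in>{- real k..real k}.
     dist (g t) (map_prod real_of_rat real_of_rat (qs ! nat (\<lfloor>real m * t\<rfloor> + int (k * m)))) \<le> 1 / real (Suc r))})"

text \<open>The index type of \<open>step_set\<close> is countable, so this reduces measurability to
  countably many sets. Given f in U with an \<epsilon>-tube over a compact window, a rational step
  function on a grid finer than the modulus of continuity of f stays within e of f, where 2 e <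
  \<epsilon>; its closed e-tube contains f and lies inside the \<epsilon>-tube of f.\<close>

lemma open_eq_Union_step_set:
  fixes U :: "(real \<Rightarrow> real \<times> real) set"
  assumes "openin compact_convergence U"
  shows "U = (\<Union>p\<in>{p. step_set p \<subseteq> U}. step_set p)"
proof (rule subset_antisym)
  show "U \<subseteq> (\<Union>p\<in>{p. step_set p \<subseteq> U}. step_set p)"
  proof
    fix f assume f: "f \<in> U"
    have U: "U \<subseteq> {f. continuous_on UNIV f}"
      "\<forall>f\<in>U. \<exists>K \<epsilon>. compact K \<and> \<epsilon> > 0 \<and> {g. continuous_on UNIV g \<and> (\<forall>t\<in>K. dist (f t) (g t) < \<epsilon>)} \<subseteq> U"
      using assms unfolding openin_compact_convergence by blast+
    have cf: "continuous_on UNIV f" using U(1) f by blast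
    obtain K \<epsilon> where K: "compact K" "\<epsilon> > 0" and sub: "{g. continuous_on UNIV g \<and> (\<forall>t\<in>K. dist (f t) (g t) < \<epsilon>)} \<subseteq> U"
      using U(2) f by meson
    obtain C where C: "\<And>t. t \<in> K \<Longrightarrow> norm t \<le> C"
      using compact_imp_bounded[OF K(1)] unfolding bounded_iff by blast
    obtain k :: nat where k: "C \<le> real k" using real_arch_simple by blast
    obtain r :: nat where r: "inverse (real (Suc r)) < \<epsilon> / 2" using reals_Archimedean[of "\<epsilon> / 2"] K(2) by auto
    define e where "e = 1 / real (Suc r)"
    have e: "e > 0" "2 * e < \<epsilon>" using r by (auto simp: e_def inverse_eq_divide)
    have "uniformly_continuous_on {- real k - 1..real k} f"
      by (intro compact_uniformly_continuous continuous_on_subset[OF cf]) auto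
    then obtain d where d: "d > 0" "\<And>s t. s \<in> {- real k - 1..real k} \<Longrightarrow> t \<in> {- real k - 1..real k} \<Longrightarrow>
        dist s t < d \<Longrightarrow> dist (f s) (f t) < e / 2"
      unfolding uniformly_continuous_on_def using e(1) by (metis half_gt_zero)
    obtain m0 :: nat where "inverse (real (Suc m0)) < d" using reals_Archimedean[of d] d(1) by auto
    then obtain m :: nat where m: "m > 0" "1 / real m < d" by (metis inverse_eq_divide zero_less_Suc)
    \<comment> \<open>A rational pair close to f at the left end of cell i: half of e is spent here,
      the other half on the oscillation of f within the cell.\<close>
    define q where "q = (\<lambda>i. SOME p :: rat \<times> rat.
        dist (f (real i / real m - real k)) (map_prod real_of_rat real_of_rat p) < e / 2)"
    have q: "dist (f (real i / real m - real k)) (map_prod real_of_rat real_of_rat (q i)) < e / 2" for i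
      unfolding q_def
    proof (rule someI_ex)
      obtain a b where "dist (f (real i / real m - real k)) (real_of_rat a, real_of_rat b) < e / 2"
        by (rule rational_between_dist[OF half_gt_zero[OF e(1)]])
      then show "\<exists>p. dist (f (real i / real m - real k)) (map_prod real_of_rat real_of_rat p) < e / 2"
        by (intro exI[of _ "(a, b)"]) simp
    qed
    \<comment> \<open>The index runs from 0 to 2 k m, and the last value occurs only at t = k, hence
      the extra cell.\<close>
    define qs where "qs = map q [0..<2 * k * m + 1]"
    have cell: "dist (f t) (map_prod real_of_rat real_of_rat (qs ! nat (\<lfloor>real m * t\<rfloor> + int (k * m)))) < e"
      if t: "t \<in> {- real k..real k}" for t
    proof -
      define i where "i = nat (\<lfloor>real m * t\<rfloor> + int (k * m))"
      have 1: "real m * t \<ge> - real (k * m)" "real m * t \<le> real (k * m)"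
        using mult_left_mono[of "- real k" t "real m"] mult_left_mono[of t "real k" "real m"] t
        by (auto simp: mult_ac)
      have fl: "\<lfloor>real m * t\<rfloor> \<ge> - int (k * m)" "\<lfloor>real m * t\<rfloor> \<le> int (k * m)"
        using 1 by (simp_all add: le_floor_iff floor_le_iff)
      then have i1: "int i = \<lfloor>real m * t\<rfloor> + int (k * m)" unfolding i_def by auto
      with fl(2) have "int i < 2 * int (k * m) + 1" by linarith
      also have "\<dots> = int (2 * k * m + 1)" by simp
      finally have i: "int i = \<lfloor>real m * t\<rfloor> + int (k * m)" "i < 2 * k * m + 1"
        using i1 by (simp_all only: of_nat_less_iff)
      then have ri: "real i = of_int \<lfloor>real m * t\<rfloor> + real (k * m)" by (metis of_int_add of_int_of_nat_eq)
      have "real i \<le> real m * t + real (k * m)" "real m * t + real (k * m) < real i + 1"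
        unfolding ri by linarith+
      then have "real i / real m \<le> t + real k" "t + real k < real i / real m + 1 / real m"
        using m(1) by (simp_all add: field_simps)
      then have b: "real i / real m - real k \<le> t" "t < real i / real m - real k + 1 / real m" by auto
      then have "dist t (real i / real m - real k) < d" using m(2) by (auto simp: dist_real_def)
      moreover have "real i / real m - real k \<in> {- real k - 1..real k}"
      proof -
        have "real i / real m \<ge> 0" by simp
        with b(1) t show ?thesis unfolding atLeastAtMost_iff by linarith
      qed
      ultimately have "dist (f t) (f (real i / real m - real k)) < e / 2" using t by (intro d(2)) auto
      with q[of i] have "dist (f t) (map_prod real_of_rat real_of_rat (q i)) < e"
        using dist_triangle[of "f t" "map_prod real_of_rat real_of_rat (q i)" "f (real i / real m - real k)"] by linarith
      then show ?thesis using i(2) unfolding i_def[symmetric] qs_def by (simp del: upt_Suc)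
    qed
    have "f \<in> step_set (k, m, r, qs)"
      using cf cell by (auto simp: step_set_def e_def less_imp_le)
    moreover have "step_set (k, m, r, qs) \<subseteq> U"
    proof
      fix g assume g: "g \<in> step_set (k, m, r, qs)"
      have "dist (f t) (g t) < \<epsilon>" if "t \<in> K" for t
      proof -
        have t: "t \<in> {- real k..real k}" using C[OF that] k by auto
        let ?p = "map_prod real_of_rat real_of_rat (qs ! nat (\<lfloor>real m * t\<rfloor> + int (k * m))) :: real \<times> real"
        have "dist (g t) ?p \<le> e" using g t by (auto simp: step_set_def e_def)
        with cell[OF t] e(2) dist_triangle2[of "f t" "g t" ?p] show ?thesis by linarith
      qed
      then show "g \<in> U" using g sub by (auto simp: step_set_def)
    qed
    ultimately show "f \<in> (\<Union>p\<in>{p. step_set p \<subseteq> U}. step_set p)" by blast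
  qed
qed blast

text \<open>Since h is constant just to the right of t, rational times slightly above t carry the
  value h t, and continuity of g closes the inequality. The right end k has no such neighbours
  inside the window, which is why k itself is rational.\<close>

lemma closed_condition_dense:
  fixes g :: "real \<Rightarrow> real \<times> real" and h :: "real \<Rightarrow> real \<times> real"
  assumes "continuous_on UNIV g" "k > 0"
    and h: "\<And>t. t < k \<Longrightarrow> \<exists>d>0. \<forall>s. t \<le> s \<and> s < t + d \<longrightarrow> h s = h t"
    and "\<And>t. t \<in> \<rat> \<inter> {-k..k} \<Longrightarrow> dist (g t) (h t) \<le> e" and "k \<in> \<rat>"
    and "t \<in> {-k..k}"
  shows "dist (g t) (h t) \<le> e"
proof (cases "t = k")
  case False
  then have tk: "t < k" using assms by auto
  obtain d where d: "d > 0" "\<And>s. t \<le> s \<Longrightarrow> s < t + d \<Longrightarrow> h s = h t" using h[OF tk] by blast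
  show ?thesis
  proof (rule ccontr)
    assume "\<not> ?thesis"
    then have pos: "dist (g t) (h t) - e > 0" by simp
    from assms(1) have "isCont g t" by (simp add: continuous_on_eq_continuous_at)
    then obtain d' where d': "d' > 0" "\<And>s. dist s t < d' \<Longrightarrow> dist (g s) (g t) < dist (g t) (h t) - e"
      using pos unfolding continuous_at_eps_delta by blast
    obtain s where s: "s \<in> \<rat>" "t < s" "s < min k (min (t + d) (t + d'))"
      using Rats_dense_in_real[of t "min k (min (t + d) (t + d'))"] tk d(1) d'(1) by auto
    have "dist (g s) (h t) \<le> e" using assms(4)[of s] s d(2)[of s] assms(6) by auto
    moreover have "dist (g s) (g t) < dist (g t) (h t) - e" using s by (intro d'(2)) (auto simp: dist_real_def)
    ultimately show False using dist_triangle3[of "g t" "h t" "g s"] by linarith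
  qed
qed (use assms in auto)

lemma floor_right_constant:
  assumes "(m :: real) \<ge> 0" shows "\<exists>d>0. \<forall>s. t \<le> s \<and> s < t + d \<longrightarrow> \<lfloor>m * s\<rfloor> = \<lfloor>m * t\<rfloor>"
proof (cases "m = 0")
  case False
  then have m: "m > 0" using assms by simp
  define d where "d = (of_int \<lfloor>m * t\<rfloor> + 1 - m * t) / m"
  have "d > 0" unfolding d_def using m by (intro divide_pos_pos) linarith+
  moreover have "\<lfloor>m * s\<rfloor> = \<lfloor>m * t\<rfloor>" if "t \<le> s" "s < t + d" for s
  proof -
    have "m * t \<le> m * s" using m that(1) by simp
    moreover have "m * s < of_int \<lfloor>m * t\<rfloor> + 1" using that(2) m unfolding d_def by (simp add: field_simps)
    ultimately show ?thesis by linarith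
  qed
  ultimately show ?thesis by blast
qed (auto intro: exI[of _ 1])

text \<open>Single-time evaluations suffice: an open set is a countable union of step sets, and
  membership of a continuous path in a step set can be tested at rational times.\<close>

theorem measurable_path:
  fixes Y :: "'a \<Rightarrow> real \<Rightarrow> real \<times> real"
  assumes meas [measurable]: "\<And>t. (\<lambda>\<omega>. Y \<omega> t) \<in> borel_measurable M"
    and cont: "\<And>\<omega>. \<omega> \<in> space M \<Longrightarrow> continuous_on UNIV (Y \<omega>)"
  shows "Y \<in> measurable M (borel_sets_of compact_convergence)"
  unfolding borel_sets_of_def
proof (rule measurable_sigma_sets)
  show "sets (sigma (topspace compact_convergence) {U. openin compact_convergence U}) =
      sigma_sets (topspace compact_convergence) {U. openin compact_convergence (U :: (real \<Rightarrow> real \<times> real) set)}"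
    by (intro sets_measure_of) (auto dest: openin_subset)
  show "{U. openin compact_convergence U} \<subseteq> Pow (topspace compact_convergence)"
    by (auto dest: openin_subset)
  show "Y \<in> space M \<rightarrow> topspace compact_convergence"
    using cont by (auto simp: topspace_compact_convergence)
  fix U :: "(real \<Rightarrow> real \<times> real) set" assume "U \<in> {U. openin compact_convergence U}"
  then have U: "U = (\<Union>p\<in>{p. step_set p \<subseteq> U}. step_set p)" using open_eq_Union_step_set by auto
  have step: "Y -` step_set p \<inter> space M \<in> sets M" for p
  proof -
    obtain k m r qs where p: "p = (k, m, r, qs)" by (cases p) auto
    define h where "h = (\<lambda>t. map_prod real_of_rat real_of_rat (qs ! nat (\<lfloor>real m * t\<rfloor> + int (k * m))) :: real \<times> real)"
    have step: "\<exists>d>0. \<forall>s. t \<le> s \<and> s < t + d \<longrightarrow> h s = h t" for t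
    proof -
      obtain d where d: "d > 0" "\<forall>s. t \<le> s \<and> s < t + d \<longrightarrow> \<lfloor>real m * s\<rfloor> = \<lfloor>real m * t\<rfloor>"
        using floor_right_constant[OF of_nat_0_le_iff, of t m] by blast
      have "h s = h t" if "t \<le> s \<and> s < t + d" for s
        unfolding h_def by (simp only: d(2)[rule_format, OF that])
      with d(1) show ?thesis by blast
    qed
    have eq: "(\<forall>t\<in>{- real k..real k}. dist (Y \<omega> t) (h t) \<le> 1 / real (Suc r)) \<longleftrightarrow>
        (\<forall>t\<in>\<rat> \<inter> {- real k..real k}. dist (Y \<omega> t) (h t) \<le> 1 / real (Suc r))" if "\<omega> \<in> space M" for \<omega>
    \<comment> \<open>For k = 0 the window is the single rational time 0, so the two conditions
      coincide.\<close>
    proof (cases "k = 0")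
      case False
      then have k: "real k > 0" "real k \<in> \<rat>" by simp_all
      show ?thesis
      proof (intro iffI ballI)
        fix t assume "\<forall>t\<in>\<rat> \<inter> {- real k..real k}. dist (Y \<omega> t) (h t) \<le> 1 / real (Suc r)"
          and "t \<in> {- real k..real k}"
        then show "dist (Y \<omega> t) (h t) \<le> 1 / real (Suc r)"
          using closed_condition_dense[OF cont[OF that] k(1) step _ k(2)] by blast
      qed simp
    qed auto
    have "Y -` step_set p \<inter> space M =
        {\<omega> \<in> space M. \<forall>t\<in>\<rat> \<inter> {- real k..real k}. dist (Y \<omega> t) (h t) \<le> 1 / real (Suc r)}"
    proof -
      have "step_set p = {g. continuous_on UNIV g \<and> (\<forall>t\<in>{- real k..real k}. dist (g t) (h t) \<le> 1 / real (Suc r))}"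
        by (simp add: p step_set_def h_def)
      with eq cont show ?thesis by blast
    qed
    also have "\<dots> \<in> sets M"
      by (intro sets.sets_Collect_countable_All' countable_Int1 countable_rat) measurable
    finally show ?thesis .
  qed
  have "Y -` U \<inter> space M = (\<Union>p\<in>{p. step_set p \<subseteq> U}. Y -` step_set p \<inter> space M)"
    by (subst U) auto
  also have "\<dots> \<in> sets M" using step by (intro sets.countable_UN') auto
  finally show "Y -` U \<inter> space M \<in> sets M" .
qed

section \<open>A criterion for convergence in law\<close>

inductive linear_eval :: "((real \<Rightarrow> real \<times> real) \<Rightarrow> real) \<Rightarrow> bool" where
  eval: "linear_eval (\<lambda>f. a * fst (f t) + b * snd (f t))"
| add: "linear_eval L \<Longrightarrow> linear_eval L' \<Longrightarrow> linear_eval (\<lambda>f. L f + L' f)"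

text \<open>The complex span of the characters \<open>cis (L f)\<close>. It is closed under
  products, hence an algebra for Stone-Weierstrass, and expectations of its members are linear
  combinations of joint characteristic functions.\<close>

inductive trig :: "((real \<Rightarrow> real \<times> real) \<Rightarrow> complex) \<Rightarrow> bool" where
  cis: "linear_eval L \<Longrightarrow> trig (\<lambda>f. cis (L f))"
| scale: "trig P \<Longrightarrow> trig (\<lambda>f. c * P f)"
| add: "trig P \<Longrightarrow> trig Q \<Longrightarrow> trig (\<lambda>f. P f + Q f)"

lemma trig_mult_cis: "trig P \<Longrightarrow> linear_eval L \<Longrightarrow> trig (\<lambda>f. cis (L f) * P f)"
proof (induction rule: trig.induct)
  case (cis L')
  then show ?case using trig.cis[OF linear_eval.add, of L L'] by (simp add: cis_mult)
next
  case (scale P c)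
  then show ?case using trig.scale[of "\<lambda>f. cis (L f) * P f" c] by (simp add: mult_ac)
next
  case (add P Q)
  then show ?case using trig.add[of "\<lambda>f. cis (L f) * P f" "\<lambda>f. cis (L f) * Q f"] by (simp add: algebra_simps)
qed

lemma trig_mult: "trig P \<Longrightarrow> trig Q \<Longrightarrow> trig (\<lambda>f. P f * Q f)"
proof (induction rule: trig.induct)
  case (cis L) then show ?case by (intro trig_mult_cis)
next
  case (scale P c)
  then show ?case using trig.scale[of "\<lambda>f. P f * Q f" c] by (simp add: mult_ac)
next
  case (add P P')
  then show ?case using trig.add[of "\<lambda>f. P f * Q f" "\<lambda>f. P' f * Q f"] by (simp add: algebra_simps)
qed

lemma trig_const: "trig (\<lambda>_. c)"
  using trig.scale[OF trig.cis[OF linear_eval.eval[of 0 0 0]], of c] by simp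

text \<open>Euler's formula. Sines are the real-valued members with which points are separated
  later.\<close>

lemma trig_sin: "linear_eval L \<Longrightarrow> linear_eval (\<lambda>f. - L f) \<Longrightarrow> trig (\<lambda>f. complex_of_real (sin (L f)))"
proof -
  assume L: "linear_eval L" "linear_eval (\<lambda>f. - L f)"
  have "complex_of_real (sin x) = (- \<i> / 2) * cis x + (\<i> / 2) * cis (- x)" for x
    by (simp add: complex_eq_iff)
  then show ?thesis
    using trig.add[OF trig.scale[OF trig.cis[OF L(1)], of "- \<i> / 2"] trig.scale[OF trig.cis[OF L(2)], of "\<i> / 2"]]
    by simp
qed

text \<open>The topology on functions is that of pointwise convergence, for which evaluations are
  coordinate maps.\<close>

lemma continuous_linear_eval: "linear_eval L \<Longrightarrow> continuous_on UNIV L"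
  by (induction rule: linear_eval.induct) (intro continuous_intros continuous_on_product_coordinates; simp)+

lemma continuous_trig: "trig P \<Longrightarrow> continuous_on UNIV P"
  by (induction rule: trig.induct) (auto intro!: continuous_intros continuous_linear_eval simp: cis_conv_exp)

lemma measurable_linear_eval:
  assumes "linear_eval L" and [measurable]: "\<And>t. (\<lambda>\<omega>. Y \<omega> t) \<in> borel_measurable M"
  shows "(\<lambda>\<omega>. L (Y \<omega>)) \<in> borel_measurable M"
  using assms(1)
proof induction
  case (eval a t b)
  have [measurable]: "(\<lambda>\<omega>. fst (Y \<omega> t)) \<in> borel_measurable M" "(\<lambda>\<omega>. snd (Y \<omega> t)) \<in> borel_measurable M"
    unfolding borel_prod[symmetric] by (intro measurable_compose[OF assms(2)[unfolded borel_prod[symmetric]]] measurable_fst measurable_snd)+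
  show ?case by measurable
qed simp

lemma measurable_trig:
  assumes "trig P" and "\<And>t. (\<lambda>\<omega>. Y \<omega> t) \<in> borel_measurable M"
  shows "(\<lambda>\<omega>. P (Y \<omega>)) \<in> borel_measurable M"
  using assms(1)
proof induction
  case (cis L)
  have [measurable]: "(\<lambda>\<omega>. L (Y \<omega>)) \<in> borel_measurable M"
    using measurable_linear_eval[OF cis assms(2)] .
  show ?case unfolding cis_conv_exp by measurable
qed simp_all

lemma bounded_trig: "trig P \<Longrightarrow> \<exists>B. \<forall>f. cmod (P f) \<le> B"
proof (induction rule: trig.induct)
  case (scale P c)
  then obtain B where "\<forall>f. cmod (P f) \<le> B" by blast
  then show ?case by (intro exI[of _ "cmod c * B"]) (auto simp: norm_mult intro: mult_left_mono)
next
  case (add P Q)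
  then obtain B C where "\<forall>f. cmod (P f) \<le> B" "\<forall>f. cmod (Q f) \<le> C" by blast
  then show ?case by (intro exI[of _ "B + C"]) (auto intro: norm_triangle_le add_mono)
qed (auto intro: exI[of _ 1])

lemma (in prob_space) integrable_trig:
  assumes "trig P" and "\<And>t. (\<lambda>\<omega>. Y \<omega> t) \<in> borel_measurable M"
  shows "integrable M (\<lambda>\<omega>. P (Y \<omega>))"
proof -
  obtain B where "\<forall>f. cmod (P f) \<le> B" using bounded_trig[OF assms(1)] by blast
  then show ?thesis using measurable_trig[OF assms] by (intro integrable_const_bound[of _ B]) auto
qed

lemma trig_convergence:
  assumes "prob_space M" "prob_space N"
    and Y: "\<And>n t. (\<lambda>\<omega>. Y n \<omega> t) \<in> borel_measurable M"
    and Z: "\<And>t. (\<lambda>\<omega>. Z \<omega> t) \<in> borel_measurable N"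
    and conv: "\<And>L. linear_eval L \<Longrightarrow> (\<lambda>n. \<integral>\<omega>. cis (L (Y n \<omega>)) \<partial>M) \<longlonglongrightarrow> (\<integral>\<omega>. cis (L (Z \<omega>)) \<partial>N)"
    and "trig P"
  shows "(\<lambda>n. \<integral>\<omega>. P (Y n \<omega>) \<partial>M) \<longlonglongrightarrow> (\<integral>\<omega>. P (Z \<omega>) \<partial>N)"
  using \<open>trig P\<close>
proof induction
  case (cis L) then show ?case by (rule conv)
next
  case (scale P c) then show ?case by (auto intro: tendsto_mult_left)
next
  case (add P Q)
  interpret M: prob_space M by fact
  interpret N: prob_space N by fact
  have "integrable M (\<lambda>\<omega>. R (Y n \<omega>))" "integrable N (\<lambda>\<omega>. R (Z \<omega>))" if "trig R" for R n
    by (rule M.integrable_trig[OF that], rule Y) (rule N.integrable_trig[OF that], rule Z)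
  with add show ?case by (simp add: tendsto_add)
qed

section \<open>Compact sets of paths\<close>

text \<open>An Arzela-Ascoli set encoded by one sequence: the index j fixes both the window of
  radius j + 1 and the accuracy 1/(j + 1). Larger windows come with finer accuracies, so continuity
  everywhere is still forced. Starting at 0 turns the moduli into pointwise bounds.\<close>

definition equicontinuous_paths :: "(nat \<Rightarrow> real) \<Rightarrow> (real \<Rightarrow> real \<times> real) set" where
  "equicontinuous_paths \<delta> = {f. f 0 = 0 \<and> (\<forall>j. \<forall>s\<in>{-real (Suc j)..real (Suc j)}. \<forall>t\<in>{-real (Suc j)..real (Suc j)}.
     \<bar>s - t\<bar> \<le> \<delta> j \<longrightarrow> dist (f s) (f t) \<le> 1 / real (Suc j))}"

lemma equicontinuous_pathsD:
  assumes "f \<in> equicontinuous_paths \<delta>" "\<bar>s\<bar> \<le> real (Suc j)" "\<bar>t\<bar> \<le> real (Suc j)" "\<bar>s - t\<bar> \<le> \<delta> j"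
  shows "dist (f s) (f t) \<le> 1 / real (Suc j)"
  using assms unfolding equicontinuous_paths_def abs_le_iff by auto

lemma obtain_index:
  assumes "(e::real) > 0" obtains j :: nat where "C \<le> real (Suc j)" "1 / real (Suc j) < e"
proof -
  obtain k :: nat where k: "inverse (real (Suc k)) < e" using reals_Archimedean[OF assms] by auto
  obtain l :: nat where l: "C \<le> real l" using real_arch_simple by blast
  have "1 / real (Suc (k + l)) \<le> 1 / real (Suc k)" by (simp add: field_simps)
  with k l that[of "k + l"] show thesis by (auto simp: inverse_eq_divide)
qed

text \<open>The time t is reached from 0 in N + 1 equal steps no longer than
  \<open>\<delta> j\<close>, each moving the path by at most 1/(j + 1).\<close>

lemma equicontinuous_paths_bounded:
  assumes "\<And>j. \<delta> j > 0"
  shows "\<exists>B. \<forall>f\<in>equicontinuous_paths \<delta>. dist 0 (f t) \<le> B"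
proof -
  obtain j :: nat where j: "\<bar>t\<bar> \<le> real (Suc j)" using obtain_index[of 1] by auto
  obtain N :: nat where N: "\<bar>t\<bar> / \<delta> j \<le> real N" using real_arch_simple by blast
  have "dist 0 (f t) \<le> real (Suc N) / real (Suc j)" if f: "f \<in> equicontinuous_paths \<delta>" for f
  proof -
    have "dist 0 (f (real i * t / real (Suc N))) \<le> real i / real (Suc j)" if "i \<le> Suc N" for i
      using that
    proof (induction i)
      case (Suc i)
      have le: "\<bar>real k * t / real (Suc N)\<bar> \<le> real (Suc j)" if "k \<le> Suc N" for k
      proof -
        have "\<bar>real k * t / real (Suc N)\<bar> = (real k / real (Suc N)) * \<bar>t\<bar>" by (simp add: abs_mult)
        also have "\<dots> \<le> 1 * \<bar>t\<bar>" using that by (intro mult_right_mono) auto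
        finally show ?thesis using j by simp
      qed
      have "real i * t / real (Suc N) - real (Suc i) * t / real (Suc N) = - t / real (Suc N)"
        unfolding diff_divide_distrib[symmetric] by (simp add: algebra_simps del: minus_divide_left)
      moreover have "\<bar>t\<bar> / real (Suc N) \<le> \<delta> j" using N assms[of j] by (simp add: field_simps)
      ultimately have "\<bar>real i * t / real (Suc N) - real (Suc i) * t / real (Suc N)\<bar> \<le> \<delta> j" by simp
      then have "dist (f (real i * t / real (Suc N))) (f (real (Suc i) * t / real (Suc N))) \<le> 1 / real (Suc j)"
        using Suc.prems by (intro equicontinuous_pathsD[OF f] le) auto
      moreover have "dist 0 (f (real i * t / real (Suc N))) \<le> real i / real (Suc j)" using Suc by simp
      moreover have "real (Suc i) / real (Suc j) = real i / real (Suc j) + 1 / real (Suc j)"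
        by (simp add: add_divide_distrib)
      ultimately show ?case
        using dist_triangle[of 0 "f (real (Suc i) * t / real (Suc N))" "f (real i * t / real (Suc N))"] by linarith
    qed (use f in \<open>simp add: equicontinuous_paths_def\<close>)
    from this[of "Suc N"] show ?thesis by simp
  qed
  then show ?thesis by blast
qed

text \<open>For pointwise convergence this is Tychonoff: the set is a closed subset of the product
  of the balls of radius \<open>B t\<close>, being cut out by conditions on at most two coordinates
  each.\<close>

lemma compact_equicontinuous_paths:
  assumes "\<And>j. \<delta> j > 0"
  shows "compact (equicontinuous_paths \<delta>)"
proof -
  have "\<exists>B. \<forall>t. \<forall>f\<in>equicontinuous_paths \<delta>. dist 0 (f t) \<le> B t"
    by (intro choice allI equicontinuous_paths_bounded assms)
  then obtain B where B: "\<And>t f. f \<in> equicontinuous_paths \<delta> \<Longrightarrow> dist 0 (f t) \<le> B t" by blast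
  have "compactin (product_topology (\<lambda>_. euclidean) UNIV) (PiE UNIV (\<lambda>t::real. cball (0 :: real \<times> real) (B t)))"
    unfolding compactin_PiE by simp
  then have "compact (PiE UNIV (\<lambda>t::real. cball (0 :: real \<times> real) (B t)))"
    by (simp only: euclidean_product_topology compactin_euclidean_iff)
  moreover have "closed (equicontinuous_paths \<delta>)"
  proof -
    let ?I = "{(j, s, t). \<bar>s\<bar> \<le> real (Suc j) \<and> \<bar>t\<bar> \<le> real (Suc j) \<and> \<bar>s - t\<bar> \<le> \<delta> j}"
    have "equicontinuous_paths \<delta> = {f. f 0 = 0} \<inter>
        (\<Inter>(j, s, t)\<in>?I. {f. dist (f s) (f t) \<le> 1 / real (Suc j)})"
      unfolding equicontinuous_paths_def abs_le_iff by auto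
    moreover have "closed {f :: real \<Rightarrow> real \<times> real. f 0 = 0}"
      by (intro closed_Collect_eq continuous_on_const continuous_on_product_coordinates)
    moreover have "closed {f :: real \<Rightarrow> real \<times> real. dist (f s) (f t) \<le> c}" for s t c
      by (intro closed_Collect_le continuous_on_dist continuous_on_const continuous_on_product_coordinates)
    ultimately show ?thesis by (simp only:) (intro closed_Int closed_INT ballI; auto)
  qed
  moreover have "equicontinuous_paths \<delta> = PiE UNIV (\<lambda>t. cball 0 (B t)) \<inter> equicontinuous_paths \<delta>"
    using B by auto
  ultimately show ?thesis by (metis compact_Int_closed)
qed

lemma equicontinuous_paths_continuous:
  assumes "\<And>j. \<delta> j > 0" "f \<in> equicontinuous_paths \<delta>"
  shows "continuous_on UNIV f"
proof -
  have "\<exists>d>0. \<forall>s. dist s t < d \<longrightarrow> dist (f s) (f t) < e" if e: "e > 0" for e t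
  proof -
    obtain j where j: "\<bar>t\<bar> + 1 \<le> real (Suc j)" "1 / real (Suc j) < e" using obtain_index[OF e] by metis
    have "dist (f s) (f t) < e" if "dist s t < min 1 (\<delta> j)" for s
    proof -
      have "\<bar>s\<bar> \<le> real (Suc j)" "\<bar>t\<bar> \<le> real (Suc j)" "\<bar>s - t\<bar> \<le> \<delta> j"
        using j(1) that unfolding dist_real_def by linarith+
      from equicontinuous_pathsD[OF assms(2) this] j(2) show ?thesis by linarith
    qed
    with assms(1)[of j] show ?thesis by (intro exI[of _ "min 1 (\<delta> j)"]) auto
  qed
  then show ?thesis unfolding continuous_on_iff by blast
qed

text \<open>On an equicontinuous set the topology of pointwise convergence is that of locally uniform
  convergence.\<close>

lemma continuous_on_equicontinuous_paths:
  assumes \<delta>: "\<And>j. \<delta> j > 0" and \<Phi>: "continuous_map compact_convergence euclideanreal \<Phi>"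
  shows "continuous_on (equicontinuous_paths \<delta>) \<Phi>"
  unfolding continuous_on_topological
proof (intro ballI allI impI)
  fix f V assume f: "f \<in> equicontinuous_paths \<delta>" and V: "open V" "\<Phi> f \<in> V"
  have cf: "continuous_on UNIV f" by (rule equicontinuous_paths_continuous[OF \<delta> f])
  define U where "U = {g \<in> topspace compact_convergence. \<Phi> g \<in> V}"
  have U: "openin compact_convergence U"
    unfolding U_def using \<Phi> V(1) by (intro openin_continuous_map_preimage[OF \<Phi>]) simp
  have fU: "f \<in> U" using cf V by (simp add: U_def topspace_compact_convergence)
  obtain K \<epsilon> where K: "compact K" "\<epsilon> > 0" and sub: "{g. continuous_on UNIV g \<and> (\<forall>t\<in>K. dist (f t) (g t) < \<epsilon>)} \<subseteq> U"
    using U[unfolded openin_compact_convergence] fU by meson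
  obtain C where C: "\<And>t. t \<in> K \<Longrightarrow> norm t \<le> C"
    using compact_imp_bounded[OF K(1)] unfolding bounded_iff by blast
  have "\<epsilon> / 4 > 0" using K(2) by simp
  then obtain j where j: "C \<le> real (Suc j)" "1 / real (Suc j) < \<epsilon> / 4" using obtain_index by metis
  \<comment> \<open>Closeness on a finite net of mesh \<open>\<delta> j\<close> is open for
    pointwise convergence. Passing between a point and the net costs less than \<epsilon>/4 on each
    of the two paths, so three quarters of \<epsilon> are used in total.\<close>
  obtain P where P: "finite P" "P \<subseteq> {-real (Suc j)..real (Suc j)}" "{-real (Suc j)..real (Suc j)} \<subseteq> (\<Union>p\<in>P. ball p (\<delta> j))"
    using seq_compact_imp_totally_bounded[OF compact_imp_seq_compact[OF compact_Icc[of "-real (Suc j)" "real (Suc j)"]],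
      rule_format, OF \<delta>[of j]] by blast
  define A where "A = (\<Inter>p\<in>P. {g :: real \<Rightarrow> real \<times> real. dist (f p) (g p) < \<epsilon> / 4})"
  have "open A" unfolding A_def using P(1)
    by (intro open_INT ballI open_Collect_less continuous_intros continuous_on_product_coordinates)
  moreover have "f \<in> A" using K(2) by (simp add: A_def)
  moreover have "\<Phi> g \<in> V" if g: "g \<in> equicontinuous_paths \<delta>" "g \<in> A" for g
  proof -
    have "dist (f t) (g t) < \<epsilon>" if "t \<in> K" for t
    proof -
      have t: "\<bar>t\<bar> \<le> real (Suc j)" using C[OF that] j(1) by simp
      then have "t \<in> {-real (Suc j)..real (Suc j)}" unfolding atLeastAtMost_iff by linarith
      then obtain p where p: "p \<in> P" "dist p t < \<delta> j" using P(3) by auto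
      have "p \<in> {-real (Suc j)..real (Suc j)}" using P(2) p(1) by blast
      then have "\<bar>p\<bar> \<le> real (Suc j)" unfolding atLeastAtMost_iff by linarith
      moreover have "\<bar>t - p\<bar> \<le> \<delta> j" "\<bar>p - t\<bar> \<le> \<delta> j" using p(2) by (auto simp: dist_real_def)
      ultimately have "dist (f t) (f p) \<le> 1 / real (Suc j)" "dist (g p) (g t) \<le> 1 / real (Suc j)"
        using equicontinuous_pathsD[OF f t] equicontinuous_pathsD[OF g(1) _ t] by blast+
      moreover have "dist (f p) (g p) < \<epsilon> / 4" using g(2) p(1) by (auto simp: A_def)
      ultimately show ?thesis
        using j(2) K(2) dist_triangle[of "f t" "g t" "f p"] dist_triangle[of "f p" "g t" "g p"] by linarith
    qed
    then have "g \<in> U" using sub equicontinuous_paths_continuous[OF \<delta> g(1)] by blast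
    then show ?thesis by (simp add: U_def)
  qed
  ultimately show "\<exists>A. open A \<and> f \<in> A \<and> (\<forall>g\<in>equicontinuous_paths \<delta>. g \<in> A \<longrightarrow> \<Phi> g \<in> V)" by blast
qed

section \<open>Approximation of continuous functionals\<close>

lemma trig_polynomial:
  fixes p :: "real \<Rightarrow> real"
  assumes "real_polynomial_function p" and P: "trig (\<lambda>f. complex_of_real (P f))"
  shows "trig (\<lambda>f. complex_of_real (p (P f)))"
  using assms(1)
proof induction
  case (linear q)
  then obtain c where "q = (\<lambda>x. x * c)" by (auto simp: real_bounded_linear)
  then show ?case using trig.scale[OF P, of "complex_of_real c"] by (simp add: mult.commute)
next
  case (const c) show ?case by (rule trig_const)
next
  case (add q r) then show ?case by (simp add: trig.add)
next
  case (mult q r) then show ?case by (simp add: trig_mult)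
qed

text \<open>Scaling both numbers into [-1, 1] puts them in a range where the sine is
  injective.\<close>

lemma sin_separates: assumes "(u::real) \<noteq> v" obtains \<theta> where "sin (\<theta> * u) \<noteq> sin (\<theta> * v)"
proof -
  define \<theta> where "\<theta> = 1 / (\<bar>u\<bar> + \<bar>v\<bar> + 1)"
  have \<theta>: "\<theta> > 0" by (auto simp: \<theta>_def intro!: divide_pos_pos)
  have "\<bar>\<theta> * u\<bar> \<le> 1" "\<bar>\<theta> * v\<bar> \<le> 1" by (auto simp: \<theta>_def abs_mult divide_le_eq)
  then have "- (pi / 2) \<le> \<theta> * u" "\<theta> * u \<le> pi / 2" "- (pi / 2) \<le> \<theta> * v" "\<theta> * v \<le> pi / 2"
    using pi_gt3 by (auto simp: abs_le_iff)
  then have "sin (\<theta> * u) = sin (\<theta> * v) \<Longrightarrow> \<theta> * u = \<theta> * v" by (rule sin_inj_pi)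
  with \<theta> assms that show thesis by auto
qed

text \<open>Stone-Weierstrass controls the approximation on the compact set only; composing with a polynomial
  approximation of a truncation makes it uniformly bounded on all paths.\<close>

lemma trig_approximation:
  assumes \<delta>: "\<And>j. \<delta> j > 0" and \<Phi>: "continuous_on (equicontinuous_paths \<delta>) \<Phi>"
    and B: "\<And>f. f \<in> equicontinuous_paths \<delta> \<Longrightarrow> \<bar>\<Phi> f\<bar> \<le> B" "B \<ge> 0" and e: "e > 0"
  obtains Q where "trig (\<lambda>f. complex_of_real (Q f))" "\<And>f. f \<in> equicontinuous_paths \<delta> \<Longrightarrow> \<bar>\<Phi> f - Q f\<bar> < e"
    "\<And>f. \<bar>Q f\<bar> \<le> B + e"
proof -
  let ?K = "equicontinuous_paths \<delta>"
  \<comment> \<open>Restriction to rational times lands in a countable product, which is a metric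
    space, and it is injective on continuous paths. On the compact set it is therefore a
    homeomorphism onto the image, and Stone-Weierstrass is applied there.\<close>
  define \<rho> where "\<rho> = (\<lambda>(f :: real \<Rightarrow> real \<times> real) (q :: rat). f (real_of_rat q))"
  have \<rho>_cont: "continuous_on UNIV \<rho>"
    unfolding \<rho>_def by (intro continuous_on_coordinatewise_then_product continuous_on_product_coordinates)
  have "inj_on \<rho> ?K"
  proof (rule inj_onI)
    fix f g assume f: "f \<in> ?K" and g: "g \<in> ?K" and "\<rho> f = \<rho> g"
    then have "\<rat> \<subseteq> {t. f t = g t}" by (auto simp: \<rho>_def fun_eq_iff elim!: Rats_cases)
    moreover have "closed {t. f t = g t}"
      using equicontinuous_paths_continuous[OF \<delta>] f g by (intro closed_Collect_eq)
    ultimately have "UNIV \<subseteq> {t. f t = g t}" using closure_minimal Rats_closure_real by metis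
    then show "f = g" by auto
  qed
  then have inv: "\<forall>f\<in>?K. inv_into ?K \<rho> (\<rho> f) = f" by simp
  have K: "compact ?K" by (rule compact_equicontinuous_paths[OF \<delta>])
  have inv_cont: "continuous_on (\<rho> ` ?K) (inv_into ?K \<rho>)"
    using continuous_on_inv[where f=\<rho> and g="inv_into ?K \<rho>", OF continuous_on_subset[OF \<rho>_cont subset_UNIV] K inv] .
  have via: "continuous_on (\<rho> ` ?K) (\<lambda>x. h (inv_into ?K \<rho> x))" if "continuous_on ?K h"
    for h :: "(real \<Rightarrow> real \<times> real) \<Rightarrow> real"
    using inv by (intro continuous_on_compose2[OF that inv_cont]) auto
  let ?trig = "\<lambda>p. trig (\<lambda>f. complex_of_real (p (\<rho> f)))"
  have "\<exists>p. ?trig p \<and> (\<forall>x\<in>\<rho> ` ?K. \<bar>\<Phi> (inv_into ?K \<rho> x) - p x\<bar> < e / 2)"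
  proof (rule Stone_Weierstrass_HOL)
    show "compact (\<rho> ` ?K)"
      by (rule compact_continuous_image[OF continuous_on_subset[OF \<rho>_cont] K]) simp
    show "continuous_on (\<rho> ` ?K) p" if p: "?trig p" for p
    proof -
      have "continuous_on ?K (\<lambda>f. p (\<rho> f))"
        using continuous_on_Re[OF continuous_on_subset[OF continuous_trig[OF p]]] by simp
      from via[OF this] have "continuous_on (\<rho> ` ?K) (\<lambda>x. p (\<rho> (inv_into ?K \<rho> x)))" .
      then show ?thesis by (rule continuous_on_eq) (auto simp: f_inv_into_f)
    qed
    fix x y assume "x \<in> \<rho> ` ?K \<and> y \<in> \<rho> ` ?K \<and> x \<noteq> y"
    then obtain q where "x q \<noteq> y q" by blast
    then have "1 * fst (x q) + 0 * snd (x q) \<noteq> 1 * fst (y q) + 0 * snd (y q) \<or>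
        0 * fst (x q) + 1 * snd (x q) \<noteq> 0 * fst (y q) + 1 * snd (y q)"
      by (simp add: prod_eq_iff)
    then obtain a b :: real where ab: "a * fst (x q) + b * snd (x q) \<noteq> a * fst (y q) + b * snd (y q)"
      by blast
    then obtain \<theta> where \<theta>: "sin (\<theta> * (a * fst (x q) + b * snd (x q))) \<noteq> sin (\<theta> * (a * fst (y q) + b * snd (y q)))"
      by (rule sin_separates)
    let ?L = "\<lambda>f :: real \<Rightarrow> real \<times> real. \<theta> * (a * fst (f (real_of_rat q)) + b * snd (f (real_of_rat q)))"
    have "linear_eval ?L" "linear_eval (\<lambda>f. - ?L f)"
      using linear_eval.eval[of "\<theta> * a" "real_of_rat q" "\<theta> * b"]
        linear_eval.eval[of "- \<theta> * a" "real_of_rat q" "- \<theta> * b"]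
      by (simp_all add: algebra_simps)
    from trig_sin[OF this] \<theta> show "\<exists>p. ?trig p \<and> p x \<noteq> p y"
      by (intro exI[of _ "\<lambda>x. sin (\<theta> * (a * fst (x q) + b * snd (x q)))"]) (simp add: \<rho>_def)
  qed (use via[OF \<Phi>] e in \<open>auto simp: trig_const trig.add trig_mult\<close>)
  then obtain p' where p': "?trig p'" "\<And>x. x \<in> \<rho> ` ?K \<Longrightarrow> \<bar>\<Phi> (inv_into ?K \<rho> x) - p' x\<bar> < e / 2" by blast
  define P where "P f = p' (\<rho> f)" for f
  have P: "trig (\<lambda>f. complex_of_real (P f))" unfolding P_def by (rule p'(1))
  have P': "\<bar>\<Phi> f - P f\<bar> < e / 2" if "f \<in> ?K" for f
    using p'(2)[of "\<rho> f"] inv that by (simp add: P_def)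
  obtain C where C: "\<And>f. \<bar>P f\<bar> \<le> C" using bounded_trig[OF P] by auto
  define h where "h x = max (- B) (min B x)" for x :: real
  have "continuous_on {-C..C} h" unfolding h_def by (intro continuous_intros)
  then obtain p where p: "real_polynomial_function p" "\<And>x. x \<in> {-C..C} \<Longrightarrow> \<bar>h x - p x\<bar> < e / 2"
    using Stone_Weierstrass_real_polynomial_function[of "{-C..C}" h "e / 2"] e by auto
  have close: "\<bar>h (P f) - p (P f)\<bar> < e / 2" for f using p(2)[of "P f"] C[of f] by (auto simp: abs_le_iff)
  show thesis
  proof (rule that)
    show "trig (\<lambda>f. complex_of_real (p (P f)))" by (rule trig_polynomial[OF p(1) P])
    show "\<bar>p (P f)\<bar> \<le> B + e" for f using close[of f] B(2) e by (auto simp: h_def abs_if split: if_splits)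
    \<comment> \<open>On the compact set \<Phi> has values in [- B, B], so truncating P cannot
      increase its distance to \<Phi>.\<close>
    show "\<bar>\<Phi> f - p (P f)\<bar> < e" if "f \<in> equicontinuous_paths \<delta>" for f
      using close[of f] P'[OF that] B(1)[OF that] unfolding h_def by linarith
  qed
qed


section \<open>From trigonometric polynomials to bounded continuous functionals\<close>

lemma borel_measurable_compact_convergence:
  assumes "continuous_map T euclideanreal \<Phi>"
  shows "\<Phi> \<in> borel_measurable (borel_sets_of T)"
proof (rule borel_measurableI)
  have sp: "space (borel_sets_of T) = topspace T" "sets (borel_sets_of T) = sigma_sets (topspace T) {U. openin T U}"
    unfolding borel_sets_of_def
    by (intro space_measure_of sets_measure_of; auto dest: openin_subset)+
  fix S :: "real set" assume "open S"
  then have "openin T {x \<in> topspace T. \<Phi> x \<in> S}"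
    by (intro openin_continuous_map_preimage[OF assms]) simp
  moreover have "{x \<in> topspace T. \<Phi> x \<in> S} = \<Phi> -` S \<inter> topspace T" by auto
  ultimately show "\<Phi> -` S \<inter> space (borel_sets_of T) \<in> sets (borel_sets_of T)" by (simp add: sp)
qed

lemma (in prob_space) expectation_close:
  fixes f g :: "'a \<Rightarrow> real"
  assumes [measurable]: "f \<in> borel_measurable M" "g \<in> borel_measurable M" "E \<in> sets M"
    and "\<And>\<omega>. \<omega> \<in> space M \<Longrightarrow> \<bar>f \<omega>\<bar> \<le> B" "\<And>\<omega>. \<omega> \<in> space M \<Longrightarrow> \<bar>g \<omega>\<bar> \<le> C"
    and "\<And>\<omega>. \<omega> \<in> space M - E \<Longrightarrow> \<bar>f \<omega> - g \<omega>\<bar> \<le> e" and "e \<ge> 0"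
  shows "\<bar>expectation f - expectation g\<bar> \<le> e + (B + C) * prob E"
proof -
  have int: "integrable M f" "integrable M g"
    using assms(4,5) by (intro integrable_const_bound[where B=B] integrable_const_bound[where B=C]; simp)+
  have intE: "integrable M (\<lambda>\<omega>. e + (B + C) * indicator E \<omega>)"
    by (intro integrable_const_bound[where B="e + \<bar>B + C\<bar>"]) (use \<open>e \<ge> 0\<close> in \<open>auto simp: indicator_def\<close>)
  have "\<bar>expectation f - expectation g\<bar> = \<bar>expectation (\<lambda>\<omega>. f \<omega> - g \<omega>)\<bar>" using int by simp
  also have "\<dots> \<le> expectation (\<lambda>\<omega>. \<bar>f \<omega> - g \<omega>\<bar>)" by (rule integral_abs_bound)
  also have "\<dots> \<le> expectation (\<lambda>\<omega>. e + (B + C) * indicator E \<omega>)"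
  proof (rule integral_mono)
    fix \<omega> assume w: "\<omega> \<in> space M"
    show "\<bar>f \<omega> - g \<omega>\<bar> \<le> e + (B + C) * indicator E \<omega>"
      using assms(4,5)[OF w] assms(6)[of \<omega>] w \<open>e \<ge> 0\<close> by (auto simp: indicator_def)
  qed (use int intE in auto)
  also have "\<dots> = e + (B + C) * prob E"
    using assms(3) by (subst Bochner_Integration.integral_add) (auto simp: prob_space emeasure_eq_measure)
  finally show ?thesis .
qed

text \<open>Off an event of small probability the paths lie in one compact set, on which \<Phi> is
  within e of a trigonometric polynomial Q; on the event the global bounds on \<Phi> and Q limit the
  error. The expectations of Q converge by the hypothesis on characteristic functions.\<close>

theorem converges_in_law_criterion:
  assumes M: "prob_space M" and N: "prob_space N"
    and Ym: "\<And>n t. (\<lambda>\<omega>. Y n \<omega> t) \<in> borel_measurable M"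
    and Yc: "\<And>n \<omega>. \<omega> \<in> space M \<Longrightarrow> continuous_on UNIV (Y n \<omega>)"
    and Zm: "\<And>t. (\<lambda>\<omega>. Z \<omega> t) \<in> borel_measurable N"
    and Zc: "\<And>\<omega>. \<omega> \<in> space N \<Longrightarrow> continuous_on UNIV (Z \<omega>)"
    and conv: "\<And>L. linear_eval L \<Longrightarrow> (\<lambda>n. \<integral>\<omega>. cis (L (Y n \<omega>)) \<partial>M) \<longlonglongrightarrow> (\<integral>\<omega>. cis (L (Z \<omega>)) \<partial>N)"
    and Y_tight: "\<And>\<eta>. \<eta> > 0 \<Longrightarrow> \<exists>\<delta>. (\<forall>j. \<delta> j > 0) \<and> (\<forall>n. \<exists>E\<in>sets M. measure M E \<le> \<eta> \<and>
        (\<forall>\<omega>\<in>space M - E. Y n \<omega> \<in> equicontinuous_paths \<delta>))"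
    and Z_tight: "\<And>\<eta>. \<eta> > 0 \<Longrightarrow> \<exists>\<delta>. (\<forall>j. \<delta> j > 0) \<and> (\<exists>E\<in>sets N. measure N E \<le> \<eta> \<and>
        (\<forall>\<omega>\<in>space N - E. Z \<omega> \<in> equicontinuous_paths \<delta>))"
  shows "converges_in_law compact_convergence M Y N Z"
  unfolding converges_in_law_def
proof (intro conjI allI impI)
  interpret M: prob_space M by (rule M)
  interpret N: prob_space N by (rule N)
  show YM: "Y n \<in> measurable M (borel_sets_of compact_convergence)" for n
    by (rule measurable_path[OF Ym Yc])
  show ZM: "Z \<in> measurable N (borel_sets_of compact_convergence)"
    by (rule measurable_path[OF Zm Zc])
  fix \<Phi> :: "(real \<Rightarrow> real \<times> real) \<Rightarrow> real"
  assume \<Phi>: "continuous_map compact_convergence euclideanreal \<Phi> \<and> bounded (\<Phi> ` topspace compact_convergence)"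
  then obtain B0 where B0: "\<And>f. continuous_on UNIV f \<Longrightarrow> \<bar>\<Phi> f\<bar> \<le> B0"
    unfolding bounded_iff topspace_compact_convergence by auto
  define B where "B = max B0 0"
  have B: "continuous_on UNIV f \<Longrightarrow> \<bar>\<Phi> f\<bar> \<le> B" "B \<ge> 0" for f
    using B0[of f] by (auto simp: B_def)
  have \<Phi>m: "\<Phi> \<in> borel_measurable (borel_sets_of compact_convergence)"
    using \<Phi> by (intro borel_measurable_compact_convergence) simp
  have \<Phi>Y: "(\<lambda>\<omega>. \<Phi> (Y n \<omega>)) \<in> borel_measurable M" for n by (rule measurable_compose[OF YM \<Phi>m])
  have \<Phi>Z: "(\<lambda>\<omega>. \<Phi> (Z \<omega>)) \<in> borel_measurable N" by (rule measurable_compose[OF ZM \<Phi>m])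
  show "(\<lambda>n. \<integral>\<omega>. \<Phi> (Y n \<omega>) \<partial>M) \<longlonglongrightarrow> (\<integral>\<omega>. \<Phi> (Z \<omega>) \<partial>N)"
  proof (rule LIMSEQ_I)
    fix r :: real assume r: "r > 0"
    define e where "e = min 1 (r / 8)"
    have e: "e > 0" "e \<le> 1" "8 * e \<le> r" using r by (auto simp: e_def)
    \<comment> \<open>Since e is at most 1, the bounds B and B + e add up to at most 2 B + 1, so the
      exceptional event costs at most e.\<close>
    define \<eta> where "\<eta> = e / (2 * B + 1)"
    have \<eta>: "\<eta> > 0" "(2 * B + 1) * \<eta> = e" using e B(2) by (auto simp: \<eta>_def)
    obtain \<delta>1 where \<delta>1: "\<And>j. \<delta>1 j > 0" and t1: "\<And>n. \<exists>E\<in>sets M. measure M E \<le> \<eta> \<and>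
        (\<forall>\<omega>\<in>space M - E. Y n \<omega> \<in> equicontinuous_paths \<delta>1)" using Y_tight[OF \<eta>(1)] by blast
    obtain \<delta>2 where \<delta>2: "\<And>j. \<delta>2 j > 0" and t2: "\<exists>E\<in>sets N. measure N E \<le> \<eta> \<and>
        (\<forall>\<omega>\<in>space N - E. Z \<omega> \<in> equicontinuous_paths \<delta>2)" using Z_tight[OF \<eta>(1)] by blast
    \<comment> \<open>Smaller moduli give a larger set of paths, so the minimum serves the sequence
      and the limit at once.\<close>
    define \<delta> where "\<delta> j = min (\<delta>1 j) (\<delta>2 j)" for j
    have \<delta>: "\<And>j. \<delta> j > 0" using \<delta>1 \<delta>2 by (simp add: \<delta>_def)
    have sub: "equicontinuous_paths \<delta>1 \<subseteq> equicontinuous_paths \<delta>" "equicontinuous_paths \<delta>2 \<subseteq> equicontinuous_paths \<delta>"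
      unfolding equicontinuous_paths_def \<delta>_def by auto
    obtain Q where Q: "trig (\<lambda>f. complex_of_real (Q f))"
        "\<And>f. f \<in> equicontinuous_paths \<delta> \<Longrightarrow> \<bar>\<Phi> f - Q f\<bar> < e" "\<And>f. \<bar>Q f\<bar> \<le> B + e"
    proof (rule trig_approximation[OF \<delta> _ _ B(2) e(1)])
      show "continuous_on (equicontinuous_paths \<delta>) \<Phi>"
        using \<Phi> by (intro continuous_on_equicontinuous_paths[OF \<delta>]) simp
      show "\<bar>\<Phi> f\<bar> \<le> B" if "f \<in> equicontinuous_paths \<delta>" for f
        using equicontinuous_paths_continuous[OF \<delta> that] by (rule B(1))
    qed blast
    have QY: "(\<lambda>\<omega>. Q (Y n \<omega>)) \<in> borel_measurable M" for n
      using measurable_compose[OF measurable_trig[OF Q(1), of "Y n", OF Ym] borel_measurable_Re] by simp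
    have QZ: "(\<lambda>\<omega>. Q (Z \<omega>)) \<in> borel_measurable N"
      using measurable_compose[OF measurable_trig[OF Q(1), of Z, OF Zm] borel_measurable_Re] by simp
    have small: "e + (B + (B + e)) * p \<le> 2 * e" if "p \<le> \<eta>" "p \<ge> 0" for p
    proof -
      have "(B + (B + e)) * p \<le> (2 * B + 1) * \<eta>" using that e(2) B(2) e(1) by (intro mult_mono) auto
      with \<eta>(2) show ?thesis by simp
    qed
    have Yclose: "\<bar>M.expectation (\<lambda>\<omega>. \<Phi> (Y n \<omega>)) - M.expectation (\<lambda>\<omega>. Q (Y n \<omega>))\<bar> \<le> 2 * e" for n
    proof -
      obtain E where E: "E \<in> sets M" "measure M E \<le> \<eta>" "\<forall>\<omega>\<in>space M - E. Y n \<omega> \<in> equicontinuous_paths \<delta>1"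
        using t1[of n] by blast
      have "\<bar>M.expectation (\<lambda>\<omega>. \<Phi> (Y n \<omega>)) - M.expectation (\<lambda>\<omega>. Q (Y n \<omega>))\<bar> \<le> e + (B + (B + e)) * measure M E"
        using E sub(1) Q(2,3) B(1) Yc e(1)
        by (intro M.expectation_close[OF \<Phi>Y QY]) (auto intro!: less_imp_le[OF Q(2)])
      also have "\<dots> \<le> 2 * e" using E(2) by (intro small) auto
      finally show ?thesis .
    qed
    have Zclose: "\<bar>N.expectation (\<lambda>\<omega>. \<Phi> (Z \<omega>)) - N.expectation (\<lambda>\<omega>. Q (Z \<omega>))\<bar> \<le> 2 * e"
    proof -
      obtain E where E: "E \<in> sets N" "measure N E \<le> \<eta>" "\<forall>\<omega>\<in>space N - E. Z \<omega> \<in> equicontinuous_paths \<delta>2"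
        using t2 by blast
      have "\<bar>N.expectation (\<lambda>\<omega>. \<Phi> (Z \<omega>)) - N.expectation (\<lambda>\<omega>. Q (Z \<omega>))\<bar> \<le> e + (B + (B + e)) * measure N E"
        using E sub(2) Q(2,3) B(1) Zc e(1)
        by (intro N.expectation_close[OF \<Phi>Z QZ]) (auto intro!: less_imp_le[OF Q(2)])
      also have "\<dots> \<le> 2 * e" using E(2) by (intro small) auto
      finally show ?thesis .
    qed
    have "(\<lambda>n. \<integral>\<omega>. complex_of_real (Q (Y n \<omega>)) \<partial>M) \<longlonglongrightarrow> (\<integral>\<omega>. complex_of_real (Q (Z \<omega>)) \<partial>N)"
      by (rule trig_convergence[OF M N Ym Zm conv Q(1)])
    then have "(\<lambda>n. M.expectation (\<lambda>\<omega>. Q (Y n \<omega>))) \<longlonglongrightarrow> N.expectation (\<lambda>\<omega>. Q (Z \<omega>))"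
      by (simp only: integral_complex_of_real tendsto_of_real_iff)
    then obtain n0 where n0: "\<And>n. n \<ge> n0 \<Longrightarrow> \<bar>M.expectation (\<lambda>\<omega>. Q (Y n \<omega>)) - N.expectation (\<lambda>\<omega>. Q (Z \<omega>))\<bar> < e"
      using LIMSEQ_D[OF _ e(1)] by (metis real_norm_def)
    \<comment> \<open>The errors add up to 2 e + e + 2 e = 5 e, which is below 8 e and hence below
      r.\<close>
    have "norm (M.expectation (\<lambda>\<omega>. \<Phi> (Y n \<omega>)) - N.expectation (\<lambda>\<omega>. \<Phi> (Z \<omega>))) < r" if "n \<ge> n0" for n
      using Yclose[of n] Zclose n0[OF that] e(1,3) unfolding real_norm_def by linarith
    then show "\<exists>n0. \<forall>n\<ge>n0. norm (M.expectation (\<lambda>\<omega>. \<Phi> (Y n \<omega>)) - N.expectation (\<lambda>\<omega>. \<Phi> (Z \<omega>))) < r"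
      by blast
  qed
qed

section \<open>Gaussian increments and tightness\<close>

lemma (in prob_space) centred_normal_char:
  assumes A: "centred_normal M A v"
  shows "expectation (\<lambda>\<omega>. cis (A \<omega>)) = of_real (exp (- v / 2))"
proof -
  have [measurable]: "A \<in> borel_measurable M" using A by (simp add: centred_normal_def)
  consider "v = 0" "AE \<omega> in M. A \<omega> = 0" | "v > 0" "distributed M lborel A (normal_density 0 (sqrt v))"
    using A by (auto simp: centred_normal_def)
  then show ?thesis
  proof cases
    case 1
    have "expectation (\<lambda>\<omega>. cis (A \<omega>)) = expectation (\<lambda>_. 1)"
      unfolding cis_conv_exp using 1(2) by (intro integral_cong_AE) (measurable, auto)
    then show ?thesis using 1(1) by (simp add: prob_space)
  next
    case 2
    have "distributed M lborel (\<lambda>x. (A x - 0) / sqrt v) std_normal_density"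
      using normal_standard_normal_convert[of "sqrt v" A 0] 2 by simp
    from distributed_distr_eq_density[OF this]
    have D: "distr M lborel (\<lambda>x. A x / sqrt v) = std_normal_distribution" by simp
    have m: "(\<lambda>x. A x / sqrt v) \<in> measurable M lborel" by simp
    have "char std_normal_distribution (sqrt v) = (\<integral>x. iexp (sqrt v * x) \<partial>distr M lborel (\<lambda>x. A x / sqrt v))"
      unfolding char_def D ..
    also have "\<dots> = expectation (\<lambda>\<omega>. iexp (sqrt v * (A \<omega> / sqrt v)))"
      by (rule integral_distr[OF m]) simp
    also have "\<dots> = expectation (\<lambda>\<omega>. cis (A \<omega>))" using 2(1) by (simp add: cis_conv_exp)
    finally show ?thesis using 2(1) by (simp add: char_std_normal_distribution)
  qed
qed

lemma (in prob_space) centred_normal_moments: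
  assumes A: "centred_normal M A v"
  shows "integrable M A" "integrable M (\<lambda>\<omega>. (A \<omega>)\<^sup>2)" "expectation A = 0" "expectation (\<lambda>\<omega>. (A \<omega>)\<^sup>2) = v"
proof -
  have [measurable]: "A \<in> borel_measurable M" using A by (simp add: centred_normal_def)
  consider "v = 0" "AE \<omega> in M. A \<omega> = 0" | "v > 0" "distributed M lborel A (normal_density 0 (sqrt v))"
    using A by (auto simp: centred_normal_def)
  then have "integrable M A \<and> integrable M (\<lambda>\<omega>. (A \<omega>)\<^sup>2) \<and> expectation A = 0 \<and> expectation (\<lambda>\<omega>. (A \<omega>)\<^sup>2) = v"
  proof cases
    case 1
    have "integrable M A \<longleftrightarrow> integrable M (\<lambda>_. 0 :: real)" "expectation A = expectation (\<lambda>_. 0)"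
      "integrable M (\<lambda>\<omega>. (A \<omega>)\<^sup>2) \<longleftrightarrow> integrable M (\<lambda>_. 0 :: real)" "expectation (\<lambda>\<omega>. (A \<omega>)\<^sup>2) = expectation (\<lambda>_. 0)"
      using 1(2) by (intro integrable_cong_AE integral_cong_AE; auto)+
    with 1(1) show ?thesis by simp
  next
    case 2
    have sv: "sqrt v > 0" using 2(1) by simp
    have E: "expectation A = 0" by (rule normal_distributed_expectation[OF sv 2(2)])
    have V: "variance A = v" using normal_distributed_variance[OF sv 2(2)] 2(1) by simp
    have "integrable M A"
      using distributed_integrable[OF 2(2), of "\<lambda>x. x"] integrable_normal_moment[OF sv, of 0 1] by simp
    moreover have "integrable M (\<lambda>\<omega>. (A \<omega>)\<^sup>2)"
      using distributed_integrable[OF 2(2), of "\<lambda>x. x\<^sup>2"] integrable_normal_moment[OF sv, of 0 2] by simp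
    ultimately show ?thesis using E V by simp
  qed
  then show "integrable M A" "integrable M (\<lambda>\<omega>. (A \<omega>)\<^sup>2)" "expectation A = 0" "expectation (\<lambda>\<omega>. (A \<omega>)\<^sup>2) = v" by auto
qed

text \<open>\<open>two_sided_BM2\<close> only asserts that some covariance matrix exists. Moments at
  time 1, where the process equals its increment from 0, identify the entries; the mixed one comes
  by polarisation from the variance of the sum of the coordinates.\<close>

lemma two_sided_BM2_increments:
  assumes BM: "two_sided_BM2 N Z" and Z0: "\<forall>\<omega>\<in>space N. Z \<omega> 0 = 0"
    and V1: "prob_space.variance N (\<lambda>\<omega>. fst (Z \<omega> 1)) = p"
    and V2: "prob_space.variance N (\<lambda>\<omega>. snd (Z \<omega> 1)) = q"
    and C: "covariance N (\<lambda>\<omega>. fst (Z \<omega> 1)) (\<lambda>\<omega>. snd (Z \<omega> 1)) = c"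
    and st: "s < t"
  shows "centred_normal N (\<lambda>\<omega>. a * fst (Z \<omega> t - Z \<omega> s) + b * snd (Z \<omega> t - Z \<omega> s))
    ((t - s) * (a\<^sup>2 * p + 2 * a * b * c + b\<^sup>2 * q))"
proof -
  interpret prob_space N using BM by (simp add: two_sided_BM2_def)
  obtain q11 q12 q22 where Q: "\<And>s t a b. s < t \<Longrightarrow> centred_normal N
      (\<lambda>\<omega>. a * fst (Z \<omega> t - Z \<omega> s) + b * snd (Z \<omega> t - Z \<omega> s)) ((t - s) * (a\<^sup>2 * q11 + 2 * a * b * q12 + b\<^sup>2 * q22))"
    using BM unfolding two_sided_BM2_def by blast
  define A where "A \<omega> = fst (Z \<omega> 1 - Z \<omega> 0)" for \<omega>
  define B where "B \<omega> = snd (Z \<omega> 1 - Z \<omega> 0)" for \<omega>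
  have nA: "centred_normal N A q11" using Q[of 0 1 1 0] unfolding A_def by simp
  have nB: "centred_normal N B q22" using Q[of 0 1 0 1] unfolding B_def by simp
  have nAB: "centred_normal N (\<lambda>\<omega>. A \<omega> + B \<omega>) (q11 + 2 * q12 + q22)" using Q[of 0 1 1 1] unfolding A_def B_def by simp
  note mA = centred_normal_moments[OF nA] and mB = centred_normal_moments[OF nB] and mAB = centred_normal_moments[OF nAB]
  have eq: "fst (Z \<omega> 1) = A \<omega>" "snd (Z \<omega> 1) = B \<omega>" if "\<omega> \<in> space N" for \<omega>
    using Z0 that by (simp_all add: A_def B_def)
  have eE: "expectation (\<lambda>\<omega>. fst (Z \<omega> 1)) = 0" "expectation (\<lambda>\<omega>. snd (Z \<omega> 1)) = 0"
    using mA(3) mB(3) eq by (simp_all cong: Bochner_Integration.integral_cong)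
  have p: "q11 = p" using V1 mA(4) eq unfolding eE by (simp cong: Bochner_Integration.integral_cong)
  have q: "q22 = q" using V2 mB(4) eq unfolding eE by (simp cong: Bochner_Integration.integral_cong)
  have AB: "expectation (\<lambda>\<omega>. A \<omega> * B \<omega>) = c"
    using C eq unfolding covariance_def eE by (simp cong: Bochner_Integration.integral_cong)
  have "expectation (\<lambda>\<omega>. A \<omega> * B \<omega>) = expectation (\<lambda>\<omega>. ((A \<omega> + B \<omega>)\<^sup>2 - (A \<omega>)\<^sup>2 - (B \<omega>)\<^sup>2) / 2)"
    by (rule Bochner_Integration.integral_cong) (auto simp: power2_eq_square algebra_simps)
  also have "\<dots> = (q11 + 2 * q12 + q22 - q11 - q22) / 2" using mA mB mAB by simp
  finally have "q12 = c" using AB by simp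
  with p q Q[OF st, of a b] show ?thesis by simp
qed

lemma two_sided_BM2_joint_char:
  fixes t u v :: "nat \<Rightarrow> real"
  assumes BM: "two_sided_BM2 N Z" and Z0: "\<forall>\<omega>\<in>space N. Z \<omega> 0 = 0"
    and V1: "prob_space.variance N (\<lambda>\<omega>. fst (Z \<omega> 1)) = p"
    and V2: "prob_space.variance N (\<lambda>\<omega>. snd (Z \<omega> 1)) = q"
    and C: "covariance N (\<lambda>\<omega>. fst (Z \<omega> 1)) (\<lambda>\<omega>. snd (Z \<omega> 1)) = c"
    and t: "\<And>j. j < r \<Longrightarrow> t j < t (Suc j)"
  shows "prob_space.expectation N (\<lambda>\<omega>. \<Prod>j<r. cis (u j * fst (Z \<omega> (t (Suc j)) - Z \<omega> (t j)) + v j * snd (Z \<omega> (t (Suc j)) - Z \<omega> (t j)))) =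
    of_real (\<Prod>j<r. exp (- ((u j)\<^sup>2 * p + 2 * u j * v j * c + (v j)\<^sup>2 * q) * (t (Suc j) - t j) / 2))"
proof -
  interpret prob_space N using BM by (simp add: two_sided_BM2_def)
  let ?L = "\<lambda>j x. u j * fst x + v j * snd x :: real"
  have Lm: "?L j \<in> borel_measurable borel" for j
    by (intro borel_measurable_continuous_onI continuous_intros)
  have cm: "(\<lambda>x. cis (?L j x)) \<in> borel_measurable borel" for j
    by (intro borel_measurable_continuous_onI) (auto simp: cis_conv_exp intro!: continuous_intros)
  have "indep_vars (\<lambda>_. borel) (\<lambda>j \<omega>. Z \<omega> (t (Suc j)) - Z \<omega> (t j)) {..<r}"
    using BM t unfolding two_sided_BM2_def by blast
  then have ind: "indep_vars (\<lambda>_. borel) (\<lambda>j \<omega>. cis (?L j (Z \<omega> (t (Suc j)) - Z \<omega> (t j)))) {..<r}"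
    by (rule indep_vars_compose2) (rule cm)
  have one: "expectation (\<lambda>\<omega>. cis (?L j (Z \<omega> (t (Suc j)) - Z \<omega> (t j)))) =
      of_real (exp (- ((u j)\<^sup>2 * p + 2 * u j * v j * c + (v j)\<^sup>2 * q) * (t (Suc j) - t j) / 2))" if "j < r" for j
  proof -
    have "- ((u j)\<^sup>2 * p + 2 * u j * v j * c + (v j)\<^sup>2 * q) * (t (Suc j) - t j) / 2 =
        - ((t (Suc j) - t j) * ((u j)\<^sup>2 * p + 2 * u j * v j * c + (v j)\<^sup>2 * q)) / 2" by (simp only: mult.commute mult_minus_left)
    then show ?thesis
      using centred_normal_char[OF two_sided_BM2_increments[OF BM Z0 V1 V2 C t[OF that], of "u j" "v j"]] by (simp only:)
  qed
  have int: "integrable N (\<lambda>\<omega>. cis (?L j (Z \<omega> (t (Suc j)) - Z \<omega> (t j))))" if "j < r" for j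
  proof (rule integrable_const_bound[where B=1])
    show "(\<lambda>\<omega>. cis (?L j (Z \<omega> (t (Suc j)) - Z \<omega> (t j)))) \<in> borel_measurable N"
      using ind that unfolding indep_vars_def by auto
  qed simp
  have "expectation (\<lambda>\<omega>. \<Prod>j<r. cis (?L j (Z \<omega> (t (Suc j)) - Z \<omega> (t j)))) =
      (\<Prod>j<r. expectation (\<lambda>\<omega>. cis (?L j (Z \<omega> (t (Suc j)) - Z \<omega> (t j)))))"
    by (rule indep_vars_lebesgue_integral[OF _ ind]) (use int in auto)
  also have "\<dots> = (\<Prod>j<r. of_real (exp (- ((u j)\<^sup>2 * p + 2 * u j * v j * c + (v j)\<^sup>2 * q) * (t (Suc j) - t j) / 2)))"
    by (intro prod.cong refl one) auto
  finally show ?thesis by simp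
qed

section \<open>Tightness from moduli of continuity\<close>

text \<open>A union bound in which level j is allowed probability \<eta> / 2^(j+1). The exceptional
  events may vary with n but the moduli may not, whence the order of the quantifiers.\<close>

lemma (in finite_measure) tight_from_modulus:
  fixes Y :: "nat \<Rightarrow> 'a \<Rightarrow> real \<Rightarrow> real \<times> real"
  assumes mod: "\<And>j \<zeta>. \<zeta> > 0 \<Longrightarrow> \<exists>\<delta>>0. \<forall>n. \<exists>E\<in>sets M. measure M E \<le> \<zeta> \<and> (\<forall>\<omega>\<in>space M - E. Y n \<omega> 0 = 0 \<and>
      (\<forall>s\<in>{-real (Suc j)..real (Suc j)}. \<forall>t\<in>{-real (Suc j)..real (Suc j)}. \<bar>s - t\<bar> \<le> \<delta> \<longrightarrow>
        dist (Y n \<omega> s) (Y n \<omega> t) \<le> 1 / real (Suc j)))" and \<eta>: "\<eta> > 0"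
  shows "\<exists>\<delta>. (\<forall>j. \<delta> j > 0) \<and> (\<forall>n. \<exists>E\<in>sets M. measure M E \<le> \<eta> \<and> (\<forall>\<omega>\<in>space M - E. Y n \<omega> \<in> equicontinuous_paths \<delta>))"
proof -
  let ?P = "\<lambda>j \<delta> n E. E \<in> sets M \<and> measure M E \<le> \<eta> * (1 / 2) ^ Suc j \<and> (\<forall>\<omega>\<in>space M - E. Y n \<omega> 0 = 0 \<and>
      (\<forall>s\<in>{-real (Suc j)..real (Suc j)}. \<forall>t\<in>{-real (Suc j)..real (Suc j)}. \<bar>s - t\<bar> \<le> \<delta> \<longrightarrow>
        dist (Y n \<omega> s) (Y n \<omega> t) \<le> 1 / real (Suc j)))"
  have "\<forall>j. \<exists>\<delta>>0. \<forall>n. \<exists>E. ?P j \<delta> n E"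
  proof
    fix j
    have "\<eta> * (1 / 2) ^ Suc j > 0" using \<eta> by simp
    from mod[OF this, of j] show "\<exists>\<delta>>0. \<forall>n. \<exists>E. ?P j \<delta> n E" by (simp only: Bex_def)
  qed
  then obtain \<delta> where \<delta>: "\<And>j. \<delta> j > 0" "\<And>j n. \<exists>E. ?P j (\<delta> j) n E" by metis
  have "\<exists>E\<in>sets M. measure M E \<le> \<eta> \<and> (\<forall>\<omega>\<in>space M - E. Y n \<omega> \<in> equicontinuous_paths \<delta>)" for n
  proof -
    have "\<forall>j. \<exists>E. ?P j (\<delta> j) n E" using \<delta>(2) by blast
    from choice[OF this] obtain E where E: "\<And>j. ?P j (\<delta> j) n (E j)" by blast
    have sums: "(\<lambda>j. \<eta> * (1 / 2) ^ Suc j) sums (\<eta> * 1)" by (intro sums_mult power_half_series)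
    have summable: "summable (\<lambda>j. measure M (E j))"
      by (rule summable_comparison_test'[OF sums_summable[OF sums], of 0]) (use E in auto)
    have "measure M (\<Union>j. E j) \<le> (\<Sum>j. measure M (E j))"
      using E summable by (intro finite_measure_subadditive_countably) auto
    also have "\<dots> \<le> (\<Sum>j. \<eta> * (1 / 2) ^ Suc j)"
      using E summable sums_summable[OF sums] by (intro suminf_le) auto
    also have "\<dots> = \<eta>" using sums_unique[OF sums] by simp
    finally have "measure M (\<Union>j. E j) \<le> \<eta>" .
    moreover have "(\<Union>j. E j) \<in> sets M" using E by auto
    moreover have "Y n \<omega> \<in> equicontinuous_paths \<delta>" if "\<omega> \<in> space M - (\<Union>j. E j)" for \<omega>
    proof -
      have "\<omega> \<in> space M - E j" for j using that by auto
      with E show ?thesis unfolding equicontinuous_paths_def by blast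
    qed
    ultimately show ?thesis by blast
  qed
  with \<delta>(1) show ?thesis by blast
qed

text \<open>Both times are moved to rationals by less than \<delta>/2, so a gap of \<delta> grows to
  at most 2 \<delta>; the assumption on rational times is made for this wider gap.\<close>

lemma rational_modulus:
  fixes f :: "real \<Rightarrow> real \<times> real"
  assumes f: "continuous_on UNIV f" and R: "R > 0" and \<delta>: "\<delta> > 0"
    and rat: "\<And>s t. s \<in> \<rat> \<Longrightarrow> t \<in> \<rat> \<Longrightarrow> s \<in> {-R..R} \<Longrightarrow> t \<in> {-R..R} \<Longrightarrow> \<bar>s - t\<bar> \<le> 2 * \<delta> \<Longrightarrow> dist (f s) (f t) \<le> c"
    and st: "s \<in> {-R..R}" "t \<in> {-R..R}" "\<bar>s - t\<bar> \<le> \<delta>"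
  shows "dist (f s) (f t) \<le> c"
proof (rule field_le_epsilon)
  fix e :: real assume e: "e > 0"
  have near: "\<exists>s'\<in>\<rat>. s' \<in> {-R..R} \<and> \<bar>s' - s\<bar> < \<delta> / 2 \<and> dist (f s') (f s) < e / 2" if s: "s \<in> {-R..R}" for s
  proof -
    have "isCont f s" using f by (simp add: continuous_on_eq_continuous_at)
    then obtain d where d: "d > 0" "\<And>x. dist x s < d \<Longrightarrow> dist (f x) (f s) < e / 2"
      using e unfolding continuous_at_eps_delta by (metis half_gt_zero)
    define g where "g = min d (\<delta> / 2)"
    have g: "g > 0" using d \<delta> by (simp add: g_def)
    have "max (s - g) (- R) < min (s + g) R" using s g R by auto
    then obtain s' where "s' \<in> \<rat>" "max (s - g) (- R) < s'" "s' < min (s + g) R" using Rats_dense_in_real by blast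
    then have s': "s' \<in> \<rat>" "s' \<in> {-R..R}" "\<bar>s' - s\<bar> < g" by auto
    then have "\<bar>s' - s\<bar> < \<delta> / 2" "dist s' s < d" unfolding g_def dist_real_def by linarith+
    with s' d(2) show ?thesis by blast
  qed
  obtain s' where s': "s' \<in> \<rat>" "s' \<in> {-R..R}" "\<bar>s' - s\<bar> < \<delta> / 2" "dist (f s') (f s) < e / 2" using near[OF st(1)] by blast
  obtain t' where t': "t' \<in> \<rat>" "t' \<in> {-R..R}" "\<bar>t' - t\<bar> < \<delta> / 2" "dist (f t') (f t) < e / 2" using near[OF st(2)] by blast
  have "\<bar>s' - t'\<bar> \<le> 2 * \<delta>" using s'(3) t'(3) st(3) by linarith
  then have "dist (f s') (f t') \<le> c" by (rule rat[OF s'(1) t'(1) s'(2) t'(2)])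
  with s'(4) t'(4) dist_triangle[of "f s" "f t" "f s'"] dist_triangle[of "f s'" "f t" "f t'"]
  show "dist (f s) (f t) \<le> c + e" by (simp add: dist_commute)
qed

text \<open>By uniform continuity no path violates the bound c at every mesh size, so the events
  \<open>D n\<close> decrease to the empty set and their probabilities tend to 0. Rational pairs of
  times keep \<open>D n\<close> measurable. This serves the limit process and, for the walks, the
  finitely many small n.\<close>

lemma (in prob_space) continuous_process_modulus:
  fixes Z :: "'a \<Rightarrow> real \<Rightarrow> real \<times> real"
  assumes Zm: "\<And>t. (\<lambda>\<omega>. Z \<omega> t) \<in> borel_measurable M"
    and Zc: "\<And>\<omega>. \<omega> \<in> space M \<Longrightarrow> continuous_on UNIV (Z \<omega>)"
    and "R > 0" "c > 0" "\<zeta> > 0"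
  shows "\<exists>\<delta>>0. \<exists>E\<in>sets M. prob E \<le> \<zeta> \<and> (\<forall>\<omega>\<in>space M - E. \<forall>s\<in>{-R..R}. \<forall>t\<in>{-R..R}. \<bar>s - t\<bar> \<le> \<delta> \<longrightarrow>
    dist (Z \<omega> s) (Z \<omega> t) \<le> c)"
proof -
  note [measurable] = Zm
  define I where "I n = {(s, t). s \<in> \<rat> \<inter> {-R..R} \<and> t \<in> \<rat> \<inter> {-R..R} \<and> \<bar>s - t\<bar> \<le> 1 / real (Suc n)}" for n :: nat
  define D where "D n = (\<Union>(s, t)\<in>I n. {\<omega> \<in> space M. c < dist (Z \<omega> s) (Z \<omega> t)})" for n
  have cI: "countable (I n)" for n
    by (rule countable_subset[of _ "\<rat> \<times> \<rat>"]) (auto simp: I_def countable_rat)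
  have DM: "D n \<in> events" for n
    unfolding D_def using cI by (intro sets.countable_UN') (auto, measurable)
  have dec: "decseq D"
  proof (rule decseq_SucI)
    fix n
    have "1 / real (Suc (Suc n)) \<le> 1 / real (Suc n)" by (simp add: field_simps)
    then have "I (Suc n) \<subseteq> I n" unfolding I_def by fastforce
    then show "D (Suc n) \<subseteq> D n" unfolding D_def by blast
  qed
  have "(\<Inter>n. D n) = {}"
  proof (rule ccontr)
    assume "(\<Inter>n. D n) \<noteq> {}"
    then obtain \<omega> where w: "\<And>n. \<omega> \<in> D n" by blast
    then have ws: "\<omega> \<in> space M" unfolding D_def by blast
    have "uniformly_continuous_on {-R..R} (Z \<omega>)"
      by (intro compact_uniformly_continuous continuous_on_subset[OF Zc[OF ws]]) auto
    then obtain d where d: "d > 0" "\<And>s t. s \<in> {-R..R} \<Longrightarrow> t \<in> {-R..R} \<Longrightarrow> dist s t < d \<Longrightarrow> dist (Z \<omega> s) (Z \<omega> t) < c"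
      unfolding uniformly_continuous_on_def using \<open>c > 0\<close> by metis
    obtain n :: nat where n: "inverse (real (Suc n)) < d" using reals_Archimedean[OF d(1)] by blast
    obtain s t where st: "(s, t) \<in> I n" "c < dist (Z \<omega> s) (Z \<omega> t)" using w[of n] unfolding D_def by blast
    then have "dist (Z \<omega> s) (Z \<omega> t) < c" using n by (intro d(2)) (auto simp: I_def dist_real_def inverse_eq_divide)
    with st(2) show False by simp
  qed
  with finite_Lim_measure_decseq[OF _ dec] DM have "(\<lambda>n. prob (D n)) \<longlonglongrightarrow> 0" by auto
  then have "\<forall>\<^sub>F n in sequentially. prob (D n) < \<zeta>" using \<open>\<zeta> > 0\<close> by (rule order_tendstoD(2))
  then obtain n where n: "prob (D n) < \<zeta>" unfolding eventually_sequentially by blast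
  \<comment> \<open>Half the mesh, because passing from rational to real times doubles the
    gap.\<close>
  define \<delta> where "\<delta> = 1 / real (Suc n) / 2"
  have \<delta>: "\<delta> > 0" "2 * \<delta> = 1 / real (Suc n)" unfolding \<delta>_def by (simp, simp only: mult_2 field_sum_of_halves)
  have "dist (Z \<omega> s) (Z \<omega> t) \<le> c" if w: "\<omega> \<in> space M - D n" and st: "s \<in> {-R..R}" "t \<in> {-R..R}" "\<bar>s - t\<bar> \<le> \<delta>" for \<omega> s t
  proof (rule rational_modulus[OF _ \<open>R > 0\<close> \<delta>(1) _ st])
    show "continuous_on UNIV (Z \<omega>)" using w by (intro Zc) auto
    show "dist (Z \<omega> x) (Z \<omega> y) \<le> c" if "x \<in> \<rat>" "y \<in> \<rat>" "x \<in> {-R..R}" "y \<in> {-R..R}" "\<bar>x - y\<bar> \<le> 2 * \<delta>" for x y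
    proof (rule ccontr)
      assume "\<not> dist (Z \<omega> x) (Z \<omega> y) \<le> c"
      moreover have "(x, y) \<in> I n" using that \<delta>(2) by (simp add: I_def)
      ultimately have "\<omega> \<in> D n" using w unfolding D_def by force
      with w show False by simp
    qed
  qed
  with DM n \<delta>(1) show ?thesis by (intro exI[of _ \<delta>] conjI bexI[of _ "D n"]) auto
qed

section \<open>Reduced words and identification\<close>

text \<open>A state \<open>(l, b)\<close> consists of the unfulfilled orders together with the unidentified \<open>d\<close> and \<open>e\<close>
  in \<open>l\<close>, and of the stack of burgers \<open>b\<close>, freshest first; it stands for the word \<open>l @ rev b\<close>.\<close>

fun basic_step :: "symbol list \<times> symbol list \<Rightarrow> symbol \<Rightarrow> symbol list \<times> symbol list" where
  "basic_step (l, b) HamOrd = (if Ham \<in> set b then (l, remove1 Ham b) else (l @ [HamOrd], b))"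
| "basic_step (l, b) ChsOrd = (if Chs \<in> set b then (l, remove1 Chs b) else (l @ [ChsOrd], b))"
| "basic_step (l, b) s = (l, s # b)"

definition stack_step :: "symbol list \<times> symbol list \<Rightarrow> symbol \<Rightarrow> symbol list \<times> symbol list" where
  "stack_step p s =
    (if s \<in> Theta0 then basic_step p s
     else if snd p = [] then (fst p @ [s], [])
     else basic_step p (replacement (hd (snd p)) s))"

definition stack_run :: "symbol list \<times> symbol list \<Rightarrow> symbol list \<Rightarrow> symbol list \<times> symbol list" where
  "stack_run = foldl stack_step"

lemma stack_run_simps [simp]:
  "stack_run p [] = p" "stack_run p (s # w) = stack_run (stack_step p s) w"
  "stack_run p (u @ v) = stack_run (stack_run p u) v"
  by (simp_all add: stack_run_def)

definition valid_stack :: "symbol list \<times> symbol list \<Rightarrow> bool" where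
  "valid_stack p \<longleftrightarrow> set (fst p) \<inter> {Ham, Chs} = {} \<and> set (snd p) \<subseteq> {Ham, Chs}"

lemma replacement_Theta0: "t \<in> {Ham, Chs} \<Longrightarrow> s \<notin> Theta0 \<Longrightarrow> replacement t s \<in> Theta0"
  by (cases s) (auto simp: replacement_def Theta0_def)

lemma valid_stack_basic_step: "valid_stack p \<Longrightarrow> s \<in> Theta0 \<Longrightarrow> valid_stack (basic_step p s)"
proof -
  have *: "set b \<subseteq> {Ham, Chs} \<Longrightarrow> set (remove1 t b) \<subseteq> {Ham, Chs}" for b t
    using set_remove1_subset[of t b] by blast
  assume "valid_stack p" "s \<in> Theta0"
  moreover obtain l b where "p = (l, b)" by fastforce
  ultimately show ?thesis using *[of b]
    by (cases s) (simp_all add: valid_stack_def Theta0_def)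
qed

lemma valid_stack_step: "valid_stack p \<Longrightarrow> valid_stack (stack_step p s)"
proof -
  assume p: "valid_stack p"
  then have "snd p \<noteq> [] \<Longrightarrow> hd (snd p) \<in> {Ham, Chs}"
    unfolding valid_stack_def using hd_in_set by blast
  then show ?thesis using p valid_stack_basic_step[OF p] replacement_Theta0[of "hd (snd p)" s]
    by (auto simp: stack_step_def) (auto simp: valid_stack_def Theta0_def)
qed

lemma valid_stack_run: "valid_stack p \<Longrightarrow> valid_stack (stack_run p w)"
  by (induction w arbitrary: p) (simp_all add: valid_stack_step)

lemma valid_stack_empty [simp]: "valid_stack ([], [])"
  by (simp add: valid_stack_def)

text \<open>Both sides of each relation drive any state into the same state, so the final state is
  an invariant of the equivalence class. Uniqueness of reduced words rests on this.\<close>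

lemma stack_run_word_relation: "word_relation l r \<Longrightarrow> stack_run p l = stack_run p r"
  by (cases p) (auto elim!: word_relation.cases simp: stack_step_def Theta0_def replacement_def)

definition stack_word :: "symbol list \<times> symbol list \<Rightarrow> symbol list" where
  "stack_word p = fst p @ rev (snd p)"

abbreviation normal_form :: "symbol list \<Rightarrow> symbol list" where
  "normal_form w \<equiv> stack_word (stack_run ([], []) w)"

lemma stack_run_word_equiv:
  assumes "word_equiv u v" shows "stack_run p u = stack_run p v"
  using assms unfolding word_equiv_def
  by (induction rule: equivclp_induct) (auto, (metis stack_run_word_relation)+)

lemma reduced_Cons: "reduced (s # w) \<longleftrightarrow>
    (s \<in> {Ham, Chs} \<longrightarrow> set w \<subseteq> {Ham, Chs}) \<and> reduced w"
  by (simp add: reduced_def All_less_Suc2 subset_code(1) all_set_conv_all_nth) blast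

lemma stack_run_burgers: "set w \<subseteq> {Ham, Chs} \<Longrightarrow> stack_run (l, b) w = (l, rev w @ b)"
  by (induction w arbitrary: b) (auto simp: stack_step_def Theta0_def)

text \<open>In a reduced word everything other than \<open>Ham\<close> and \<open>Chs\<close> is
  read while the stack is still empty, so nothing cancels and nothing gets identified.\<close>

lemma stack_run_reduced: "reduced w \<Longrightarrow> stack_word (stack_run (l, []) w) = l @ w"
proof (induction w arbitrary: l)
  case (Cons s w)
  then show ?case
  proof (cases "s \<in> {Ham, Chs}")
    case True
    with Cons have "set (s # w) \<subseteq> {Ham, Chs}" by (auto simp: reduced_Cons)
    then show ?thesis by (simp add: stack_run_burgers stack_word_def del: stack_run_simps)
  next
    case False
    then have "stack_step (l, []) s = (l @ [s], [])" by (cases s) (auto simp: stack_step_def Theta0_def)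
    with Cons show ?thesis by (auto simp: reduced_Cons)
  qed
qed (simp add: stack_word_def)

lemma reduced_stack_word: "valid_stack p \<Longrightarrow> reduced (stack_word p)"
proof -
  have burgers: "set w \<subseteq> {Ham, Chs} \<Longrightarrow> reduced w" for w
    by (induction w) (auto simp: reduced_Cons reduced_def[of "[]"])
  have "set l \<inter> {Ham, Chs} = {} \<Longrightarrow> reduced w \<Longrightarrow> reduced (l @ w)" for l w
    by (induction l) (auto simp: reduced_Cons)
  with burgers show "valid_stack p \<Longrightarrow> reduced (stack_word p)"
    by (auto simp: stack_word_def valid_stack_def)
qed

section \<open>Every word is equivalent to its final stack\<close>

lemma word_equiv_refl [simp]: "word_equiv w w"
  by (simp add: word_equiv_def)

lemma word_equiv_trans [trans]: "word_equiv u v \<Longrightarrow> word_equiv v w \<Longrightarrow> word_equiv u w"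
  unfolding word_equiv_def by (rule equivclp_trans)

lemma word_equiv_relation: "word_relation l r \<Longrightarrow> word_equiv (a @ l @ b) (a @ r @ b)"
  unfolding word_equiv_def by (rule r_into_equivclp) blast

lemma word_equiv_sym: "word_equiv u v \<Longrightarrow> word_equiv v u"
  unfolding word_equiv_def by (rule equivclp_sym)

lemma word_equiv_context:
  assumes "word_equiv u v" shows "word_equiv (a @ u @ b) (a @ v @ b)"
  using assms[unfolded word_equiv_def]
proof (induction rule: equivclp_induct)
  case (step y z)
  from step(2) have "word_equiv (a @ y @ b) (a @ z @ b)"
  proof (elim disjE exE conjE)
    fix c d l r assume "word_relation l r" "y = c @ l @ d" "z = c @ r @ d"
    then show ?thesis using word_equiv_relation[of l r "a @ c" "d @ b"] by simp
  next
    fix c d l r assume "word_relation l r" "z = c @ l @ d" "y = c @ r @ d"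
    then show ?thesis using word_equiv_relation[of l r "a @ c" "d @ b"] by (simp add: word_equiv_sym)
  qed
  with step(3) show ?case by (rule word_equiv_trans)
qed simp

lemma word_equiv_order_left:
  assumes "(x, y) \<in> {(Ham, ChsOrd), (Chs, HamOrd)}"
  shows "word_equiv (replicate n x @ [y]) (y # replicate n x)"
proof (induction n)
  case (Suc n)
  have r: "word_relation [x, y] [y, x]" using assms by (auto intro: word_relation.intros)
  have "word_equiv (replicate (Suc n) x @ [y]) ([x] @ y # replicate n x)"
    using word_equiv_context[OF Suc, of "[x]" "[]"] by simp
  also have "word_equiv ([x] @ y # replicate n x) (y # replicate (Suc n) x)"
    using word_equiv_relation[OF r, of "[]" "replicate n x"] by simp
  finally show ?case .
qed simp

text \<open>Here t is the burger that matches the order y, and x is the other burger. All burgers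
  fresher than the first t are x, so y moves left past them and cancels t; without any t it moves
  past the whole stack.\<close>

lemma word_equiv_order:
  assumes b: "set b \<subseteq> {Ham, Chs}"
    and y: "(t, x, y) \<in> {(Ham, Chs, HamOrd), (Chs, Ham, ChsOrd)}"
  shows "word_equiv (rev b @ [y])
    (if t \<in> set b then rev (remove1 t b) else y # rev b)"
proof -
  have rep: "set c \<subseteq> {Ham, Chs} \<Longrightarrow> t \<notin> set c \<Longrightarrow> c = replicate (length c) x" for c
    using y by (intro replicate_eqI) auto
  have xy: "(x, y) \<in> {(Ham, ChsOrd), (Chs, HamOrd)}" using y by auto
  show ?thesis
  proof (cases "t \<in> set b")
    case True
    then obtain c d where bd: "b = c @ t # d" "t \<notin> set c" by (meson split_list_first)
    then have c: "rev c = replicate (length c) x" using rep[of c] b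
      by (metis Un_subset_iff rev_replicate set_append)
    have ty: "word_relation [t, y] []" using y by (auto intro: word_relation.intros)
    have "word_equiv (rev b @ [y]) (rev d @ [t] @ [y] @ rev c)"
      using word_equiv_context[OF word_equiv_order_left[OF xy, of "length c"], of "rev d @ [t]" "[]"]
      by (simp add: bd c)
    also have "word_equiv (rev d @ [t] @ [y] @ rev c) (rev d @ rev c)"
      using word_equiv_relation[OF ty, of "rev d" "rev c"] by simp
    finally show ?thesis using True bd by (simp add: remove1_append)
  next
    case False
    then have "rev b = replicate (length b) x" using rep[of b] b by (metis rev_replicate)
    with False word_equiv_order_left[OF xy, of "length b"] show ?thesis by simp
  qed
qed

lemma word_equiv_basic_step:
  assumes "valid_stack (l, b)" and "s \<in> Theta0"
  shows "word_equiv (stack_word (l, b) @ [s]) (stack_word (basic_step (l, b) s))"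
proof -
  have b: "set b \<subseteq> {Ham, Chs}" using assms(1) by (simp add: valid_stack_def)
  show ?thesis
  proof (cases s)
    case HamOrd
    then show ?thesis
      using word_equiv_context[OF word_equiv_order[OF b, of Ham Chs HamOrd], of l "[]"]
      by (auto simp: stack_word_def)
  next
    case ChsOrd
    then show ?thesis
      using word_equiv_context[OF word_equiv_order[OF b, of Chs Ham ChsOrd], of l "[]"]
      by (auto simp: stack_word_def)
  qed (use assms(2) in \<open>auto simp: stack_word_def Theta0_def\<close>)
qed

lemma word_equiv_stack_step:
  assumes "valid_stack (l, b)"
  shows "word_equiv (stack_word (l, b) @ [s]) (stack_word (stack_step (l, b) s))"
proof (cases "s \<in> Theta0 \<or> b = []")
  case True
  with word_equiv_basic_step[OF assms, of s] show ?thesis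
    by (auto simp: stack_step_def stack_word_def)
next
  case False
  then obtain t c where bc: "b = t # c" by (cases b) auto
  have t: "t \<in> {Ham, Chs}" using assms bc by (auto simp: valid_stack_def)
  have r: "word_relation [t, s] [t, replacement t s]"
    using False t by (cases s) (auto simp: replacement_def Theta0_def intro: word_relation.intros)
  have "word_equiv (stack_word (l, b) @ [s]) (stack_word (l, b) @ [replacement t s])"
    using word_equiv_relation[OF r, of "l @ rev c" "[]"] by (simp add: stack_word_def bc)
  also have "word_equiv \<dots> (stack_word (basic_step (l, b) (replacement t s)))"
    using False t by (intro word_equiv_basic_step assms replacement_Theta0) auto
  finally show ?thesis using False by (simp add: stack_step_def bc)
qed

lemma word_equiv_stack_run:
  "valid_stack p \<Longrightarrow> word_equiv (stack_word p @ w) (stack_word (stack_run p w))"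
proof (induction w arbitrary: p)
  case (Cons s w)
  obtain l b where p: "p = (l, b)" by fastforce
  have "word_equiv (stack_word p @ s # w) (stack_word (stack_step p s) @ w)"
    using word_equiv_context[OF word_equiv_stack_step[of l b s], of "[]" w] Cons.prems p by simp
  also have "word_equiv \<dots> (stack_word (stack_run (stack_step p s) w))"
    using Cons.prems by (intro Cons.IH valid_stack_step)
  finally show ?case by simp
qed simp

text \<open>Existence: each stack step is a chain of relations. Uniqueness: equivalent words have
  the same final stack, and a reduced word is its own.\<close>

theorem reduce_eq_normal_form: "reduce w = normal_form w"
  unfolding reduce_def
proof (rule the_equality, intro conjI)
  show "reduced (normal_form w)" by (intro reduced_stack_word valid_stack_run valid_stack_empty)
  show "word_equiv w (normal_form w)"
    using word_equiv_stack_run[of "([], [])" w] by (simp add: stack_word_def)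
  fix r assume r: "reduced r \<and> word_equiv w r"
  then have "normal_form w = normal_form r" by (metis stack_run_word_equiv)
  with r stack_run_reduced[of r "[]"] show "r = normal_form w" by simp
qed

text \<open>Stacks are kept freshest first, so the rightmost burger of the reduced word is the head
  of the stack.\<close>

lemma burgers_reduce: "filter (\<lambda>b. b \<in> {Ham, Chs}) (reduce w) = rev (snd (stack_run ([], []) w))"
proof -
  have *: "set l \<inter> {Ham, Chs} = {} \<Longrightarrow> filter (\<lambda>b. b \<in> {Ham, Chs}) l = []"
    "set l \<subseteq> {Ham, Chs} \<Longrightarrow> filter (\<lambda>b. b \<in> {Ham, Chs}) l = l" for l
    by (auto simp: filter_empty_conv intro!: filter_True)
  have "valid_stack (stack_run ([], []) w)" by (intro valid_stack_run valid_stack_empty)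
  then show ?thesis
    unfolding reduce_eq_normal_form stack_word_def valid_stack_def filter_append
    by (subst *(1), simp, subst *(2), simp_all)
qed

lemma counts_append [simp]:
  "ham_count (u @ v) = ham_count u + ham_count v" "chs_count (u @ v) = chs_count u + chs_count v"
  by (simp_all add: ham_count_def chs_count_def)

lemma count_list_pos: "x \<in> set b \<Longrightarrow> Suc 0 \<le> count_list b x"
  by (induction b) auto

text \<open>On identified symbols a step only adds a symbol or cancels an order against a matching
  burger, so both counts are additive.\<close>

lemma counts_stack_run:
  assumes "set w \<subseteq> Theta0"
  shows "ham_count (stack_word (stack_run p w)) = ham_count (stack_word p) + ham_count w \<and>
    chs_count (stack_word (stack_run p w)) = chs_count (stack_word p) + chs_count w"
  using assms
proof (induction w arbitrary: p)
  case (Cons s w)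
  obtain l b where p: "p = (l, b)" by fastforce
  have s: "s \<in> Theta0" using Cons.prems by auto
  have "ham_count (stack_word (stack_step p s)) = ham_count (stack_word p) + ham_count [s]"
    using s by (auto simp: p stack_step_def Theta0_def stack_word_def ham_count_def of_nat_diff count_list_pos)
  moreover have "chs_count (stack_word (stack_step p s)) = chs_count (stack_word p) + chs_count [s]"
    using s by (auto simp: p stack_step_def Theta0_def stack_word_def chs_count_def of_nat_diff count_list_pos)
  moreover have "ham_count (s # w) = ham_count [s] + ham_count w"
    "chs_count (s # w) = chs_count [s] + chs_count w"
    by (simp_all add: ham_count_def chs_count_def)
  ultimately show ?case
    using Cons.IH[of "stack_step p s"] Cons.prems by simp
qed (simp add: ham_count_def chs_count_def)

lemma counts_reduce:
  assumes "set w \<subseteq> Theta0"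
  shows "ham_count (reduce w) = ham_count w" "chs_count (reduce w) = chs_count w"
  using counts_stack_run[OF assms, of "([], [])"]
  by (simp_all add: reduce_eq_normal_form stack_word_def ham_count_def chs_count_def)


section \<open>The sign of the top burger when all orders are stale\<close>

definition burger_sign :: "symbol \<Rightarrow> real" where
  "burger_sign b = (if b = Ham then 1 else - 1)"

text \<open>The value 0 means that no burger is present, so that d, e, F and S cannot be identified;
  \<open>top_step\<close> fixes it until the next h or c.\<close>

definition stack_sign :: "symbol list \<times> symbol list \<Rightarrow> real" where
  "stack_sign p = (if snd p = [] then 0 else burger_sign (hd (snd p)))"

text \<open>The default branch is that of d and S. Since the map is constant for h and c, the sign
  forgets everything before the last such symbol.\<close>

definition top_step :: "symbol \<Rightarrow> real \<Rightarrow> real" where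
  "top_step s v = (case s of Ham \<Rightarrow> 1 | Chs \<Rightarrow> - 1 | Opp \<Rightarrow> - v | _ \<Rightarrow> v)"

definition symbol_type :: "symbol \<Rightarrow> real" where
  "symbol_type s = (if s \<in> {HamOrd, ChsOrd, Flex, Stale} then - 1 else 1)"

definition stale_symbols :: "symbol set" where
  "stale_symbols = {Ham, Chs, Dup, Opp, Stale}"

text \<open>A stale order removes a burger of the type that is not on top of the stack, so it leaves the
  type of the top burger unchanged.\<close>

lemma stack_sign_step:
  assumes "valid_stack p" "s \<in> stale_symbols"
  shows "stack_sign (stack_step p s) = top_step s (stack_sign p)"
proof (cases "s \<in> {Ham, Chs}")
  case True
  then show ?thesis
    by (cases p) (auto simp: stack_sign_def stack_step_def top_step_def Theta0_def burger_sign_def)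
next
  case False
  with assms(2) have s: "s = Dup \<or> s = Opp \<or> s = Stale" by (simp add: stale_symbols_def)
  obtain l b where p: "p = (l, b)" by fastforce
  show ?thesis
  proof (cases b)
    case Nil
    with s show ?thesis by (auto simp: p stack_sign_def stack_step_def top_step_def Theta0_def)
  next
    case (Cons t c)
    with assms(1) have "t = Ham \<or> t = Chs" by (simp add: p valid_stack_def)
    with s show ?thesis
      by (cases "Ham \<in> set c"; cases "Chs \<in> set c") (auto simp: p Cons stack_sign_def stack_step_def top_step_def Theta0_def
          replacement_def burger_sign_def)
  qed
qed

lemma stack_sign_run:
  "valid_stack p \<Longrightarrow> set w \<subseteq> stale_symbols \<Longrightarrow> stack_sign (stack_run p w) = fold top_step w (stack_sign p)"
  by (induction w arbitrary: p) (simp_all add: stack_sign_step valid_stack_step)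

text \<open>A nonzero sign certifies a nonempty stack and names its top burger, which is the one
  that identification looks at.\<close>

lemma identification_eq:
  assumes "set w \<subseteq> stale_symbols" "fold top_step w 0 = v" "v \<noteq> 0"
  shows "identification w s = Some (replacement (if v = 1 then Ham else Chs) s)"
proof -
  define b where "b = snd (stack_run ([], []) w)"
  have v: "stack_sign (stack_run ([], []) w) = v"
    using stack_sign_run[OF valid_stack_empty assms(1)] assms(2) by (simp add: stack_sign_def)
  with assms(3) have b: "b \<noteq> []" "v = burger_sign (hd b)" unfolding b_def stack_sign_def by auto
  have "valid_stack (stack_run ([], []) w)" by (intro valid_stack_run valid_stack_empty)
  with b(1) have "hd b \<in> {Ham, Chs}" unfolding b_def valid_stack_def using hd_in_set by blast
  with b(2) have "hd b = (if v = 1 then Ham else Chs)" by (auto simp: burger_sign_def)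
  with b(1) show ?thesis
    unfolding identification_def burgers_reduce b_def[symmetric]
    by (auto simp: last_rev replacement_def Theta0_def Let_def)
qed

text \<open>The difference of the coordinates moves by the sign after the step: a new burger becomes
  the top itself, while a stale order consumes the kind opposite to the top, or is recorded as an
  order of that kind, which again shifts the difference towards the top. The sum moves by the type
  of the symbol.\<close>

lemma counts_replacement:
  assumes "v = 1 \<or> v = -1" "s \<in> stale_symbols"
  shows "replacement (if v = 1 then Ham else Chs) s \<in> Theta0"
    and "real_of_int (ham_count [replacement (if v = 1 then Ham else Chs) s]) = (symbol_type s + top_step s v) / 2"
    and "real_of_int (chs_count [replacement (if v = 1 then Ham else Chs) s]) = (symbol_type s - top_step s v) / 2"
  using assms by (auto simp: stale_symbols_def replacement_def Theta0_def ham_count_def chs_count_def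
      symbol_type_def top_step_def)

section \<open>The type of the freshest burger\<close>

text \<open>The value \<open>1\<close> stands for \<open>h\<close>, and \<open>- 1\<close> for \<open>c\<close>. The normalisation to \<open>{1, - 1}\<close> only
  matters on the null event where the limit is undefined or 0.\<close>

definition top_type :: "(int \<Rightarrow> symbol) \<Rightarrow> int \<Rightarrow> real" where
  "top_type x k = (if lim (\<lambda>m. fold top_step (map x [- int m..k]) 0) = - 1 then - 1 else 1)"

text \<open>The almost sure event on which the analysis of the word is deterministic: with an h or c
  arbitrarily far to the left, the top type at each place depends on a finite stretch of the
  past.\<close>

definition good_word :: "(int \<Rightarrow> symbol) \<Rightarrow> bool" where
  "good_word x \<longleftrightarrow> (\<forall>i. x i \<in> stale_symbols) \<and> (\<forall>k. \<exists>j\<le>k. x j \<in> {Ham, Chs})"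

lemma top_type_cases: "top_type x k = 1 \<or> top_type x k = - 1"
  by (simp add: top_type_def)

lemma fold_top_step_sign:
  "v = 1 \<or> v = - 1 \<Longrightarrow> fold top_step w v = 1 \<or> fold top_step w v = - 1"
proof (induction w arbitrary: v)
  case (Cons s w)
  then have "top_step s v = 1 \<or> top_step s v = - 1" by (cases s) (auto simp: top_step_def)
  then show ?case using Cons.IH by simp
qed simp

text \<open>An h or c at j fixes the sign there, whatever precedes it. All windows that reach back
  to j therefore give the same value, and the sequence is eventually constant.\<close>

lemma good_word_top_type:
  assumes "good_word x"
  shows "\<forall>\<^sub>F m in sequentially. fold top_step (map x [- int m..k]) 0 = top_type x k"
proof -
  obtain j where j: "j \<le> k" "x j \<in> {Ham, Chs}" using assms unfolding good_word_def by blast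
  define v where "v = fold top_step (map x [j + 1..k]) (burger_sign (x j))"
  have v: "v = 1 \<or> v = - 1" unfolding v_def by (rule fold_top_step_sign) (auto simp: burger_sign_def)
  have eq: "fold top_step (map x [- int m..k]) 0 = v" if "m \<ge> nat (- j)" for m
  proof -
    have "- int m \<le> j" using that by simp
    then have "[- int m..k] = [- int m..j - 1] @ j # [j + 1..k]"
      using j(1) by (intro upto_split3)
    moreover have "top_step (x j) u = burger_sign (x j)" for u
      using j(2) by (auto simp: top_step_def burger_sign_def)
    ultimately show ?thesis by (simp add: v_def)
  qed
  then have ev: "\<forall>\<^sub>F m in sequentially. fold top_step (map x [- int m..k]) 0 = v"
    unfolding eventually_sequentially by blast
  then have "lim (\<lambda>m. fold top_step (map x [- int m..k]) 0) = v"
    by (intro limI tendsto_eventually)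
  with v have "top_type x k = v" by (auto simp: top_type_def)
  with ev show ?thesis by simp
qed

lemma good_word_top_type_step:
  assumes "good_word x"
  shows "top_type x (k + 1) = top_step (x (k + 1)) (top_type x k)"
proof -
  have "\<forall>\<^sub>F m in sequentially. - int m \<le> k + 1"
    unfolding eventually_sequentially by (intro exI[of _ "nat (- k - 1)"]) auto
  with good_word_top_type[OF assms, of k] good_word_top_type[OF assms, of "k + 1"]
  have "\<forall>\<^sub>F m :: nat in sequentially. top_type x (k + 1) = top_step (x (k + 1)) (top_type x k)"
    by eventually_elim (simp add: upto_rec2)
  then show ?thesis by simp
qed

lemma good_word_identified:
  assumes "good_word x"
  shows "identified_word x i = replacement (if top_type x (i - 1) = 1 then Ham else Chs) (x i)"
    (is "_ = ?r")
proof -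
  have w: "set (map x [- int m..i - 1]) \<subseteq> stale_symbols" for m
    using assms by (auto simp: good_word_def)
  have nz: "top_type x (i - 1) \<noteq> 0" using top_type_cases[of x "i - 1"] by auto
  have ev: "\<forall>\<^sub>F m in sequentially. identification (map x [- int m..i - 1]) (x i) = Some ?r"
    using good_word_top_type[OF assms, of "i - 1"]
    by eventually_elim (rule identification_eq[OF w _ nz])
  show ?thesis unfolding identified_word_def
  proof (rule the_equality)
    show "\<forall>\<^sub>F m in sequentially. identification (map x [- int m..i - 1]) (x i) = Some ?r" by (rule ev)
    fix s assume "\<forall>\<^sub>F m in sequentially. identification (map x [- int m..i - 1]) (x i) = Some s"
    with ev have "\<forall>\<^sub>F m :: nat in sequentially. s = ?r" by eventually_elim simp
    then show "s = ?r" by simp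
  qed
qed

text \<open>The top type is taken after symbol i has been read, whereas the identification of that
  symbol uses the top type at i - 1.\<close>

definition ham_step :: "(int \<Rightarrow> symbol) \<Rightarrow> int \<Rightarrow> real" where
  "ham_step x i = (symbol_type (x i) + top_type x i) / 2"

definition chs_step :: "(int \<Rightarrow> symbol) \<Rightarrow> int \<Rightarrow> real" where
  "chs_step x i = (symbol_type (x i) - top_type x i) / 2"

lemma good_word_counts:
  assumes "good_word x"
  shows "real_of_int (ham_count (reduce (map (identified_word x) [a..b]))) = (\<Sum>i\<in>{a..b}. ham_step x i)"
    and "real_of_int (chs_count (reduce (map (identified_word x) [a..b]))) = (\<Sum>i\<in>{a..b}. chs_step x i)"
proof -
  have one: "identified_word x i \<in> Theta0"
    "real_of_int (ham_count [identified_word x i]) = ham_step x i"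
    "real_of_int (chs_count [identified_word x i]) = chs_step x i" for i
    using counts_replacement[OF top_type_cases[of x "i - 1"], of "x i"]
      good_word_identified[OF assms, of i] good_word_top_type_step[OF assms, of "i - 1"] assms
    by (simp_all add: ham_step_def chs_step_def good_word_def)
  have *: "real_of_int (ham_count (map (identified_word x) is)) = (\<Sum>i\<leftarrow>is. ham_step x i) \<and>
    real_of_int (chs_count (map (identified_word x) is)) = (\<Sum>i\<leftarrow>is. chs_step x i)" for "is"
  proof (induction "is")
    case (Cons i "is")
    then show ?case
      using counts_append[of "[identified_word x i]" "map (identified_word x) is"] one(2,3)[of i] by simp
  qed (simp add: ham_count_def chs_count_def)
  then have "real_of_int (ham_count (map (identified_word x) is)) = (\<Sum>i\<leftarrow>is. ham_step x i)"
    "real_of_int (chs_count (map (identified_word x) is)) = (\<Sum>i\<leftarrow>is. chs_step x i)" for "is"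
    by simp_all
  moreover have "identified_word x ` {a..b} \<subseteq> Theta0" using one(1) by auto
  ultimately show "real_of_int (ham_count (reduce (map (identified_word x) [a..b]))) = (\<Sum>i\<in>{a..b}. ham_step x i)"
    "real_of_int (chs_count (reduce (map (identified_word x) [a..b]))) = (\<Sum>i\<in>{a..b}. chs_step x i)"
    using counts_reduce[of "map (identified_word x) [a..b]"]
      sum_list_distinct_conv_sum_set[OF distinct_upto, of _ a b] by simp_all
qed

text \<open>At most one of the two ranges is nonempty, and on either side of the origin the steps
  enter with a plus sign.\<close>

lemma good_word_walk:
  assumes "good_word x"
  shows "real_of_int (walk ham_count (identified_word x) i) = (\<Sum>j\<in>{1..i} \<union> {i+1..0}. ham_step x j)"
    and "real_of_int (walk chs_count (identified_word x) i) = (\<Sum>j\<in>{1..i} \<union> {i+1..0}. chs_step x j)"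
  using good_word_counts[OF assms] by (auto simp: walk_def)

section \<open>Additive functionals of a two-state chain\<close>

text \<open>An order has probability 1/2 and keeps the sign; a burger keeps it with probability
  \<mu>/2 and flips it with probability (1 - \<mu>)/2. Testing against arbitrary bounded
  \<open>F k\<close>-measurable variables expresses the Markov property without conditional
  expectations. The conditional mean of the next sign is \<mu> times the present one.\<close>

locale sign_chain = prob_space M for M :: "'a measure" +
  fixes F :: "int \<Rightarrow> 'a measure" and b \<sigma> :: "int \<Rightarrow> 'a \<Rightarrow> real" and \<mu> :: real
  assumes subalg: "\<And>k. subalgebra M (F k)"
    and filt: "\<And>k. subalgebra (F (k + 1)) (F k)"
    and b_adapted: "\<And>k. b k \<in> borel_measurable (F k)"
    and \<sigma>_adapted: "\<And>k. \<sigma> k \<in> borel_measurable (F k)"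
    and b_cases: "\<And>k \<omega>. b k \<omega> = 1 \<or> b k \<omega> = - 1"
    and \<sigma>_cases: "\<And>k \<omega>. \<sigma> k \<omega> = 1 \<or> \<sigma> k \<omega> = - 1"
    and \<mu>: "0 \<le> \<mu>" "\<mu> < 1"
    and chain_step: "\<And>k (Y :: 'a \<Rightarrow> complex) C (g :: real \<Rightarrow> real \<Rightarrow> complex).
      Y \<in> borel_measurable (F k) \<Longrightarrow> (\<And>\<omega>. \<omega> \<in> space M \<Longrightarrow> cmod (Y \<omega>) \<le> C) \<Longrightarrow>
      expectation (\<lambda>\<omega>. Y \<omega> * g (b (k + 1) \<omega>) (\<sigma> (k + 1) \<omega>)) =
      expectation (\<lambda>\<omega>. Y \<omega> * (1 / 2 * g (- 1) (\<sigma> k \<omega>) + \<mu> / 2 * g 1 (\<sigma> k \<omega>) + (1 - \<mu>) / 2 * g 1 (- \<sigma> k \<omega>)))"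
begin

lemma abs_b [simp]: "\<bar>b k \<omega>\<bar> = 1" and abs_\<sigma> [simp]: "\<bar>\<sigma> k \<omega>\<bar> = 1"
  using b_cases[of k \<omega>] \<sigma>_cases[of k \<omega>] by auto

lemma filt_le: "i \<le> j \<Longrightarrow> subalgebra (F j) (F i)"
proof (induction j rule: int_ge_induct)
  case (step j) with filt[of j] show ?case unfolding subalgebra_def by auto
qed (simp add: subalgebra_def)

lemma adapted_mono: "f \<in> measurable (F i) A \<Longrightarrow> i \<le> j \<Longrightarrow> f \<in> measurable (F j) A"
  using measurable_from_subalg[OF filt_le] by blast

lemma adapted_M: "f \<in> measurable (F i) A \<Longrightarrow> f \<in> measurable M A"
  using measurable_from_subalg[OF subalg] by blast

lemma space_F [simp]: "space (F k) = space M"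
  using subalg unfolding subalgebra_def by auto

lemma adapted_sum:
  assumes "\<And>k. f k \<in> borel_measurable (F k)"
  shows "(\<lambda>\<omega>. \<Sum>k\<in>{i+1..j}. f k \<omega> :: real) \<in> borel_measurable (F j)"
  using assms by (intro borel_measurable_sum) (auto intro: adapted_mono)

lemma bounded_integrable:
  fixes f :: "'a \<Rightarrow> 'b::{banach, second_countable_topology}"
  shows "f \<in> borel_measurable M \<Longrightarrow> (\<And>\<omega>. \<omega> \<in> space M \<Longrightarrow> norm (f \<omega>) \<le> C) \<Longrightarrow> integrable M f"
  by (intro integrable_const_bound) auto

lemma norm_expectation_le:
  fixes f :: "'a \<Rightarrow> complex"
  assumes "f \<in> borel_measurable M" "\<And>\<omega>. \<omega> \<in> space M \<Longrightarrow> norm (f \<omega>) \<le> C"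
  shows "norm (expectation f) \<le> C"
proof -
  have i: "integrable M f" by (rule bounded_integrable[OF assms])
  have "norm (expectation f) \<le> expectation (\<lambda>\<omega>. norm (f \<omega>))" by (rule integral_norm_bound)
  also have "\<dots> \<le> expectation (\<lambda>_. C)" using i assms by (intro integral_mono) auto
  finally show ?thesis by (simp add: prob_space)
qed

subsection \<open>Characteristic functions\<close>

text \<open>The asymptotic variance per step of u b + v \<sigma>. The factor of v^2 is the
  autocorrelation sum 1 + 2 (\<mu> + \<mu>^2 + ...). There is no cross term: reversing all signs
  preserves the transition probabilities but would reverse that term.\<close>

definition var_rate :: "real \<Rightarrow> real \<Rightarrow> real" where
  "var_rate u v = u\<^sup>2 + (1 + \<mu>) / (1 - \<mu>) * v\<^sup>2"

text \<open>A perturbation of the constant function 1 that is an eigenfunction of the transfer operator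
  \<open>f \<mapsto> E[cis (h (u b + v \<sigma>)) f(\<sigma>)]\<close> up to an error of third order in \<open>h\<close>; the eigenvalue is
  \<open>1 - h\<^sup>2 var_rate u v / 2\<close>.\<close>

definition corrector :: "real \<Rightarrow> real \<Rightarrow> real \<Rightarrow> real \<Rightarrow> complex" where
  "corrector u v h s = 1 + \<i> * of_real (h * (\<mu> * v / (1 - \<mu>)) * s) + of_real (h\<^sup>2 * (u * v / (1 - \<mu>)) * s)"

lemma cis_second_order: "cmod (cis x - (1 + \<i> * of_real x - of_real (x\<^sup>2 / 2))) \<le> \<bar>x\<bar> ^ 3"
proof -
  have "(\<Sum>k\<le>2. (\<i> * complex_of_real x) ^ k / fact k) = 1 + \<i> * of_real x - of_real (x\<^sup>2 / 2)"
    by (simp add: numeral_2_eq_2) (simp add: complex_eq_iff power2_eq_square)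
  then have "cmod (cis x - (1 + \<i> * of_real x - of_real (x\<^sup>2 / 2))) \<le> \<bar>x\<bar> ^ 3 / fact 3"
    using iexp_approx1[of x 2] by (simp add: cis_conv_exp numeral_3_eq_3)
  also have "\<dots> \<le> \<bar>x\<bar> ^ 3" by (simp add: divide_le_eq fact_numeral mult_le_cancel_left1)
  finally show ?thesis .
qed

text \<open>With x and \<gamma> of order h and \<eta> of order h^2, everything beyond second order
  sits in four terms: the Taylor remainder of \<open>cis x\<close> times the second factor
  contributes 3 A^4 h^3, and each of the three leftover products at most A^4 h^3.\<close>

lemma product_second_order:
  fixes x \<gamma> \<eta> A h s :: real
  assumes A: "A \<ge> 1" and h: "0 \<le> h" "h \<le> 1" and x: "\<bar>x\<bar> \<le> A * h" and \<gamma>: "\<bar>\<gamma>\<bar> \<le> A * h" and \<eta>: "\<bar>\<eta>\<bar> \<le> A * h\<^sup>2"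
    and s: "s = 1 \<or> s = - 1"
  shows "cmod (cis x * (1 + \<i> * of_real (\<gamma> * s) + of_real (\<eta> * s)) -
    (1 + \<i> * of_real (x + \<gamma> * s) + of_real (\<eta> * s - x\<^sup>2 / 2 - x * \<gamma> * s))) \<le> 6 * A ^ 4 * h ^ 3"
proof -
  define r where "r = cis x - (1 + \<i> * of_real x - of_real (x\<^sup>2 / 2))"
  define f where "f = 1 + \<i> * of_real (\<gamma> * s) + (of_real (\<eta> * s) :: complex)"
  have "\<bar>x\<bar> ^ 3 \<le> (A * h) ^ 3" using x by (intro power_mono) auto
  then have r: "cmod r \<le> A ^ 3 * h ^ 3" using cis_second_order[of x] unfolding r_def power_mult_distrib by linarith
  have as: "\<bar>s\<bar> = 1" using s by auto
  have h2: "h\<^sup>2 \<le> 1" using h by (simp add: power_le_one)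
  have "cmod f \<le> cmod (1 + \<i> * of_real (\<gamma> * s)) + cmod (of_real (\<eta> * s))"
    unfolding f_def by (rule norm_triangle_ineq)
  also have "\<dots> \<le> (1 + \<bar>\<gamma>\<bar>) + \<bar>\<eta>\<bar>"
    using norm_triangle_ineq[of 1 "\<i> * complex_of_real (\<gamma> * s)"] as by (simp add: norm_mult abs_mult del: of_real_mult)
  also have "\<dots> \<le> 3 * A"
  proof -
    have "A * h \<le> A" "A * h\<^sup>2 \<le> A" using A h h2 by (simp_all add: mult_left_le)
    with \<gamma> \<eta> A show ?thesis by linarith
  qed
  finally have f: "cmod f \<le> 3 * A" .
  have eq: "cis x * f - (1 + \<i> * of_real (x + \<gamma> * s) + of_real (\<eta> * s - x\<^sup>2 / 2 - x * \<gamma> * s)) =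
      r * f + \<i> * of_real (x * \<eta> * s) - \<i> * of_real (x\<^sup>2 / 2 * \<gamma> * s) - of_real (x\<^sup>2 / 2 * \<eta> * s)"
    unfolding r_def f_def by (simp add: complex_eq_iff power2_eq_square algebra_simps)
  have x2: "x\<^sup>2 / 2 \<le> A\<^sup>2 * h\<^sup>2"
  proof -
    have "x\<^sup>2 \<le> (A * h)\<^sup>2" using x A h by (intro abs_le_square_iff[THEN iffD1]) auto
    then show ?thesis by (simp add: power_mult_distrib) (metis add_increasing2 zero_le_power2 linorder_linear mult_2_right zero_le_mult_iff)
  qed
  have A4: "A ^ 3 \<le> A ^ 4" "A\<^sup>2 \<le> A ^ 4" using A by (auto intro: power_increasing)
  have h3: "0 \<le> h ^ 3" using h by simp
  have n1: "cmod (r * f) \<le> 3 * A ^ 4 * h ^ 3"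
  proof -
    have "cmod (r * f) \<le> (A ^ 3 * h ^ 3) * (3 * A)" unfolding norm_mult
      using r f A h by (intro mult_mono) auto
    also have "\<dots> = 3 * A ^ 4 * h ^ 3" by (simp add: eval_nat_numeral)
    finally show ?thesis .
  qed
  have n2: "cmod (\<i> * of_real (x * \<eta> * s)) \<le> A ^ 4 * h ^ 3"
  proof -
    have "\<bar>x\<bar> * \<bar>\<eta>\<bar> \<le> (A * h) * (A * h\<^sup>2)" using x \<eta> A h by (intro mult_mono) auto
    also have "\<dots> = A\<^sup>2 * h ^ 3" by (simp add: eval_nat_numeral)
    also have "\<dots> \<le> A ^ 4 * h ^ 3" using A4(2) h3 by (rule mult_right_mono)
    finally show ?thesis using as by (simp add: norm_mult abs_mult)
  qed
  have n3: "cmod (\<i> * of_real (x\<^sup>2 / 2 * \<gamma> * s)) \<le> A ^ 4 * h ^ 3"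
  proof -
    have "x\<^sup>2 / 2 * \<bar>\<gamma>\<bar> \<le> (A\<^sup>2 * h\<^sup>2) * (A * h)" using x2 \<gamma> A h by (intro mult_mono) auto
    also have "\<dots> = A ^ 3 * h ^ 3" by (simp add: eval_nat_numeral)
    also have "\<dots> \<le> A ^ 4 * h ^ 3" using A4(1) h3 by (rule mult_right_mono)
    finally show ?thesis using as by (simp add: norm_mult abs_mult norm_power norm_divide)
  qed
  have n4: "cmod (of_real (x\<^sup>2 / 2 * \<eta> * s)) \<le> A ^ 4 * h ^ 3"
  proof -
    have "x\<^sup>2 / 2 * \<bar>\<eta>\<bar> \<le> (A\<^sup>2 * h\<^sup>2) * (A * h\<^sup>2)" using x2 \<eta> A h by (intro mult_mono) auto
    also have "\<dots> = A ^ 3 * h ^ 3 * h" by (simp add: eval_nat_numeral)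
    also have "\<dots> \<le> A ^ 3 * h ^ 3" using A h h3 by (intro mult_left_le) auto
    also have "\<dots> \<le> A ^ 4 * h ^ 3" using A4(1) h3 by (rule mult_right_mono)
    finally show ?thesis using as by (simp add: norm_mult abs_mult norm_power norm_divide)
  qed
  have tri: "cmod (p + q - t - w) \<le> cmod p + cmod q + cmod t + cmod w" for p q t w
    using norm_triangle_ineq4[of "p + q - t" w] norm_triangle_ineq4[of "p + q" t] norm_triangle_ineq[of p q] by linarith
  have "cmod (cis x * f - (1 + \<i> * of_real (x + \<gamma> * s) + of_real (\<eta> * s - x\<^sup>2 / 2 - x * \<gamma> * s))) \<le> 6 * A ^ 4 * h ^ 3"
    unfolding eq by (rule order_trans[OF tri]) (use n1 n2 n3 n4 in linarith)
  then show ?thesis unfolding f_def .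
qed

text \<open>One step of the tilted chain from state s, applied to the corrector. The summands belong
  to an order, to a burger keeping the top type and to a burger flipping it.\<close>

definition transfer :: "real \<Rightarrow> real \<Rightarrow> real \<Rightarrow> real \<Rightarrow> complex" where
  "transfer u v h s =
    1 / 2 * (cis (h * (- u + v * s)) * corrector u v h s) +
    \<mu> / 2 * (cis (h * (u + v * s)) * corrector u v h s) +
    (1 - \<mu>) / 2 * (cis (h * (u - v * s)) * corrector u v h (- s))"

text \<open>The average of the three second-order expansions is the corrector minus q h^2 / 2.
  Replacing this by (1 - q h^2 / 2) times the corrector costs only third order, since the corrector
  is 1 + O(h). The constant 7 is 6 from the remainders, whose weights sum to 1, plus 1 from this
  replacement.\<close>

lemma transfer_corrector:
  "\<exists>C\<ge>0. \<forall>h s. 0 \<le> h \<longrightarrow> h \<le> 1 \<longrightarrow> s = 1 \<or> s = - 1 \<longrightarrow>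
    cmod (transfer u v h s - of_real (1 - var_rate u v * h\<^sup>2 / 2) * corrector u v h s) \<le> C * h ^ 3"
proof -
  define \<gamma> where "\<gamma> = \<mu> * v / (1 - \<mu>)"
  define \<eta> where "\<eta> = u * v / (1 - \<mu>)"
  define q where "q = var_rate u v"
  define A where "A = 1 + \<bar>u\<bar> + \<bar>v\<bar> + \<bar>\<gamma>\<bar> + \<bar>\<eta>\<bar> + \<bar>q\<bar>"
  have A: "A \<ge> 1" "\<bar>u\<bar> + \<bar>v\<bar> \<le> A" "\<bar>\<gamma>\<bar> \<le> A" "\<bar>\<eta>\<bar> \<le> A" "\<bar>q\<bar> \<le> A" unfolding A_def by linarith+
  \<comment> \<open>The first-order Poisson equation: the mean step \<mu> v s and the transported
    correction \<mu> \<gamma> s together must return \<gamma> s.\<close>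
  have \<gamma>: "\<mu> * (v + \<gamma>) = \<gamma>" using \<mu> unfolding \<gamma>_def by (simp add: field_simps)
  \<comment> \<open>At second order the interaction of b with the sign leaves the term u v s. Being
    odd in s it averages out in time but not within one step, and \<eta> absorbs it.\<close>
  have \<eta>: "\<eta> = \<mu> * \<eta> + u * v" using \<mu> unfolding \<eta>_def by (simp add: field_simps)
  have \<gamma>u: "(1 - \<mu>) * (v + \<gamma>) = v" using \<gamma> by (simp add: algebra_simps)
  have q: "q = u\<^sup>2 + v\<^sup>2 + 2 * \<gamma> * v"
    using \<mu> unfolding q_def \<gamma>_def var_rate_def by (simp add: field_simps power2_eq_square)
  have "cmod (transfer u v h s - of_real (1 - q * h\<^sup>2 / 2) * corrector u v h s) \<le> (7 * A ^ 4) * h ^ 3"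
    if h: "0 \<le> h" "h \<le> 1" and s: "s = 1 \<or> s = - 1" for h s
  proof -
    define m where "m x t = 1 + \<i> * complex_of_real (h * x + (h * \<gamma>) * t) +
        of_real ((h\<^sup>2 * \<eta>) * t - (h * x)\<^sup>2 / 2 - (h * x) * (h * \<gamma>) * t)" for x t
    have corr: "corrector u v h t = 1 + \<i> * of_real ((h * \<gamma>) * t) + of_real ((h\<^sup>2 * \<eta>) * t)" for t
      by (simp add: corrector_def \<gamma>_def \<eta>_def)
    have err: "cmod (cis (h * x) * corrector u v h t - m x t) \<le> 6 * A ^ 4 * h ^ 3"
      if "\<bar>x\<bar> \<le> A" "t = 1 \<or> t = - 1" for x t
      unfolding corr m_def
    proof (rule product_second_order[OF A(1) h _ _ _ that(2)])
      show "\<bar>h * x\<bar> \<le> A * h" "\<bar>h * \<gamma>\<bar> \<le> A * h" using h A(3) that(1)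
        by (simp_all add: abs_mult mult.commute[of A] mult_left_mono)
      show "\<bar>h\<^sup>2 * \<eta>\<bar> \<le> A * h\<^sup>2" using A(4) by (simp add: abs_mult mult.commute[of A] mult_left_mono)
    qed
    have as: "\<bar>s\<bar> = 1" using s by auto
    have "\<bar>- u + v * s\<bar> \<le> A" "\<bar>u + v * s\<bar> \<le> A" "\<bar>u - v * s\<bar> \<le> A"
      using s A(2) by auto
    note e = err[OF this(1) s] err[OF this(2) s] err[OF this(3), of "- s"]
    have main: "1 / 2 * m (- u + v * s) s + \<mu> / 2 * m (u + v * s) s + (1 - \<mu>) / 2 * m (u - v * s) (- s) =
        corrector u v h s - of_real (q * h\<^sup>2 / 2)"
    proof -
      have ss: "s * s = 1" using s by auto
      have re: "1 / 2 * ((h\<^sup>2 * \<eta>) * s - (h * (- u + v * s))\<^sup>2 / 2 - (h * (- u + v * s)) * (h * \<gamma>) * s)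
          + \<mu> / 2 * ((h\<^sup>2 * \<eta>) * s - (h * (u + v * s))\<^sup>2 / 2 - (h * (u + v * s)) * (h * \<gamma>) * s)
          + (1 - \<mu>) / 2 * ((h\<^sup>2 * \<eta>) * (- s) - (h * (u - v * s))\<^sup>2 / 2 - (h * (u - v * s)) * (h * \<gamma>) * (- s))
          = (h\<^sup>2 * \<eta>) * s - q * h\<^sup>2 / 2" (is "?l = ?r")
      proof -
        have "?l = h\<^sup>2 * (\<mu> * \<eta> * s - (u\<^sup>2 + v\<^sup>2 * (s * s)) / 2 + u * s * ((1 - \<mu>) * (v + \<gamma>)) - \<gamma> * v * (s * s))"
          by (simp add: field_simps power2_eq_square)
        also have "\<dots> = h\<^sup>2 * ((\<mu> * \<eta> + u * v) * s - q / 2)"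
          unfolding \<gamma>u ss q by (simp add: algebra_simps)
        also have "\<dots> = ?r" unfolding \<eta>[symmetric] by (simp add: algebra_simps)
        finally show ?thesis .
      qed
      have im: "1 / 2 * (h * (- u + v * s) + (h * \<gamma>) * s) + \<mu> / 2 * (h * (u + v * s) + (h * \<gamma>) * s) +
          (1 - \<mu>) / 2 * (h * (u - v * s) + (h * \<gamma>) * (- s)) = (h * \<gamma>) * s" (is "?l = ?r")
      proof -
        have "?l = h * s * (\<mu> * (v + \<gamma>))" by (simp add: field_simps)
        then show ?thesis unfolding \<gamma> by simp
      qed
      show ?thesis
        unfolding m_def corr complex_eq_iff using re im by (simp add: field_simps)
    qed
    have split: "transfer u v h s - of_real (1 - q * h\<^sup>2 / 2) * corrector u v h s =
        1 / 2 * (cis (h * (- u + v * s)) * corrector u v h s - m (- u + v * s) s) +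
        \<mu> / 2 * (cis (h * (u + v * s)) * corrector u v h s - m (u + v * s) s) +
        (1 - \<mu>) / 2 * (cis (h * (u - v * s)) * corrector u v h (- s) - m (u - v * s) (- s)) +
        of_real (q * h\<^sup>2 / 2) * (corrector u v h s - 1)"
    proof -
      have alg: "t = p + (c - k) \<Longrightarrow> t - (1 - k) * c = p + k * (c - 1)" for t p c k :: complex
        by (simp add: algebra_simps)
      have T: "transfer u v h s = (1 / 2 * (cis (h * (- u + v * s)) * corrector u v h s - m (- u + v * s) s) +
        \<mu> / 2 * (cis (h * (u + v * s)) * corrector u v h s - m (u + v * s) s) +
        (1 - \<mu>) / 2 * (cis (h * (u - v * s)) * corrector u v h (- s) - m (u - v * s) (- s))) +
        (1 / 2 * m (- u + v * s) s + \<mu> / 2 * m (u + v * s) s + (1 - \<mu>) / 2 * m (u - v * s) (- s))"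
        unfolding transfer_def by (simp add: algebra_simps diff_divide_distrib add_divide_distrib)
      show ?thesis using alg[OF T[unfolded main]] by (simp only: of_real_diff of_real_1)
    qed
    have last: "cmod (of_real (q * h\<^sup>2 / 2) * (corrector u v h s - 1)) \<le> A ^ 4 * h ^ 3"
    proof -
      have "cmod (corrector u v h s - 1) \<le> \<bar>h * \<gamma>\<bar> + \<bar>h\<^sup>2 * \<eta>\<bar>"
        using norm_triangle_ineq[of "\<i> * complex_of_real ((h * \<gamma>) * s)" "complex_of_real ((h\<^sup>2 * \<eta>) * s)"] as
        by (simp add: corr norm_mult abs_mult norm_power)
      also have "\<dots> \<le> 2 * A * h"
      proof -
        have "h\<^sup>2 * \<bar>\<eta>\<bar> \<le> h * A" using h A(1,4) by (intro mult_mono) (auto simp: power2_eq_square mult_left_le)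
        moreover have "h * \<bar>\<gamma>\<bar> \<le> h * A" using h A(3) by (intro mult_left_mono) auto
        ultimately show ?thesis using h by (simp add: abs_mult algebra_simps)
      qed
      finally have c: "cmod (corrector u v h s - 1) \<le> 2 * A * h" .
      have "\<bar>q * h\<^sup>2 / 2\<bar> \<le> A * h\<^sup>2 / 2" using A(5) by (simp add: abs_mult mult_right_mono)
      then have "cmod (of_real (q * h\<^sup>2 / 2) * (corrector u v h s - 1)) \<le> (A * h\<^sup>2 / 2) * (2 * A * h)"
        unfolding norm_mult norm_of_real using c A h by (intro mult_mono) auto
      also have "\<dots> = A\<^sup>2 * h ^ 3" by (simp add: eval_nat_numeral)
      also have "\<dots> \<le> A ^ 4 * h ^ 3" using A(1) h by (intro mult_right_mono power_increasing) auto
      finally show ?thesis .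
    qed
    have tri: "cmod (p + q + t + w) \<le> cmod p + cmod q + cmod t + cmod w" for p q t w
      using norm_triangle_ineq[of "p + q + t" w] norm_triangle_ineq[of "p + q" t] norm_triangle_ineq[of p q] by linarith
    have "cmod (transfer u v h s - of_real (1 - q * h\<^sup>2 / 2) * corrector u v h s) \<le>
        1 / 2 * (6 * A ^ 4 * h ^ 3) + \<mu> / 2 * (6 * A ^ 4 * h ^ 3) + (1 - \<mu>) / 2 * (6 * A ^ 4 * h ^ 3) + A ^ 4 * h ^ 3"
    proof -
      have w: "cmod (of_real c * y) \<le> c * (6 * A ^ 4 * h ^ 3)" if "c \<ge> 0" "cmod y \<le> 6 * A ^ 4 * h ^ 3" for c y
        using that by (simp add: norm_mult mult_left_mono)
      show ?thesis
        unfolding split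
        using w[of "1/2", OF _ e(1)] w[of "\<mu>/2", OF _ e(2)] w[of "(1-\<mu>)/2", OF _ e(3)] last \<mu> s
        by (intro order_trans[OF tri] add_mono) auto
    qed
    also have "\<dots> = (7 * A ^ 4) * h ^ 3" by (simp add: field_simps)
    finally show ?thesis .
  qed
  then show ?thesis using A(1) unfolding q_def by (intro exI[of _ "7 * A ^ 4"]) auto
qed


lemma corrector_near_1:
  "\<exists>C\<ge>0. \<forall>h s. 0 \<le> h \<longrightarrow> h \<le> 1 \<longrightarrow> s = 1 \<or> s = - 1 \<longrightarrow> cmod (corrector u v h s - 1) \<le> C * h"
proof (intro exI conjI allI impI)
  let ?\<gamma> = "\<mu> * v / (1 - \<mu>)" and ?\<eta> = "u * v / (1 - \<mu>)"
  show "0 \<le> \<bar>?\<gamma>\<bar> + \<bar>?\<eta>\<bar>" by simp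
  fix h s :: real assume h: "0 \<le> h" "h \<le> 1" and s: "s = 1 \<or> s = - 1"
  have "corrector u v h s - 1 = \<i> * of_real (h * ?\<gamma> * s) + of_real (h\<^sup>2 * ?\<eta> * s)"
    unfolding corrector_def by simp
  then have "cmod (corrector u v h s - 1) \<le> cmod (\<i> * of_real (h * ?\<gamma> * s)) + cmod (of_real (h\<^sup>2 * ?\<eta> * s))"
    by (simp only: norm_triangle_ineq)
  also have "\<dots> = h * \<bar>?\<gamma>\<bar> + h\<^sup>2 * \<bar>?\<eta>\<bar>"
    using h s unfolding norm_mult norm_of_real abs_mult by auto
  also have "\<dots> \<le> h * \<bar>?\<gamma>\<bar> + h * \<bar>?\<eta>\<bar>"
    using h by (intro add_left_mono mult_right_mono) (auto simp: power2_eq_square mult_left_le)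
  finally show "cmod (corrector u v h s - 1) \<le> (\<bar>?\<gamma>\<bar> + \<bar>?\<eta>\<bar>) * h" by (simp add: algebra_simps)
qed

section \<open>Iterating the one-step estimate\<close>

definition drift_sum :: "real \<Rightarrow> real \<Rightarrow> int \<Rightarrow> int \<Rightarrow> 'a \<Rightarrow> real" where
  "drift_sum u v i j \<omega> = (\<Sum>k\<in>{i+1..j}. u * b k \<omega> + v * \<sigma> k \<omega>)"

lemma drift_sum_adapted: "drift_sum u v i j \<in> borel_measurable (F j)"
proof -
  note [measurable] = b_adapted \<sigma>_adapted
  show ?thesis unfolding drift_sum_def by (intro adapted_sum) measurable
qed

lemma cis_measurable:
  assumes [measurable]: "f \<in> borel_measurable A" shows "(\<lambda>\<omega>. cis (f \<omega>)) \<in> borel_measurable A"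
  unfolding cis_conv_exp by measurable

lemma corrector_measurable:
  assumes [measurable]: "f \<in> borel_measurable A" shows "(\<lambda>\<omega>. corrector u v h (f \<omega>)) \<in> borel_measurable A"
  unfolding corrector_def by measurable

text \<open>Induction on the number of steps, removing the last one: the phase accumulated before it
  joins Y as a bounded factor from the past, the transfer estimate adds C h^3, and the old error is
  multiplied by the eigenvalue. The smallness assumption on h keeps the eigenvalue in
  [0, 1].\<close>

lemma corrected_char_bound:
  "\<exists>C\<ge>0. \<forall>h. 0 \<le> h \<longrightarrow> h \<le> 1 \<longrightarrow> var_rate u v * h\<^sup>2 \<le> 1 \<longrightarrow>
    (\<forall>i (m::nat) Y. Y \<in> borel_measurable (F i) \<longrightarrow> (\<forall>\<omega>\<in>space M. cmod (Y \<omega>) \<le> 1) \<longrightarrow>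
      cmod (expectation (\<lambda>\<omega>. Y \<omega> * cis (h * drift_sum u v i (i + int m) \<omega>) * corrector u v h (\<sigma> (i + int m) \<omega>))
        - of_real ((1 - var_rate u v * h\<^sup>2 / 2) ^ m) * expectation (\<lambda>\<omega>. Y \<omega> * corrector u v h (\<sigma> i \<omega>))) \<le> real m * C * h ^ 3)"
proof -
  obtain C where C: "C \<ge> 0" "\<And>h s. 0 \<le> h \<Longrightarrow> h \<le> 1 \<Longrightarrow> s = 1 \<or> s = - 1 \<Longrightarrow>
      cmod (transfer u v h s - of_real (1 - var_rate u v * h\<^sup>2 / 2) * corrector u v h s) \<le> C * h ^ 3"
    using transfer_corrector by blast
  obtain D where D: "D \<ge> 0" "\<And>h s. 0 \<le> h \<Longrightarrow> h \<le> 1 \<Longrightarrow> s = 1 \<or> s = - 1 \<Longrightarrow> cmod (corrector u v h s - 1) \<le> D * h"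
    using corrector_near_1 by blast
  have vr: "var_rate u v \<ge> 0" using \<mu> by (simp add: var_rate_def)
  show ?thesis
  proof (intro exI[of _ C] conjI allI impI C(1))
    fix h i Y and m :: nat
    assume h: "0 \<le> h" "h \<le> 1" and q: "var_rate u v * h\<^sup>2 \<le> 1"
      and Y: "Y \<in> borel_measurable (F i)" "\<forall>\<omega>\<in>space M. cmod (Y \<omega>) \<le> 1"
    define e where "e = 1 - var_rate u v * h\<^sup>2 / 2"
    have e: "0 \<le> e" "e \<le> 1" using q vr by (auto simp: e_def)
    have bound: "cmod (corrector u v h (\<sigma> k \<omega>)) \<le> 1 + D" for k \<omega>
    proof -
      have "cmod (corrector u v h (\<sigma> k \<omega>)) \<le> cmod (corrector u v h (\<sigma> k \<omega>) - 1) + 1"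
        using norm_triangle_ineq[of "corrector u v h (\<sigma> k \<omega>) - 1" 1] by simp
      also have "\<dots> \<le> D * h + 1" using D(2)[OF h \<sigma>_cases] by simp
      also have "\<dots> \<le> 1 + D" using mult_left_mono[OF h(2) D(1)] by simp
      finally show ?thesis .
    qed
    let ?E = "\<lambda>m. expectation (\<lambda>\<omega>. Y \<omega> * cis (h * drift_sum u v i (i + int m) \<omega>) * corrector u v h (\<sigma> (i + int m) \<omega>))"
    show "cmod (?E m - of_real ((1 - var_rate u v * h\<^sup>2 / 2) ^ m) * expectation (\<lambda>\<omega>. Y \<omega> * corrector u v h (\<sigma> i \<omega>))) \<le> real m * C * h ^ 3"
    proof (induction m)
      case 0 then show ?case by (simp add: drift_sum_def)
    next
      case (Suc m)
      define k where "k = i + int m"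
      define Y' where "Y' \<omega> = Y \<omega> * cis (h * drift_sum u v i k \<omega>)" for \<omega>
      have Ym: "Y \<in> borel_measurable (F k)" using adapted_mono[OF Y(1), of k] by (simp add: k_def)
      have Y'm: "Y' \<in> borel_measurable (F k)"
        unfolding Y'_def using drift_sum_adapted[of u v i k]
        by (intro borel_measurable_times Ym cis_measurable) measurable
      have Y'b: "cmod (Y' \<omega>) \<le> 1" if "\<omega> \<in> space M" for \<omega>
        using Y(2) that by (simp add: Y'_def norm_mult)
      have step: "?E (Suc m) = expectation (\<lambda>\<omega>. Y' \<omega> * transfer u v h (\<sigma> k \<omega>))"
      proof -
        have "drift_sum u v i (k + 1) \<omega> = drift_sum u v i k \<omega> + (u * b (k + 1) \<omega> + v * \<sigma> (k + 1) \<omega>)" for \<omega>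
        proof -
          have "{i + 1..k + 1} = insert (k + 1) {i + 1..k}" by (auto simp: k_def)
          then show ?thesis by (simp add: drift_sum_def)
        qed
        then have "?E (Suc m) = expectation (\<lambda>\<omega>. Y' \<omega> *
            (\<lambda>x y. cis (h * (u * x + v * y)) * corrector u v h y) (b (k + 1) \<omega>) (\<sigma> (k + 1) \<omega>))"
          by (simp add: Y'_def k_def distrib_left cis_mult[symmetric] mult_ac add_ac)
        also have "\<dots> = expectation (\<lambda>\<omega>. Y' \<omega> * transfer u v h (\<sigma> k \<omega>))"
          using chain_step[OF Y'm Y'b, of "\<lambda>x y. cis (h * (u * x + v * y)) * corrector u v h y"]
          by (simp add: transfer_def)
        finally show ?thesis .
      qed
      have cm: "(\<lambda>\<omega>. corrector u v h (\<sigma> k \<omega>)) \<in> borel_measurable M"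
        by (intro corrector_measurable adapted_M[OF \<sigma>_adapted])
      have tm: "(\<lambda>\<omega>. transfer u v h (\<sigma> k \<omega>)) \<in> borel_measurable M"
      proof -
        note [measurable] = adapted_M[OF \<sigma>_adapted[of k]]
        show ?thesis unfolding transfer_def
          by (intro borel_measurable_add borel_measurable_times borel_measurable_const corrector_measurable cis_measurable) measurable
      qed
      have mult: "(\<lambda>\<omega>. Y' \<omega> * (transfer u v h (\<sigma> k \<omega>) - of_real e * corrector u v h (\<sigma> k \<omega>))) \<in> borel_measurable M"
        by (intro borel_measurable_times borel_measurable_diff borel_measurable_const adapted_M[OF Y'm] cm tm)
      have 1: "cmod (expectation (\<lambda>\<omega>. Y' \<omega> * (transfer u v h (\<sigma> k \<omega>) - of_real e * corrector u v h (\<sigma> k \<omega>)))) \<le> C * h ^ 3"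
      proof (rule norm_expectation_le[OF mult])
        fix \<omega> assume w: "\<omega> \<in> space M"
        have "cmod (Y' \<omega>) * cmod (transfer u v h (\<sigma> k \<omega>) - of_real e * corrector u v h (\<sigma> k \<omega>)) \<le> 1 * (C * h ^ 3)"
          unfolding e_def using C(2)[OF h \<sigma>_cases] Y'b[OF w] by (intro mult_mono) auto
        then show "cmod (Y' \<omega> * (transfer u v h (\<sigma> k \<omega>) - of_real e * corrector u v h (\<sigma> k \<omega>))) \<le> C * h ^ 3"
          by (simp add: norm_mult)
      qed
      have int: "integrable M (\<lambda>\<omega>. Y' \<omega> * corrector u v h (\<sigma> k \<omega>))"
      proof (rule bounded_integrable)
        show "norm (Y' \<omega> * corrector u v h (\<sigma> k \<omega>)) \<le> 1 * (1 + D)" if "\<omega> \<in> space M" for \<omega>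
          unfolding norm_mult using bound Y'b[OF that] by (intro mult_mono) auto
      qed (intro borel_measurable_times adapted_M[OF Y'm] cm)
      have int2: "integrable M (\<lambda>\<omega>. Y' \<omega> * (transfer u v h (\<sigma> k \<omega>) - of_real e * corrector u v h (\<sigma> k \<omega>)))"
      proof (rule bounded_integrable[OF mult])
        show "norm (Y' \<omega> * (transfer u v h (\<sigma> k \<omega>) - of_real e * corrector u v h (\<sigma> k \<omega>))) \<le> 1 * (C * h ^ 3)"
          if "\<omega> \<in> space M" for \<omega>
          unfolding norm_mult e_def using C(2)[OF h \<sigma>_cases] Y'b[OF that] by (intro mult_mono) auto
      qed
      have "expectation (\<lambda>\<omega>. Y' \<omega> * transfer u v h (\<sigma> k \<omega>)) =
          expectation (\<lambda>\<omega>. Y' \<omega> * (transfer u v h (\<sigma> k \<omega>) - of_real e * corrector u v h (\<sigma> k \<omega>)) +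
            of_real e * (Y' \<omega> * corrector u v h (\<sigma> k \<omega>)))"
        by (simp add: algebra_simps)
      also have "\<dots> = expectation (\<lambda>\<omega>. Y' \<omega> * (transfer u v h (\<sigma> k \<omega>) - of_real e * corrector u v h (\<sigma> k \<omega>))) +
            of_real e * ?E m"
        using int int2 by (simp add: Y'_def k_def)
      finally have split: "?E (Suc m) = expectation (\<lambda>\<omega>. Y' \<omega> * (transfer u v h (\<sigma> k \<omega>) - of_real e * corrector u v h (\<sigma> k \<omega>))) +
            of_real e * ?E m" using step by simp
      let ?c = "expectation (\<lambda>\<omega>. Y \<omega> * corrector u v h (\<sigma> i \<omega>))"
      have "?E (Suc m) - of_real (e ^ Suc m) * ?c =
          expectation (\<lambda>\<omega>. Y' \<omega> * (transfer u v h (\<sigma> k \<omega>) - of_real e * corrector u v h (\<sigma> k \<omega>))) +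
          of_real e * (?E m - of_real (e ^ m) * ?c)"
        unfolding split by (simp add: algebra_simps)
      also have "cmod \<dots> \<le> C * h ^ 3 + e * (real m * C * h ^ 3)"
      proof (rule order_trans[OF norm_triangle_ineq add_mono[OF 1]])
        show "cmod (of_real e * (?E m - of_real (e ^ m) * ?c)) \<le> e * (real m * C * h ^ 3)"
        proof -
          have "cmod (of_real e) = e" using e(1) by simp
          then show ?thesis
            using mult_left_mono[OF Suc[folded e_def] e(1)] unfolding norm_mult by (simp only:)
        qed
      qed
      also have "\<dots> \<le> C * h ^ 3 + 1 * (real m * C * h ^ 3)"
        using e C(1) h by (intro add_left_mono mult_right_mono) auto
      finally show ?case unfolding e_def by (simp add: algebra_simps)
    qed
  qed
qed

text \<open>Dropping the corrector costs O(h) at each of the two ends of the interval, and not once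
  per step.\<close>

lemma char_increment_bound:
  "\<exists>C\<ge>0. \<forall>h. 0 \<le> h \<longrightarrow> h \<le> 1 \<longrightarrow> var_rate u v * h\<^sup>2 \<le> 1 \<longrightarrow>
    (\<forall>i (m::nat) Y. Y \<in> borel_measurable (F i) \<longrightarrow> (\<forall>\<omega>\<in>space M. cmod (Y \<omega>) \<le> 1) \<longrightarrow>
      cmod (expectation (\<lambda>\<omega>. Y \<omega> * cis (h * drift_sum u v i (i + int m) \<omega>))
        - of_real ((1 - var_rate u v * h\<^sup>2 / 2) ^ m) * expectation Y) \<le> C * (real m * h ^ 3 + h))"
proof -
  obtain C where C: "C \<ge> 0" "\<And>h i m Y. 0 \<le> h \<Longrightarrow> h \<le> 1 \<Longrightarrow> var_rate u v * h\<^sup>2 \<le> 1 \<Longrightarrow>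
    Y \<in> borel_measurable (F i) \<Longrightarrow> (\<forall>\<omega>\<in>space M. cmod (Y \<omega>) \<le> 1) \<Longrightarrow>
      cmod (expectation (\<lambda>\<omega>. Y \<omega> * cis (h * drift_sum u v i (i + int m) \<omega>) * corrector u v h (\<sigma> (i + int m) \<omega>))
        - of_real ((1 - var_rate u v * h\<^sup>2 / 2) ^ m) * expectation (\<lambda>\<omega>. Y \<omega> * corrector u v h (\<sigma> i \<omega>))) \<le> real m * C * h ^ 3"
    using corrected_char_bound[of u v] by blast
  obtain D where D: "D \<ge> 0" "\<And>h s. 0 \<le> h \<Longrightarrow> h \<le> 1 \<Longrightarrow> s = 1 \<or> s = - 1 \<Longrightarrow> cmod (corrector u v h s - 1) \<le> D * h"
    using corrector_near_1 by blast
  have vr: "var_rate u v \<ge> 0" using \<mu> by (simp add: var_rate_def)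
  show ?thesis
  proof (intro exI[of _ "C + 2 * D"] conjI allI impI)
    show "0 \<le> C + 2 * D" using C(1) D(1) by simp
    fix h i Y and m :: nat
    assume h: "0 \<le> h" "h \<le> 1" and q: "var_rate u v * h\<^sup>2 \<le> 1"
      and Y: "Y \<in> borel_measurable (F i)" "\<forall>\<omega>\<in>space M. cmod (Y \<omega>) \<le> 1"
    define e where "e = 1 - var_rate u v * h\<^sup>2 / 2"
    have e: "0 \<le> e" "e \<le> 1" using q vr by (auto simp: e_def)
    have near: "cmod (expectation (\<lambda>\<omega>. W \<omega> * corrector u v h (\<sigma> j \<omega>)) - expectation W) \<le> D * h"
      if W: "W \<in> borel_measurable M" "\<And>\<omega>. \<omega> \<in> space M \<Longrightarrow> cmod (W \<omega>) \<le> 1" for W j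
    proof -
      have bd: "cmod (W \<omega> * (corrector u v h (\<sigma> j \<omega>) - 1)) \<le> D * h" if "\<omega> \<in> space M" for \<omega>
      proof -
        have "cmod (W \<omega>) * cmod (corrector u v h (\<sigma> j \<omega>) - 1) \<le> 1 * (D * h)"
          using D(2)[OF h \<sigma>_cases] W(2)[OF that] by (intro mult_mono) auto
        then show ?thesis by (simp add: norm_mult)
      qed
      have m: "(\<lambda>\<omega>. W \<omega> * (corrector u v h (\<sigma> j \<omega>) - 1)) \<in> borel_measurable M"
        by (intro borel_measurable_times borel_measurable_diff borel_measurable_const W(1)
            corrector_measurable adapted_M[OF \<sigma>_adapted])
      have "expectation (\<lambda>\<omega>. W \<omega> * corrector u v h (\<sigma> j \<omega>)) =
          expectation (\<lambda>\<omega>. W \<omega> * (corrector u v h (\<sigma> j \<omega>) - 1) + W \<omega>)" by (simp add: algebra_simps)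
      also have "\<dots> = expectation (\<lambda>\<omega>. W \<omega> * (corrector u v h (\<sigma> j \<omega>) - 1)) + expectation W"
        using bounded_integrable[OF m bd] bounded_integrable[OF W] by (rule Bochner_Integration.integral_add)
      finally show ?thesis using norm_expectation_le[OF m bd] by simp
    qed
    let ?W = "\<lambda>\<omega>. Y \<omega> * cis (h * drift_sum u v i (i + int m) \<omega>)"
    have W: "?W \<in> borel_measurable M" "\<And>\<omega>. \<omega> \<in> space M \<Longrightarrow> cmod (?W \<omega>) \<le> 1"
    proof -
      show "?W \<in> borel_measurable M"
        using adapted_M[OF drift_sum_adapted[of u v i "i + int m"]]
        by (intro borel_measurable_times adapted_M[OF Y(1)] cis_measurable) measurable
      show "cmod (?W \<omega>) \<le> 1" if "\<omega> \<in> space M" for \<omega> using Y(2) that by (simp add: norm_mult)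
    qed
    let ?A = "expectation ?W" and ?A' = "expectation (\<lambda>\<omega>. ?W \<omega> * corrector u v h (\<sigma> (i + int m) \<omega>))"
    let ?B = "expectation Y" and ?B' = "expectation (\<lambda>\<omega>. Y \<omega> * corrector u v h (\<sigma> i \<omega>))"
    have 1: "cmod (?A' - ?A) \<le> D * h" by (rule near[OF W])
    have 2: "cmod (?B' - ?B) \<le> D * h" using Y(2) by (intro near adapted_M[OF Y(1)]) auto
    have 3: "cmod (?A' - of_real (e ^ m) * ?B') \<le> real m * C * h ^ 3"
      unfolding e_def by (rule C(2)[OF h q Y])
    have 4: "cmod (of_real (e ^ m) * (?B' - ?B)) \<le> 1 * (D * h)"
      unfolding norm_mult using e 2 by (intro mult_mono) (auto simp: norm_power power_le_one)
    have "?A - of_real (e ^ m) * ?B = (?A' - of_real (e ^ m) * ?B') - (?A' - ?A) + of_real (e ^ m) * (?B' - ?B)"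
      by (simp add: algebra_simps)
    then have "cmod (?A - of_real (e ^ m) * ?B) \<le> real m * C * h ^ 3 + D * h + D * h"
      using norm_triangle_ineq[of "(?A' - of_real (e ^ m) * ?B') - (?A' - ?A)" "of_real (e ^ m) * (?B' - ?B)"]
        norm_triangle_ineq4[of "?A' - of_real (e ^ m) * ?B'" "?A' - ?A"] 1 3 4 by (simp only:)
    also have "\<dots> \<le> (C + 2 * D) * (real m * h ^ 3 + h)"
    proof -
      have "0 \<le> 2 * D * (real m * h ^ 3)" "0 \<le> C * h" using C(1) D(1) h by simp_all
      then show ?thesis by (simp add: algebra_simps)
    qed
    finally show "cmod (?A - of_real ((1 - var_rate u v * h\<^sup>2 / 2) ^ m) * ?B) \<le> (C + 2 * D) * (real m * h ^ 3 + h)"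
      unfolding e_def .
  qed
qed

end

context sign_chain
begin

text \<open>The factors of the earlier intervals form a bounded variable measurable at the start of
  the last one, which therefore splits off with its own deterministic factor. This is the source of
  asymptotic independence.\<close>

lemma joint_char_bound:
  fixes u v :: "nat \<Rightarrow> real" and r :: nat
  shows "\<exists>C\<ge>0. \<forall>h. 0 \<le> h \<longrightarrow> h \<le> 1 \<longrightarrow> (\<forall>j<r. var_rate (u j) (v j) * h\<^sup>2 \<le> 1) \<longrightarrow>
    (\<forall>k :: nat \<Rightarrow> int. (\<forall>j<r. k j \<le> k (Suc j)) \<longrightarrow>
      cmod (expectation (\<lambda>\<omega>. \<Prod>j<r. cis (h * drift_sum (u j) (v j) (k j) (k (Suc j)) \<omega>))
        - (\<Prod>j<r. of_real ((1 - var_rate (u j) (v j) * h\<^sup>2 / 2) ^ nat (k (Suc j) - k j))))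
      \<le> C * (of_int (k r - k 0) * h ^ 3 + h))"
proof (induction r)
  case 0
  show ?case by (intro exI[of _ 0]) (simp add: prob_space)
next
  case (Suc r)
  then obtain C where C: "C \<ge> 0" "\<And>h k. 0 \<le> h \<Longrightarrow> h \<le> 1 \<Longrightarrow> (\<forall>j<r. var_rate (u j) (v j) * h\<^sup>2 \<le> 1) \<Longrightarrow>
      (\<forall>j<r. k j \<le> k (Suc j)) \<Longrightarrow>
      cmod (expectation (\<lambda>\<omega>. \<Prod>j<r. cis (h * drift_sum (u j) (v j) (k j) (k (Suc j)) \<omega>))
        - (\<Prod>j<r. of_real ((1 - var_rate (u j) (v j) * h\<^sup>2 / 2) ^ nat (k (Suc j) - k j))))
      \<le> C * (of_int (k r - k 0) * h ^ 3 + h)" by blast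
  obtain D where D: "D \<ge> 0" "\<And>h i m Y. 0 \<le> h \<Longrightarrow> h \<le> 1 \<Longrightarrow> var_rate (u r) (v r) * h\<^sup>2 \<le> 1 \<Longrightarrow>
      Y \<in> borel_measurable (F i) \<Longrightarrow> (\<forall>\<omega>\<in>space M. cmod (Y \<omega>) \<le> 1) \<Longrightarrow>
      cmod (expectation (\<lambda>\<omega>. Y \<omega> * cis (h * drift_sum (u r) (v r) i (i + int m) \<omega>))
        - of_real ((1 - var_rate (u r) (v r) * h\<^sup>2 / 2) ^ m) * expectation Y) \<le> D * (real m * h ^ 3 + h)"
    using char_increment_bound[of "u r" "v r"] by blast
  show ?case
  proof (intro exI[of _ "C + D"] conjI allI impI)
    show "0 \<le> C + D" using C(1) D(1) by simp
    fix h :: real and k :: "nat \<Rightarrow> int"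
    assume h: "0 \<le> h" "h \<le> 1" and q: "\<forall>j<Suc r. var_rate (u j) (v j) * h\<^sup>2 \<le> 1" and k: "\<forall>j<Suc r. k j \<le> k (Suc j)"
    define Y where "Y \<omega> = (\<Prod>j<r. cis (h * drift_sum (u j) (v j) (k j) (k (Suc j)) \<omega>))" for \<omega>
    define P where "P = (\<Prod>j<r. complex_of_real ((1 - var_rate (u j) (v j) * h\<^sup>2 / 2) ^ nat (k (Suc j) - k j)))"
    define e where "e = complex_of_real ((1 - var_rate (u r) (v r) * h\<^sup>2 / 2) ^ nat (k (Suc r) - k r))"
    have mono: "k i \<le> k j" if "i \<le> j" "j \<le> Suc r" for i j
      using that by (induction j rule: dec_induct) (use k in \<open>auto intro: order_trans\<close>)
    have Ym: "Y \<in> borel_measurable (F (k r))"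
      unfolding Y_def
    proof (intro borel_measurable_prod cis_measurable)
      fix j assume "j \<in> {..<r}"
      then have "drift_sum (u j) (v j) (k j) (k (Suc j)) \<in> borel_measurable (F (k r))"
        by (intro adapted_mono[OF drift_sum_adapted] mono) auto
      then show "(\<lambda>\<omega>. h * drift_sum (u j) (v j) (k j) (k (Suc j)) \<omega>) \<in> borel_measurable (F (k r))" by measurable
    qed
    have Yb: "\<forall>\<omega>\<in>space M. cmod (Y \<omega>) \<le> 1" by (simp add: Y_def prod_norm[symmetric])
    define m where "m = nat (k (Suc r) - k r)"
    have m: "k r + int m = k (Suc r)" "real m = of_int (k (Suc r) - k r)" using k by (auto simp: m_def)
    have e1: "cmod e \<le> 1"
    proof -
      have "var_rate (u r) (v r) * h\<^sup>2 \<ge> 0" using \<mu> by (simp add: var_rate_def)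
      then have "\<bar>1 - var_rate (u r) (v r) * h\<^sup>2 / 2\<bar> \<le> 1" using q[rule_format, of r] by (auto simp: abs_le_iff)
      then show ?thesis unfolding e_def norm_of_real power_abs by (intro power_le_one) auto
    qed
    have 1: "cmod (expectation Y - P) \<le> C * (of_int (k r - k 0) * h ^ 3 + h)"
      unfolding Y_def P_def using q k by (intro C(2) h) auto
    have 2: "cmod (expectation (\<lambda>\<omega>. Y \<omega> * cis (h * drift_sum (u r) (v r) (k r) (k (Suc r)) \<omega>)) - e * expectation Y)
        \<le> D * (of_int (k (Suc r) - k r) * h ^ 3 + h)"
      using D(2)[OF h _ Ym Yb, of m] q unfolding e_def m_def[symmetric] m(1,2) by simp
    have 3: "cmod (e * (expectation Y - P)) \<le> 1 * (C * (of_int (k r - k 0) * h ^ 3 + h))"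
      unfolding norm_mult using e1 1 by (intro mult_mono) auto
    have eq: "expectation (\<lambda>\<omega>. Y \<omega> * cis (h * drift_sum (u r) (v r) (k r) (k (Suc r)) \<omega>)) - P * e =
        (expectation (\<lambda>\<omega>. Y \<omega> * cis (h * drift_sum (u r) (v r) (k r) (k (Suc r)) \<omega>)) - e * expectation Y)
        + e * (expectation Y - P)" by (simp add: algebra_simps)
    have "cmod (expectation (\<lambda>\<omega>. Y \<omega> * cis (h * drift_sum (u r) (v r) (k r) (k (Suc r)) \<omega>)) - P * e)
        \<le> D * (of_int (k (Suc r) - k r) * h ^ 3 + h) + C * (of_int (k r - k 0) * h ^ 3 + h)"
      unfolding eq using norm_triangle_mono[OF 2 3] by (simp only: mult_1_left)
    also have "\<dots> \<le> D * (of_int (k (Suc r) - k 0) * h ^ 3 + h) + C * (of_int (k (Suc r) - k 0) * h ^ 3 + h)"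
      using C(1) D(1) h mono[of 0 r] mono[of r "Suc r"]
      by (intro add_mono mult_left_mono mult_right_mono add_right_mono) auto
    finally show "cmod (expectation (\<lambda>\<omega>. \<Prod>j<Suc r. cis (h * drift_sum (u j) (v j) (k j) (k (Suc j)) \<omega>))
        - (\<Prod>j<Suc r. of_real ((1 - var_rate (u j) (v j) * h\<^sup>2 / 2) ^ nat (k (Suc j) - k j))))
      \<le> (C + D) * (of_int (k (Suc r) - k 0) * h ^ 3 + h)"
      unfolding Y_def P_def e_def by (simp add: algebra_simps)
  qed
qed

section \<open>Passage to the diffusive limit\<close>

text \<open>The power is rewritten as ((1 - c/n)^n)^(m/n); real exponents are legitimate once n >
  |c| makes the base positive.\<close>

lemma power_exp_limit:
  fixes c \<tau> :: real and m :: "nat \<Rightarrow> nat"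
  assumes "(\<lambda>n. real (m n) / real n) \<longlonglongrightarrow> \<tau>"
  shows "(\<lambda>n. (1 - c / real n) ^ m n) \<longlonglongrightarrow> exp (- c * \<tau>)"
proof -
  have "(\<lambda>n. (1 + (- c) / real n) ^ n) \<longlonglongrightarrow> exp (- c)" by (rule tendsto_exp_limit_sequentially)
  then have "(\<lambda>n. ((1 + (- c) / real n) ^ n) powr (real (m n) / real n)) \<longlonglongrightarrow> exp (- c) powr \<tau>"
    using assms by (intro tendsto_powr) auto
  moreover have "\<forall>\<^sub>F n in sequentially. ((1 + (- c) / real n) ^ n) powr (real (m n) / real n) = (1 - c / real n) ^ m n"
    using eventually_gt_at_top[of "nat \<lceil>\<bar>c\<bar>\<rceil>"]
  proof eventually_elim
    case (elim n)
    then have n: "real n > \<bar>c\<bar>" "n > 0" by linarith+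
    then have p: "1 - c / real n > 0" by (simp add: field_simps)
    have "((1 + (- c) / real n) ^ n) powr (real (m n) / real n) = (1 - c / real n) powr (real n * (real (m n) / real n))"
      using p by (simp add: powr_powr powr_realpow[symmetric])
    also have "\<dots> = (1 - c / real n) ^ m n" using n p by (simp add: powr_realpow)
    finally show ?case .
  qed
  ultimately show ?thesis
    by (simp add: exp_powr_real tendsto_cong)
qed

lemma floor_scaled_limit: "(\<lambda>n. of_int \<lfloor>real n * t\<rfloor> / real n) \<longlonglongrightarrow> (t :: real)"
proof (rule real_tendsto_sandwich)
  show "\<forall>\<^sub>F n in sequentially. t - 1 / real n \<le> of_int \<lfloor>real n * t\<rfloor> / real n"
    using eventually_gt_at_top[of 0]
  proof eventually_elim
    case (elim n)
    then have "t - 1 / real n = (real n * t - 1) / real n" by (simp add: field_simps)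
    also have "\<dots> \<le> of_int \<lfloor>real n * t\<rfloor> / real n" by (intro divide_right_mono) linarith+
    finally show ?case .
  qed
  show "\<forall>\<^sub>F n in sequentially. of_int \<lfloor>real n * t\<rfloor> / real n \<le> t"
    using eventually_gt_at_top[of 0]
  proof eventually_elim
    case (elim n)
    have "of_int \<lfloor>real n * t\<rfloor> / real n \<le> (real n * t) / real n" by (intro divide_right_mono) linarith+
    with elim show ?case by simp
  qed
  show "(\<lambda>n. t - 1 / real n) \<longlonglongrightarrow> t"
    using tendsto_diff[OF tendsto_const lim_1_over_n, of t] by simp
qed simp

text \<open>With h = n^(-1/2) the number of steps is of order n, so the error m h^3 + h is of order
  h and vanishes.\<close>

theorem joint_char_limit:
  fixes u v t :: "nat \<Rightarrow> real" and r :: nat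
  assumes t: "\<And>j. j < r \<Longrightarrow> t j \<le> t (Suc j)"
  shows "(\<lambda>n. expectation (\<lambda>\<omega>. \<Prod>j<r. cis (real n powr (- 1 / 2) *
      drift_sum (u j) (v j) \<lfloor>real n * t j\<rfloor> \<lfloor>real n * t (Suc j)\<rfloor> \<omega>)))
    \<longlonglongrightarrow> of_real (\<Prod>j<r. exp (- var_rate (u j) (v j) * (t (Suc j) - t j) / 2))"
proof -
  define h where "h n = real n powr (- 1 / 2)" for n :: nat
  define k where "k n j = \<lfloor>real n * t j\<rfloor>" for n j
  define P where "P n = (\<Prod>j<r. (1 - var_rate (u j) (v j) * (h n)\<^sup>2 / 2) ^ nat (k n (Suc j) - k n j))" for n
  define E where "E n = expectation (\<lambda>\<omega>. \<Prod>j<r. cis (h n * drift_sum (u j) (v j) (k n j) (k n (Suc j)) \<omega>))" for n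
  have h2: "(h n)\<^sup>2 = 1 / real n" if "n > 0" for n
    using that unfolding h_def power2_eq_square powr_add[symmetric] by (simp add: powr_minus_divide)
  have h0: "h \<longlonglongrightarrow> 0" unfolding h_def
    by (rule tendsto_neg_powr) (auto intro: filterlim_real_sequentially)
  have kmono: "k n j \<le> k n (Suc j)" if "j < r" for n j
    unfolding k_def using t[OF that] by (intro floor_mono mult_left_mono) auto
  have kd: "(\<lambda>n. of_int (k n j - k n i) / real n) \<longlonglongrightarrow> t j - t i" for i j
    unfolding of_int_diff diff_divide_distrib k_def by (intro tendsto_diff floor_scaled_limit)
  have "P \<longlonglongrightarrow> (\<Prod>j<r. exp (- var_rate (u j) (v j) * (t (Suc j) - t j) / 2))"
    unfolding P_def
  proof (rule tendsto_prod)
    fix j assume j: "j \<in> {..<r}"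
    let ?q = "var_rate (u j) (v j)"
    have "(\<lambda>n. real (nat (k n (Suc j) - k n j)) / real n) \<longlonglongrightarrow> t (Suc j) - t j"
      using kd[of "Suc j" j] kmono[of j] j by simp
    from power_exp_limit[OF this, of "?q / 2"]
    have "(\<lambda>n. (1 - ?q / 2 / real n) ^ nat (k n (Suc j) - k n j)) \<longlonglongrightarrow> exp (- ?q * (t (Suc j) - t j) / 2)" by simp
    moreover have "\<forall>\<^sub>F n in sequentially. (1 - ?q / 2 / real n) ^ nat (k n (Suc j) - k n j) =
        (1 - ?q * (h n)\<^sup>2 / 2) ^ nat (k n (Suc j) - k n j)"
      using eventually_gt_at_top[of 0] by eventually_elim (simp add: h2 mult.commute)
    ultimately show "(\<lambda>n. (1 - ?q * (h n)\<^sup>2 / 2) ^ nat (k n (Suc j) - k n j)) \<longlonglongrightarrow> exp (- ?q * (t (Suc j) - t j) / 2)"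
      by (simp add: tendsto_cong)
  qed
  then have P: "(\<lambda>n. complex_of_real (P n)) \<longlonglongrightarrow> of_real (\<Prod>j<r. exp (- var_rate (u j) (v j) * (t (Suc j) - t j) / 2))"
    by (rule tendsto_of_real)
  obtain C where C: "C \<ge> 0" "\<And>h k. 0 \<le> h \<Longrightarrow> h \<le> 1 \<Longrightarrow> (\<forall>j<r. var_rate (u j) (v j) * h\<^sup>2 \<le> 1) \<Longrightarrow>
      (\<forall>j<r. k j \<le> k (Suc j)) \<Longrightarrow>
      cmod (expectation (\<lambda>\<omega>. \<Prod>j<r. cis (h * drift_sum (u j) (v j) (k j) (k (Suc j)) \<omega>))
        - (\<Prod>j<r. of_real ((1 - var_rate (u j) (v j) * h\<^sup>2 / 2) ^ nat (k (Suc j) - k j))))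
      \<le> C * (of_int (k r - k 0) * h ^ 3 + h)" using joint_char_bound[of r u v] by blast
  have h2lim: "(\<lambda>n. (h n)\<^sup>2) \<longlonglongrightarrow> 0" using tendsto_power[OF h0, of 2] by simp
  have "\<forall>\<^sub>F n in sequentially. \<forall>j\<in>{..<r}. var_rate (u j) (v j) * (h n)\<^sup>2 \<le> 1"
  proof (intro eventually_ball_finite ballI)
    fix j
    have "(\<lambda>n. var_rate (u j) (v j) * (h n)\<^sup>2) \<longlonglongrightarrow> var_rate (u j) (v j) * 0"
      by (intro tendsto_intros h2lim)
    then have "\<forall>\<^sub>F n in sequentially. var_rate (u j) (v j) * (h n)\<^sup>2 < 1" by (rule order_tendstoD(2)) simp
    then show "\<forall>\<^sub>F n in sequentially. var_rate (u j) (v j) * (h n)\<^sup>2 \<le> 1" by eventually_elim simp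
  qed simp
  moreover have "\<forall>\<^sub>F n in sequentially. h n < 1" using h0 by (rule order_tendstoD(2)) simp
  ultimately have ev: "\<forall>\<^sub>F n in sequentially. cmod (E n - of_real (P n)) \<le> C * (of_int (k n r - k n 0) / real n * h n + h n)"
    using eventually_gt_at_top[of 0]
  proof eventually_elim
    case (elim n)
    have "cmod (E n - of_real (P n)) \<le> C * (of_int (k n r - k n 0) * h n ^ 3 + h n)"
      unfolding E_def P_def of_real_prod using elim kmono by (intro C(2)) (auto simp: h_def)
    also have "h n ^ 3 = 1 / real n * h n" using h2[OF elim(3)] by (simp add: eval_nat_numeral)
    finally show ?case by simp
  qed
  have "(\<lambda>n. C * (of_int (k n r - k n 0) / real n * h n + h n)) \<longlonglongrightarrow> C * ((t r - t 0) * 0 + 0)"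
    by (intro tendsto_intros kd h0)
  then have "(\<lambda>n. C * (of_int (k n r - k n 0) / real n * h n + h n)) \<longlonglongrightarrow> 0"
    by (simp only: mult_zero_right add_0_right)
  with ev have "(\<lambda>n. E n - of_real (P n)) \<longlonglongrightarrow> 0" by (rule Lim_null_comparison)
  from tendsto_add[OF this P] have "E \<longlonglongrightarrow> of_real (\<Prod>j<r. exp (- var_rate (u j) (v j) * (t (Suc j) - t j) / 2))"
    by (simp only: diff_add_cancel add_0_left)
  then show ?thesis unfolding E_def h_def k_def .
qed

end

section \<open>Maximal inequalities\<close>

text \<open>For negative y the bound is the reciprocal of the quadratic Taylor lower bound at x = -
  y.\<close>

lemma exp_quadratic_upper: "exp y \<le> 1 + y + y\<^sup>2" if "\<bar>y\<bar> \<le> 1" for y :: real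
proof (cases "y \<ge> 0")
  case True with that show ?thesis using exp_bound[of y] by simp
next
  case False
  define x where "x = - y"
  have x: "0 \<le> x" "x \<le> 1" using False that by (auto simp: x_def)
  have "1 + x + x\<^sup>2 / 2 \<le> exp x" using x by (intro exp_lower_Taylor_quadratic)
  then have "exp (- x) \<le> inverse (1 + x + x\<^sup>2 / 2)"
    using x by (simp add: exp_minus le_imp_inverse_le add_pos_nonneg)
  also have "\<dots> \<le> 1 - x + x\<^sup>2"
  proof -
    have "(1 - x + x\<^sup>2) * (1 + x + x\<^sup>2 / 2) = 1 + x\<^sup>2 / 2 * (1 + x + x\<^sup>2)"
      by (simp add: field_simps power2_eq_square)
    moreover have "0 \<le> x\<^sup>2 / 2 * (1 + x + x\<^sup>2)" using x by simp
    ultimately have "1 \<le> (1 - x + x\<^sup>2) * (1 + x + x\<^sup>2 / 2)" by linarith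
    moreover have "0 < 1 + x + x\<^sup>2 / 2" using x by (simp add: add_pos_nonneg)
    ultimately show ?thesis by (simp add: inverse_eq_divide divide_le_eq)
  qed
  finally show ?thesis by (simp add: x_def)
qed

text \<open>The fourth power of y/4 <= exp (y/4), whence 256 = 4^4. Order 4 makes the probability of
  a bad block quadratic in its length, which outweighs the number of blocks in the tightness
  estimate.\<close>

lemma exp_minus_le_quartic: "exp (- y) \<le> 256 / y ^ 4" if "y > 0" for y :: real
proof -
  have "(y / 4) ^ 4 \<le> exp (y / 4) ^ 4" using that exp_ge_add_one_self[of "y / 4"] by (intro power_mono) linarith+
  also have "exp (y / 4) ^ 4 = exp y" by (simp add: exp_of_nat_mult[symmetric])
  finally have "y ^ 4 / 256 \<le> exp y" by (simp add: power_divide)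
  then show ?thesis using that by (simp add: exp_minus field_simps)
qed

context sign_chain
begin

text \<open>The linear term has mean zero against Y. So 1 + t <= exp t gives the submartingale
  property, and exp t <= 1 + t + t^2, available because \<theta> c <= 1, gives the growth
  factor.\<close>

lemma martingale_exp_bounds:
  fixes e :: "int \<Rightarrow> 'a \<Rightarrow> real"
  assumes em: "\<And>k. e k \<in> borel_measurable (F k)" and eb: "\<And>k \<omega>. \<bar>e k \<omega>\<bar> \<le> c"
    and mart: "\<And>k Y C. Y \<in> borel_measurable (F k) \<Longrightarrow> (\<And>\<omega>. \<omega> \<in> space M \<Longrightarrow> \<bar>Y \<omega>\<bar> \<le> C) \<Longrightarrow>
      expectation (\<lambda>\<omega>. Y \<omega> * e (k + 1) \<omega>) = 0"
    and Y: "Y \<in> borel_measurable (F k)" "\<And>\<omega>. \<omega> \<in> space M \<Longrightarrow> 0 \<le> Y \<omega>" "\<And>\<omega>. \<omega> \<in> space M \<Longrightarrow> Y \<omega> \<le> C"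
    and \<theta>: "\<theta> \<ge> 0" "\<theta> * c \<le> 1"
  shows "expectation Y \<le> expectation (\<lambda>\<omega>. Y \<omega> * exp (\<theta> * e (k + 1) \<omega>))"
    and "expectation (\<lambda>\<omega>. Y \<omega> * exp (\<theta> * e (k + 1) \<omega>)) \<le> (1 + \<theta>\<^sup>2 * c\<^sup>2) * expectation Y"
proof -
  note [measurable] = adapted_M[OF Y(1)] adapted_M[OF em]
  have c: "c \<ge> 0" using eb[of 0 undefined] by linarith
  have small: "\<bar>\<theta> * e (k + 1) \<omega>\<bar> \<le> 1" for \<omega>
    using mult_left_mono[OF eb[of "k + 1" \<omega>] \<theta>(1)] \<theta> by (simp add: abs_mult)
  have Yabs: "\<bar>Y \<omega>\<bar> \<le> C" if "\<omega> \<in> space M" for \<omega> using Y(2,3)[OF that] by simp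
  have C0: "C \<ge> 0" using Y(2,3) not_empty by force
  have iY: "integrable M Y" using Yabs by (intro bounded_integrable[where C=C]) auto
  have iYe: "integrable M (\<lambda>\<omega>. Y \<omega> * e (k + 1) \<omega>)"
  proof (rule bounded_integrable[where C="C * c"])
    show "norm (Y \<omega> * e (k + 1) \<omega>) \<le> C * c" if "\<omega> \<in> space M" for \<omega>
      unfolding norm_mult using Yabs[OF that] eb[of "k + 1" \<omega>] C0 by (intro mult_mono) auto
  qed measurable
  have iexp: "integrable M (\<lambda>\<omega>. Y \<omega> * exp (\<theta> * e (k + 1) \<omega>))"
  proof (rule bounded_integrable[where C="C * exp 1"])
    show "norm (Y \<omega> * exp (\<theta> * e (k + 1) \<omega>)) \<le> C * exp 1" if "\<omega> \<in> space M" for \<omega>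
      unfolding norm_mult using Yabs[OF that] small[of \<omega>] C0 by (intro mult_mono) auto
  qed measurable
  have zero: "expectation (\<lambda>\<omega>. Y \<omega> * e (k + 1) \<omega>) = 0" using Yabs by (rule mart[OF Y(1)])
  have lin: "expectation (\<lambda>\<omega>. a * Y \<omega> + \<theta> * (Y \<omega> * e (k + 1) \<omega>)) = a * expectation Y" for a
    using iY iYe zero by simp
  have ilin: "integrable M (\<lambda>\<omega>. a * Y \<omega> + \<theta> * (Y \<omega> * e (k + 1) \<omega>))" for a
    using iY iYe by simp
  have "expectation (\<lambda>\<omega>. 1 * Y \<omega> + \<theta> * (Y \<omega> * e (k + 1) \<omega>)) \<le> expectation (\<lambda>\<omega>. Y \<omega> * exp (\<theta> * e (k + 1) \<omega>))"
  proof (rule integral_mono[OF ilin iexp])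
    fix \<omega> assume w: "\<omega> \<in> space M"
    have "Y \<omega> * (1 + \<theta> * e (k + 1) \<omega>) \<le> Y \<omega> * exp (\<theta> * e (k + 1) \<omega>)"
      using Y(2)[OF w] by (intro mult_left_mono exp_ge_add_one_self)
    then show "1 * Y \<omega> + \<theta> * (Y \<omega> * e (k + 1) \<omega>) \<le> Y \<omega> * exp (\<theta> * e (k + 1) \<omega>)" by (simp add: algebra_simps)
  qed
  then show "expectation Y \<le> expectation (\<lambda>\<omega>. Y \<omega> * exp (\<theta> * e (k + 1) \<omega>))" unfolding lin by simp
  have "expectation (\<lambda>\<omega>. Y \<omega> * exp (\<theta> * e (k + 1) \<omega>)) \<le> expectation (\<lambda>\<omega>. (1 + \<theta>\<^sup>2 * c\<^sup>2) * Y \<omega> + \<theta> * (Y \<omega> * e (k + 1) \<omega>))"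
  proof (rule integral_mono[OF iexp ilin])
    fix \<omega> assume w: "\<omega> \<in> space M"
    have "(e (k + 1) \<omega>)\<^sup>2 \<le> c\<^sup>2" using eb[of "k + 1" \<omega>] c by (intro abs_le_square_iff[THEN iffD1]) simp
    then have "(\<theta> * e (k + 1) \<omega>)\<^sup>2 \<le> \<theta>\<^sup>2 * c\<^sup>2" unfolding power_mult_distrib by (intro mult_left_mono) auto
    then have "exp (\<theta> * e (k + 1) \<omega>) \<le> 1 + \<theta> * e (k + 1) \<omega> + \<theta>\<^sup>2 * c\<^sup>2"
      using exp_quadratic_upper[OF small[of \<omega>]] by linarith
    from mult_left_mono[OF this Y(2)[OF w]]
    show "Y \<omega> * exp (\<theta> * e (k + 1) \<omega>) \<le> (1 + \<theta>\<^sup>2 * c\<^sup>2) * Y \<omega> + \<theta> * (Y \<omega> * e (k + 1) \<omega>)" by (simp add: algebra_simps)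
  qed
  then show "expectation (\<lambda>\<omega>. Y \<omega> * exp (\<theta> * e (k + 1) \<omega>)) \<le> (1 + \<theta>\<^sup>2 * c\<^sup>2) * expectation Y" unfolding lin .
qed

text \<open>Doob's argument by first passage: \<open>A k\<close> is the event that the sum first
  reaches x at step k. The submartingale property carries the exponential from k to m on this event,
  and the disjoint events together contribute at most the full exponential moment.\<close>

lemma martingale_maximal_exp:
  fixes e :: "int \<Rightarrow> 'a \<Rightarrow> real"
  assumes em: "\<And>k. e k \<in> borel_measurable (F k)" and eb: "\<And>k \<omega>. \<bar>e k \<omega>\<bar> \<le> c"
    and mart: "\<And>k Y C. Y \<in> borel_measurable (F k) \<Longrightarrow> (\<And>\<omega>. \<omega> \<in> space M \<Longrightarrow> \<bar>Y \<omega>\<bar> \<le> C) \<Longrightarrow>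
      expectation (\<lambda>\<omega>. Y \<omega> * e (k + 1) \<omega>) = 0"
    and \<theta>: "\<theta> \<ge> 0" "\<theta> * c \<le> 1"
  shows "prob {\<omega> \<in> space M. \<exists>k\<le>m. x \<le> (\<Sum>l\<in>{i+1..i + int k}. e l \<omega>)} \<le> exp (real m * (\<theta>\<^sup>2 * c\<^sup>2) - \<theta> * x)"
proof -
  define S where "S k \<omega> = (\<Sum>l\<in>{i+1..i + int k}. e l \<omega>)" for k \<omega>
  define A where "A k = {\<omega> \<in> space M. x \<le> S k \<omega> \<and> (\<forall>j<k. S j \<omega> < x)}" for k :: nat
  have c: "c \<ge> 0" using eb[of 0 undefined] by linarith
  have S_ad: "S k \<in> borel_measurable (F (i + int k))" for k
    unfolding S_def using em by (intro adapted_sum)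
  have S_Suc: "S (Suc k) \<omega> = S k \<omega> + e (i + int k + 1) \<omega>" for k \<omega>
  proof -
    have "{i + 1..i + int (Suc k)} = insert (i + int k + 1) {i + 1..i + int k}" by auto
    then show ?thesis by (simp add: S_def)
  qed
  have S_bound: "\<bar>S k \<omega>\<bar> \<le> real k * c" for k \<omega>
  proof (induction k)
    case (Suc k) then show ?case using eb[of "i + int k + 1" \<omega>] by (simp add: S_Suc algebra_simps)
  qed (simp add: S_def)
  have A_ad: "A k \<in> sets (F (i + int k))" for k
  proof -
    have [measurable]: "S j \<in> borel_measurable (F (i + int k))" if "j \<le> k" for j
      using that by (intro adapted_mono[OF S_ad]) auto
    have "A k = {\<omega> \<in> space (F (i + int k)). x \<le> S k \<omega>} \<inter> (space (F (i + int k)) \<inter> (\<Inter>j\<in>{..<k}. {\<omega> \<in> space (F (i + int k)). S j \<omega> < x}))"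
      unfolding A_def by auto
    also have "\<dots> \<in> sets (F (i + int k))"
    proof (rule sets.Int)
      show "{\<omega> \<in> space (F (i + int k)). x \<le> S k \<omega>} \<in> sets (F (i + int k))" by measurable
      show "space (F (i + int k)) \<inter> (\<Inter>j\<in>{..<k}. {\<omega> \<in> space (F (i + int k)). S j \<omega> < x}) \<in> sets (F (i + int k))"
      proof (cases "k = 0")
        case False
        then have "(\<Inter>j\<in>{..<k}. {\<omega> \<in> space (F (i + int k)). S j \<omega> < x}) \<in> sets (F (i + int k))"
          by (intro sets.finite_INT) (auto intro!: borel_measurable_less[unfolded pred_def] simp del: space_F)
        then show ?thesis by (intro sets.Int sets.top)
      next
        case True
        then show ?thesis using sets.top[of "F i", unfolded space_F] by simp
      qed
    qed
    finally show ?thesis .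
  qed
  have A_M: "A k \<in> events" for k using A_ad subalg unfolding subalgebra_def by blast
  define G where "G k j = expectation (\<lambda>\<omega>. indicator (A k) \<omega> * exp (\<theta> * S j \<omega>))" for k j
  have exp_bound: "exp (\<theta> * S j \<omega>) \<le> exp (\<theta> * (real j * c))" for j \<omega>
    using S_bound[of j \<omega>] \<theta>(1) by (simp add: mult_left_mono)
  have int: "integrable M (\<lambda>\<omega>. indicator B \<omega> * exp (\<theta> * S j \<omega>))" if [measurable]: "B \<in> events" for j B
  proof (rule bounded_integrable[where C="exp (\<theta> * (real j * c))"])
    note [measurable] = adapted_M[OF S_ad[of j]]
    show "(\<lambda>\<omega>. indicator B \<omega> * exp (\<theta> * S j \<omega>)) \<in> borel_measurable M" by measurable
  qed (use exp_bound in \<open>auto simp: indicator_def\<close>)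
  have G_mono: "G k j \<le> G k (Suc j)" if "k \<le> j" for k j
  proof -
    have Am: "A k \<in> sets (F (i + int j))" using A_ad[of k] filt_le[of "i + int k" "i + int j"] that
      unfolding subalgebra_def by auto
    note [measurable] = S_ad[of j]
    have Ym: "(\<lambda>\<omega>. indicator (A k) \<omega> * exp (\<theta> * S j \<omega>)) \<in> borel_measurable (F (i + int j))" using Am by measurable
    have "G k j \<le> expectation (\<lambda>\<omega>. indicator (A k) \<omega> * exp (\<theta> * S j \<omega>) * exp (\<theta> * e (i + int j + 1) \<omega>))"
      unfolding G_def
    proof (rule martingale_exp_bounds(1)[OF em eb _ Ym _ _ \<theta>])
      show "expectation (\<lambda>\<omega>. Y \<omega> * e (k + 1) \<omega>) = 0"
        if "Y \<in> borel_measurable (F k)" "\<And>\<omega>. \<omega> \<in> space M \<Longrightarrow> \<bar>Y \<omega>\<bar> \<le> C" for k Y C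
        using that by (rule mart)
      show "indicator (A k) \<omega> * exp (\<theta> * S j \<omega>) \<le> exp (\<theta> * (real j * c))" for \<omega>
        using exp_bound[of j \<omega>] by (auto simp: indicator_def)
    qed simp
    also have "\<dots> = G k (Suc j)" unfolding G_def S_Suc by (simp add: distrib_left exp_add mult_ac)
    finally show ?thesis .
  qed
  have G_ge: "exp (\<theta> * x) * prob (A k) \<le> G k m" if "k \<le> m" for k
  proof -
    have "G k k \<le> G k m" using that by (induction m rule: dec_induct) (auto intro: order_trans G_mono)
    moreover have "exp (\<theta> * x) * prob (A k) \<le> G k k"
    proof -
      have "exp (\<theta> * x) * prob (A k) = expectation (\<lambda>\<omega>. exp (\<theta> * x) * indicator (A k) \<omega>)"
        using A_M by simp
      also have "\<dots> \<le> G k k" unfolding G_def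
      proof (rule integral_mono)
        show "exp (\<theta> * x) * indicator (A k) \<omega> \<le> indicator (A k) \<omega> * exp (\<theta> * S k \<omega>)" for \<omega>
          using \<theta>(1) by (auto simp: indicator_def A_def mult_left_mono)
      qed (use int[OF A_M] A_M in \<open>auto simp: emeasure_eq_measure\<close>)
      finally show ?thesis .
    qed
    ultimately show ?thesis by simp
  qed
  have total: "expectation (\<lambda>\<omega>. exp (\<theta> * S j \<omega>)) \<le> exp (real j * (\<theta>\<^sup>2 * c\<^sup>2))" for j
  proof (induction j)
    case 0 then show ?case by (simp add: S_def prob_space)
  next
    case (Suc j)
    note [measurable] = S_ad[of j]
    have Ym: "(\<lambda>\<omega>. exp (\<theta> * S j \<omega>)) \<in> borel_measurable (F (i + int j))" by measurable
    have "expectation (\<lambda>\<omega>. exp (\<theta> * S j \<omega>) * exp (\<theta> * e (i + int j + 1) \<omega>)) \<le>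
        (1 + \<theta>\<^sup>2 * c\<^sup>2) * expectation (\<lambda>\<omega>. exp (\<theta> * S j \<omega>))"
    proof (rule martingale_exp_bounds(2)[OF em eb _ Ym _ _ \<theta>])
      show "expectation (\<lambda>\<omega>. Y \<omega> * e (k + 1) \<omega>) = 0"
        if "Y \<in> borel_measurable (F k)" "\<And>\<omega>. \<omega> \<in> space M \<Longrightarrow> \<bar>Y \<omega>\<bar> \<le> C" for k Y C
        using that by (rule mart)
      show "exp (\<theta> * S j \<omega>) \<le> exp (\<theta> * (real j * c))" for \<omega> by (rule exp_bound)
    qed simp
    also have "\<dots> \<le> exp (\<theta>\<^sup>2 * c\<^sup>2) * exp (real j * (\<theta>\<^sup>2 * c\<^sup>2))"
      using Suc exp_ge_add_one_self[of "\<theta>\<^sup>2 * c\<^sup>2"] by (intro mult_mono) auto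
    finally show ?case unfolding S_Suc by (simp add: distrib_left distrib_right exp_add mult_ac)
  qed
  have "A k \<inter> A l = {}" if "k < l" for k l
    using that unfolding A_def by force
  then have disj: "disjoint_family A"
    unfolding disjoint_family_on_def by (metis Int_commute linorder_neqE_nat)
  have U: "{\<omega> \<in> space M. \<exists>k\<le>m. x \<le> (\<Sum>l\<in>{i+1..i + int k}. e l \<omega>)} = (\<Union>k\<in>{..m}. A k)"
  proof (intro equalityI subsetI)
    fix \<omega> assume "\<omega> \<in> {\<omega> \<in> space M. \<exists>k\<le>m. x \<le> (\<Sum>l\<in>{i+1..i + int k}. e l \<omega>)}"
    then obtain k where k: "\<omega> \<in> space M" "k \<le> m" "x \<le> S k \<omega>" unfolding S_def by blast
    define k' where "k' = (LEAST k. x \<le> S k \<omega>)"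
    have "x \<le> S k' \<omega>" unfolding k'_def using k(3) by (rule LeastI)
    moreover have "k' \<le> k" unfolding k'_def using k(3) by (rule Least_le)
    moreover have "\<forall>j<k'. S j \<omega> < x" unfolding k'_def using not_less_Least by (metis not_le)
    ultimately show "\<omega> \<in> (\<Union>k\<in>{..m}. A k)" using k unfolding A_def by auto
  qed (auto simp: A_def S_def)
  have "exp (\<theta> * x) * prob (\<Union>k\<in>{..m}. A k) = (\<Sum>k\<le>m. exp (\<theta> * x) * prob (A k))"
    using A_M disj by (subst finite_measure_finite_Union) (auto simp: sum_distrib_left disjoint_family_on_def)
  also have "\<dots> \<le> (\<Sum>k\<le>m. G k m)" by (intro sum_mono G_ge) auto
  also have "\<dots> = expectation (\<lambda>\<omega>. \<Sum>k\<le>m. indicator (A k) \<omega> * exp (\<theta> * S m \<omega>))"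
    unfolding G_def using int[OF A_M] by (subst Bochner_Integration.integral_sum) auto
  also have "\<dots> \<le> expectation (\<lambda>\<omega>. exp (\<theta> * S m \<omega>))"
  proof (rule integral_mono)
    show "integrable M (\<lambda>\<omega>. \<Sum>k\<le>m. indicator (A k) \<omega> * exp (\<theta> * S m \<omega>))"
      by (intro Bochner_Integration.integrable_sum int A_M)
    show "integrable M (\<lambda>\<omega>. exp (\<theta> * S m \<omega>))"
      using adapted_M[OF S_ad[of m]] exp_bound[of m]
      by (intro bounded_integrable[where C="exp (\<theta> * (real m * c))"]) auto
    fix \<omega> assume w: "\<omega> \<in> space M"
    have "(\<Sum>k\<le>m. indicator (A k) \<omega> :: real) = indicator (\<Union>k\<in>{..m}. A k) \<omega>"
      using disj by (intro indicator_UN_disjoint[symmetric]) (auto simp: disjoint_family_on_def)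
    also have "\<dots> \<le> 1" by (simp add: indicator_def)
    finally have "(\<Sum>k\<le>m. indicator (A k) \<omega>) * exp (\<theta> * S m \<omega>) \<le> 1 * exp (\<theta> * S m \<omega>)" by (intro mult_right_mono) auto
    then show "(\<Sum>k\<le>m. indicator (A k) \<omega> * exp (\<theta> * S m \<omega>)) \<le> exp (\<theta> * S m \<omega>)" by (simp add: sum_distrib_right)
  qed
  also have "\<dots> \<le> exp (real m * (\<theta>\<^sup>2 * c\<^sup>2))" by (rule total)
  finally have "exp (\<theta> * x) * prob (\<Union>k\<in>{..m}. A k) \<le> exp (real m * (\<theta>\<^sup>2 * c\<^sup>2))" .
  then have "prob (\<Union>k\<in>{..m}. A k) \<le> exp (real m * (\<theta>\<^sup>2 * c\<^sup>2)) / exp (\<theta> * x)" by (simp add: field_simps)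
  then show ?thesis unfolding U exp_diff .
qed

text \<open>The choice \<theta> = 1 / sqrt m makes the exponential moment the constant exp (c^2),
  and c^2 <= m ensures \<theta> c <= 1. The quartic bound on exp (- \<theta> x) yields m^2 / x^4;
  using it for e and for - e turns 256 into 512.\<close>

lemma martingale_maximal:
  fixes e :: "int \<Rightarrow> 'a \<Rightarrow> real"
  assumes em: "\<And>k. e k \<in> borel_measurable (F k)" and eb: "\<And>k \<omega>. \<bar>e k \<omega>\<bar> \<le> c"
    and mart: "\<And>k Y C. Y \<in> borel_measurable (F k) \<Longrightarrow> (\<And>\<omega>. \<omega> \<in> space M \<Longrightarrow> \<bar>Y \<omega>\<bar> \<le> C) \<Longrightarrow>
      expectation (\<lambda>\<omega>. Y \<omega> * e (k + 1) \<omega>) = 0"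
    and m: "c\<^sup>2 \<le> real m" "m > 0" and x: "x > 0"
  shows "prob {\<omega> \<in> space M. \<exists>k\<le>m. x \<le> \<bar>\<Sum>l\<in>{i+1..i + int k}. e l \<omega>\<bar>} \<le> 512 * exp (c\<^sup>2) * (real m)\<^sup>2 / x ^ 4"
proof -
  define \<theta> where "\<theta> = 1 / sqrt (real m)"
  have c: "c \<ge> 0" using eb[of 0 undefined] by linarith
  have \<theta>: "\<theta> \<ge> 0" "\<theta> * c \<le> 1"
  proof -
    have "c \<le> sqrt (real m)" using m(1) by (rule real_le_rsqrt)
    then show "\<theta> \<ge> 0" "\<theta> * c \<le> 1" using m(2) by (simp_all add: \<theta>_def)
  qed
  have "exp (real m * (\<theta>\<^sup>2 * c\<^sup>2) - \<theta> * x) = exp (c\<^sup>2) * exp (- (\<theta> * x))"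
    using m(2) by (simp add: \<theta>_def power_divide exp_add[symmetric])
  also have "\<dots> \<le> exp (c\<^sup>2) * (256 / (\<theta> * x) ^ 4)"
    using x m(2) by (intro mult_left_mono exp_minus_le_quartic) (auto simp: \<theta>_def)
  also have "(\<theta> * x) ^ 4 = x ^ 4 / (real m)\<^sup>2"
  proof -
    have "sqrt (real m) ^ 4 = (sqrt (real m) ^ 2) ^ 2" by (simp only: power_mult[symmetric]) simp
    then show ?thesis by (simp add: \<theta>_def power_divide power_mult_distrib)
  qed
  finally have bd: "exp (real m * (\<theta>\<^sup>2 * c\<^sup>2) - \<theta> * x) \<le> 256 * exp (c\<^sup>2) * (real m)\<^sup>2 / x ^ 4" by (simp add: mult_ac)
  note [measurable] = adapted_M[OF em]
  let ?P = "{\<omega> \<in> space M. \<exists>k\<le>m. x \<le> (\<Sum>l\<in>{i+1..i + int k}. e l \<omega>)}"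
  let ?N = "{\<omega> \<in> space M. \<exists>k\<le>m. x \<le> (\<Sum>l\<in>{i+1..i + int k}. - e l \<omega>)}"
  have "?P \<in> events" "?N \<in> events" by measurable
  moreover have "{\<omega> \<in> space M. \<exists>k\<le>m. x \<le> \<bar>\<Sum>l\<in>{i+1..i + int k}. e l \<omega>\<bar>} \<subseteq> ?P \<union> ?N"
    by (auto simp: sum_negf abs_if split: if_splits)
  ultimately have "prob {\<omega> \<in> space M. \<exists>k\<le>m. x \<le> \<bar>\<Sum>l\<in>{i+1..i + int k}. e l \<omega>\<bar>} \<le> prob (?P \<union> ?N)"
    by (intro finite_measure_mono) auto
  also have "\<dots> \<le> prob ?P + prob ?N" using \<open>?P \<in> events\<close> \<open>?N \<in> events\<close> by (rule measure_Un_le)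
  also have "\<dots> \<le> exp (real m * (\<theta>\<^sup>2 * c\<^sup>2) - \<theta> * x) + exp (real m * (\<theta>\<^sup>2 * c\<^sup>2) - \<theta> * x)"
  proof (rule add_mono)
    show "prob ?P \<le> exp (real m * (\<theta>\<^sup>2 * c\<^sup>2) - \<theta> * x)" by (rule martingale_maximal_exp[OF em eb mart \<theta>])
    have neg: "expectation (\<lambda>\<omega>. Y \<omega> * - e (k + 1) \<omega>) = 0"
      if "Y \<in> borel_measurable (F k)" "\<And>\<omega>. \<omega> \<in> space M \<Longrightarrow> \<bar>Y \<omega>\<bar> \<le> C" for k Y C
      using mart[OF that] by simp
    show "prob ?N \<le> exp (real m * (\<theta>\<^sup>2 * c\<^sup>2) - \<theta> * x)"
      by (rule martingale_maximal_exp[where e="\<lambda>k \<omega>. - e k \<omega>" and c=c, OF _ _ neg \<theta>]) (use em eb in auto)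
  qed
  also have "\<dots> \<le> 512 * exp (c\<^sup>2) * (real m)\<^sup>2 / x ^ 4" using bd by simp
  finally show ?thesis .
qed


section \<open>The two martingales of the chain\<close>

lemma chain_step_real:
  assumes "Y \<in> borel_measurable (F k)" "\<And>\<omega>. \<omega> \<in> space M \<Longrightarrow> \<bar>Y \<omega>\<bar> \<le> C"
  shows "expectation (\<lambda>\<omega>. Y \<omega> * g (b (k + 1) \<omega>) (\<sigma> (k + 1) \<omega>)) =
      expectation (\<lambda>\<omega>. Y \<omega> * (1 / 2 * g (- 1) (\<sigma> k \<omega>) + \<mu> / 2 * g 1 (\<sigma> k \<omega>) + (1 - \<mu>) / 2 * g 1 (- \<sigma> k \<omega>)))"
proof -
  have "(\<lambda>\<omega>. complex_of_real (Y \<omega>)) \<in> borel_measurable (F k)" using assms(1) by measurable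
  from chain_step[OF this, of C "\<lambda>x y. complex_of_real (g x y)"] assms(2)
  have "complex_of_real (expectation (\<lambda>\<omega>. Y \<omega> * g (b (k + 1) \<omega>) (\<sigma> (k + 1) \<omega>))) =
      complex_of_real (expectation (\<lambda>\<omega>. Y \<omega> * (1 / 2 * g (- 1) (\<sigma> k \<omega>) + \<mu> / 2 * g 1 (\<sigma> k \<omega>) + (1 - \<mu>) / 2 * g 1 (- \<sigma> k \<omega>))))"
    unfolding integral_complex_of_real[symmetric] by simp
  then show ?thesis by (simp only: of_real_eq_iff)
qed

text \<open>Subtracting the conditional mean, \<mu> times the previous sign, turns the signs into
  martingale differences.\<close>

definition type_martingale :: "int \<Rightarrow> 'a \<Rightarrow> real" where
  "type_martingale k \<omega> = \<sigma> k \<omega> - \<mu> * \<sigma> (k - 1) \<omega>"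

text \<open>(1 - \<mu>) times the sum of signs is a martingale up to a boundary term of size at most
  2 \<mu>.\<close>

lemma type_martingale_sum:
  "(\<Sum>l\<in>{i+1..i + int k}. type_martingale l \<omega>) =
    (1 - \<mu>) * (\<Sum>l\<in>{i+1..i + int k}. \<sigma> l \<omega>) + \<mu> * (\<sigma> (i + int k) \<omega> - \<sigma> i \<omega>)"
proof (induction k)
  case (Suc k)
  have "{i + 1..i + int (Suc k)} = insert (i + int k + 1) {i + 1..i + int k}" by auto
  then show ?case using Suc by (simp add: type_martingale_def algebra_simps)
qed simp

text \<open>The threshold 4 for m is the square of the bound 2 on the increments of the sign
  martingale. For x >= 4 / (1 - \<mu>) the boundary term is at most half of (1 - \<mu>) x, so a
  large sum of signs forces the martingale to at least y = (1 - \<mu>) x / 2.\<close>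

lemma walk_maximal:
  "\<exists>K m0 x0. K \<ge> 0 \<and> x0 > 0 \<and> (\<forall>i m x. m0 \<le> m \<longrightarrow> x0 \<le> x \<longrightarrow>
    prob {\<omega> \<in> space M. \<exists>k\<le>m. x \<le> \<bar>\<Sum>l\<in>{i+1..i + int k}. b l \<omega>\<bar> \<or> x \<le> \<bar>\<Sum>l\<in>{i+1..i + int k}. \<sigma> l \<omega>\<bar>}
      \<le> K * (real m)\<^sup>2 / x ^ 4)"
proof -
  note [measurable] = adapted_M[OF b_adapted] adapted_M[OF \<sigma>_adapted]
  define d where "d = (1 - \<mu>) / 2"
  have d: "d > 0" using \<mu> by (simp add: d_def)
  define K where "K = 512 * exp 1 + 512 * exp 4 / d ^ 4"
  have mb: "expectation (\<lambda>\<omega>. Y \<omega> * b (k + 1) \<omega>) = 0"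
    if Y: "Y \<in> borel_measurable (F k)" "\<And>\<omega>. \<omega> \<in> space M \<Longrightarrow> \<bar>Y \<omega>\<bar> \<le> C" for Y k C
  proof -
    have "1 / 2 * (- 1) + \<mu> / 2 * 1 + (1 - \<mu>) / 2 * 1 = (0 :: real)" by (simp add: field_simps)
    with chain_step_real[OF Y, of "\<lambda>x y. x"] show ?thesis by (simp only: mult_zero_right) simp
  qed
  have mt: "expectation (\<lambda>\<omega>. Y \<omega> * type_martingale (k + 1) \<omega>) = 0"
    if Y: "Y \<in> borel_measurable (F k)" "\<And>\<omega>. \<omega> \<in> space M \<Longrightarrow> \<bar>Y \<omega>\<bar> \<le> C" for Y k C
  proof -
    have int: "integrable M (\<lambda>\<omega>. Y \<omega> * \<sigma> j \<omega>)" for j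
    proof (rule bounded_integrable[where C=C])
      show "(\<lambda>\<omega>. Y \<omega> * \<sigma> j \<omega>) \<in> borel_measurable M" using adapted_M[OF Y(1)] by measurable
    qed (use Y(2) in \<open>simp add: abs_mult\<close>)
    have "expectation (\<lambda>\<omega>. Y \<omega> * \<sigma> (k + 1) \<omega>) =
        expectation (\<lambda>\<omega>. Y \<omega> * (1 / 2 * \<sigma> k \<omega> + \<mu> / 2 * \<sigma> k \<omega> + (1 - \<mu>) / 2 * - \<sigma> k \<omega>))"
      by (rule chain_step_real[OF Y, of "\<lambda>x y. y"])
    also have "\<dots> = expectation (\<lambda>\<omega>. \<mu> * (Y \<omega> * \<sigma> k \<omega>))"
      by (intro arg_cong[where f=expectation] ext) (simp add: field_simps)
    also have "\<dots> = \<mu> * expectation (\<lambda>\<omega>. Y \<omega> * \<sigma> k \<omega>)" by simp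
    finally have "expectation (\<lambda>\<omega>. Y \<omega> * \<sigma> (k + 1) \<omega> - \<mu> * (Y \<omega> * \<sigma> k \<omega>)) = 0"
      using int by simp
    then show ?thesis by (simp add: type_martingale_def algebra_simps)
  qed
  have tm: "type_martingale k \<in> borel_measurable (F k)" for k
  proof -
    note [measurable] = \<sigma>_adapted[of k] adapted_mono[OF \<sigma>_adapted[of "k - 1"], of k]
    show ?thesis unfolding type_martingale_def by measurable
  qed
  have tb: "\<bar>type_martingale k \<omega>\<bar> \<le> 2" for k \<omega>
    using \<sigma>_cases[of k \<omega>] \<sigma>_cases[of "k - 1" \<omega>] \<mu> unfolding type_martingale_def by auto
  note [measurable] = adapted_M[OF tm]
  have "prob {\<omega> \<in> space M. \<exists>k\<le>m. x \<le> \<bar>\<Sum>l\<in>{i+1..i + int k}. b l \<omega>\<bar> \<or> x \<le> \<bar>\<Sum>l\<in>{i+1..i + int k}. \<sigma> l \<omega>\<bar>}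
      \<le> K * (real m)\<^sup>2 / x ^ 4" if m: "4 \<le> m" and x: "4 / (1 - \<mu>) \<le> x" for i m x
  proof -
    have x4: "x > 0" "4 \<le> (1 - \<mu>) * x" using x \<mu> by (auto simp: field_simps intro: less_le_trans[of 0 "4 / (1 - \<mu>)"])
    define y where "y = (1 - \<mu>) * x / 2"
    have y: "y > 0" using x4 by (simp add: y_def)
    let ?A = "{\<omega> \<in> space M. \<exists>k\<le>m. x \<le> \<bar>\<Sum>l\<in>{i+1..i + int k}. b l \<omega>\<bar>}"
    let ?B = "{\<omega> \<in> space M. \<exists>k\<le>m. y \<le> \<bar>\<Sum>l\<in>{i+1..i + int k}. type_martingale l \<omega>\<bar>}"
    have ev: "?A \<in> events" "?B \<in> events" by measurable
    have imp: "y \<le> \<bar>\<Sum>l\<in>{i+1..i + int k}. type_martingale l \<omega>\<bar>" if "x \<le> \<bar>\<Sum>l\<in>{i+1..i + int k}. \<sigma> l \<omega>\<bar>" for k \<omega>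
    proof -
      let ?s = "\<Sum>l\<in>{i+1..i + int k}. \<sigma> l \<omega>"
      have "\<bar>\<sigma> (i + int k) \<omega> - \<sigma> i \<omega>\<bar> \<le> 2" using \<sigma>_cases[of "i + int k" \<omega>] \<sigma>_cases[of i \<omega>] by auto
      then have "\<bar>\<mu> * (\<sigma> (i + int k) \<omega> - \<sigma> i \<omega>)\<bar> \<le> 1 * 2" unfolding abs_mult using \<mu> by (intro mult_mono) auto
      moreover have "(1 - \<mu>) * x \<le> \<bar>(1 - \<mu>) * ?s\<bar>" unfolding abs_mult using \<mu> that by (simp add: mult_left_mono)
      ultimately show ?thesis using x4 unfolding type_martingale_sum y_def by linarith
    qed
    have "prob {\<omega> \<in> space M. \<exists>k\<le>m. x \<le> \<bar>\<Sum>l\<in>{i+1..i + int k}. b l \<omega>\<bar> \<or> x \<le> \<bar>\<Sum>l\<in>{i+1..i + int k}. \<sigma> l \<omega>\<bar>}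
        \<le> prob (?A \<union> ?B)" using ev imp by (intro finite_measure_mono) auto
    also have "\<dots> \<le> prob ?A + prob ?B" using ev by (rule measure_Un_le)
    also have "\<dots> \<le> 512 * exp (1\<^sup>2) * (real m)\<^sup>2 / x ^ 4 + 512 * exp (2\<^sup>2) * (real m)\<^sup>2 / y ^ 4"
      using m x4(1) y by (intro add_mono martingale_maximal b_adapted tm tb mb mt) auto
    also have "\<dots> = K * (real m)\<^sup>2 / x ^ 4"
    proof -
      have "y ^ 4 = d ^ 4 * x ^ 4" by (simp add: y_def d_def power_mult_distrib[symmetric])
      then show ?thesis using x4(1) d by (simp add: K_def field_simps)
    qed
    finally show ?thesis .
  qed
  moreover have "K \<ge> 0" using d by (simp add: K_def)
  moreover have "4 / (1 - \<mu>) > 0" using \<mu> by simp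
  ultimately show ?thesis by blast
qed

end

section \<open>The random word\<close>

lemma UNIV_symbol: "(UNIV :: symbol set) = {Ham, Chs, HamOrd, ChsOrd, Dup, Opp, Flex, Stale}"
proof (rule UNIV_eq_I)
  show "s \<in> {Ham, Chs, HamOrd, ChsOrd, Dup, Opp, Flex, Stale}" for s by (cases s) simp_all
qed

lemma finite_symbol: "finite (UNIV :: symbol set)"
  by (simp add: UNIV_symbol)

lemma sum_symbol: "(\<Sum>s\<in>UNIV. f s) =
    f Ham + (f Chs + (f HamOrd + (f ChsOrd + (f Dup + (f Opp + (f Flex + f Stale))))))"
  for f :: "symbol \<Rightarrow> 'b::comm_monoid_add"
proof -
  have U: "UNIV = set [Ham, Chs, HamOrd, ChsOrd, Dup, Opp, Flex, Stale]" by (simp only: UNIV_symbol list.set)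
  have "(\<Sum>s\<in>UNIV. f s) = sum_list (map f [Ham, Chs, HamOrd, ChsOrd, Dup, Opp, Flex, Stale])"
    unfolding U by (rule sum.distinct_set_conv_list) simp
  then show ?thesis by (simp only: list.map sum_list.Cons sum_list.Nil add_0_right)
qed

text \<open>Letters are substituted one at a time from a finite alphabet, so every g is
  allowed.\<close>

lemma measurable_word_function:
  fixes X :: "int \<Rightarrow> 'a \<Rightarrow> symbol"
  assumes "\<And>i. i \<in> set xs \<Longrightarrow> X i \<in> measurable A (count_space UNIV)" and "\<And>w. g w \<in> space N"
  shows "(\<lambda>\<omega>. g (map (\<lambda>i. X i \<omega>) xs)) \<in> measurable A N"
  using assms
proof (induction xs arbitrary: g)
  case (Cons i xs)
  have "(\<lambda>\<omega>. g (s # map (\<lambda>i. X i \<omega>) xs)) \<in> measurable A N" for s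
    by (rule Cons.IH) (use Cons.prems in auto)
  moreover have "X i \<in> measurable A (count_space UNIV)" using Cons.prems(1) by simp
  ultimately have "(\<lambda>\<omega>. g (X i \<omega> # map (\<lambda>i. X i \<omega>) xs)) \<in> measurable A N"
    using countable_finite[OF finite_symbol] by (rule measurable_compose_countable')
  then show ?case by simp
qed simp

locale stale_word = prob_space M for M :: "'a measure" +
  fixes X :: "int \<Rightarrow> 'a \<Rightarrow> symbol" and pd pe :: real
  assumes param: "(0, 1, pd, pe) \<in> param_set" and iid: "iid_word M (0, 1, pd, pe) X"
begin

lemma indep: "indep_vars (\<lambda>_. count_space UNIV) X UNIV"
  and prob_symbol: "prob {\<omega> \<in> space M. X i \<omega> = s} = symbol_prob (0, 1, pd, pe) s"
  using iid by (auto simp: iid_word_def)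

lemma X_measurable [measurable]: "X i \<in> measurable M (count_space UNIV)"
  using indep by (auto simp: indep_vars_def)

lemma pred_X [measurable]: "Measurable.pred M (\<lambda>\<omega>. X i \<omega> \<in> A)"
  by (rule measurable_compose[OF X_measurable]) auto

lemma p_nonneg: "0 \<le> pd" "0 \<le> pe" "pd + pe < 1"
  using param by (auto simp: param_set_def)

text \<open>Generated by the restricted family as a single map, the form in which independence of
  disjoint blocks of symbols is available.\<close>

definition past :: "int \<Rightarrow> 'a measure" where
  "past k = vimage_algebra (space M) (\<lambda>\<omega>. restrict (\<lambda>i. X i \<omega>) {..k}) (PiM {..k} (\<lambda>_. count_space UNIV))"

lemma restrict_space: "(\<lambda>\<omega>. restrict (\<lambda>i. X i \<omega>) A) \<in> space M \<rightarrow> space (PiM A (\<lambda>_. count_space UNIV))"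
  by (auto simp: space_PiM)

lemma X_past: "i \<le> k \<Longrightarrow> X i \<in> measurable (past k) (count_space UNIV)"
proof -
  assume i: "i \<le> k"
  have "(\<lambda>\<omega>. restrict (\<lambda>i. X i \<omega>) {..k} i) \<in> measurable (past k) (count_space UNIV)"
    unfolding past_def using i
    by (intro measurable_compose[OF measurable_vimage_algebra1[OF restrict_space] measurable_component_singleton]) auto
  then show ?thesis using i by simp
qed

lemma past_subalgebra: "subalgebra M (past k)"
  unfolding subalgebra_def past_def
  by (intro conjI sets_image_in_sets measurable_restrict) auto

lemma past_mono: "subalgebra (past (k + 1)) (past k)"
  unfolding subalgebra_def
proof
  show "space (past k) = space (past (k + 1))" by (simp add: past_def)
  show "sets (past k) \<subseteq> sets (past (k + 1))"
    unfolding past_def[of k]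
    by (intro sets_image_in_sets measurable_restrict X_past) (auto simp: past_def)
qed

definition type_of :: "int \<Rightarrow> 'a \<Rightarrow> real" where "type_of k \<omega> = top_type (\<lambda>i. X i \<omega>) k"

definition kind_of :: "int \<Rightarrow> 'a \<Rightarrow> real" where "kind_of k \<omega> = symbol_type (X k \<omega>)"

lemma kind_adapted: "kind_of k \<in> borel_measurable (past k)"
  unfolding kind_of_def by (intro measurable_compose[OF X_past]) auto

text \<open>Each window ending at k involves finitely many symbols up to k, and \<open>lim\<close>
  of measurable functions is measurable including where no limit exists.\<close>

lemma type_adapted: "type_of k \<in> borel_measurable (past k)"
proof -
  have "(\<lambda>\<omega>. lim (\<lambda>m. fold top_step (map (\<lambda>i. X i \<omega>) [- int m..k]) 0)) \<in> borel_measurable (past k)"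
    by (intro borel_measurable_lim_metric measurable_word_function[where g="\<lambda>w. fold top_step w 0"] X_past) auto
  then show ?thesis unfolding type_of_def top_type_def by measurable
qed

text \<open>Symbols outside \<open>stale_symbols\<close> are excluded by countably many null events.
  For the other half, n consecutive symbols avoid h and c with probability p^n, which tends to
  0.\<close>

lemma AE_good_word: "AE \<omega> in M. good_word (\<lambda>i. X i \<omega>)"
proof -
  have 1: "AE \<omega> in M. X i \<omega> \<in> stale_symbols" for i
  proof -
    have zero: "AE \<omega> in M. X i \<omega> \<noteq> s" if "s \<notin> stale_symbols" for s
    proof -
      have "symbol_prob (0, 1, pd, pe) s = 0" using that by (cases s) (auto simp: stale_symbols_def)
      then have "prob {\<omega> \<in> space M. X i \<omega> = s} = 0" by (simp only: prob_symbol)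
      then show ?thesis by (subst AE_iff_measurable[OF _ refl]) (auto simp: emeasure_eq_measure)
    qed
    have "AE \<omega> in M. \<forall>s\<in>- stale_symbols. X i \<omega> \<noteq> s"
      using zero finite_symbol by (intro AE_finite_allI) (auto intro: finite_subset)
    then show ?thesis by eventually_elim auto
  qed
  have 2: "AE \<omega> in M. \<exists>j\<le>k. X j \<omega> \<in> {Ham, Chs}" for k
  proof -
    \<comment> \<open>The probability that a symbol is neither h nor c, below 1 because p_d + p_e <
      1.\<close>
    define p where "p = 1 - (1 - pd - pe) / 2"
    have p: "0 \<le> p" "p < 1" using p_nonneg by (auto simp: p_def)
    have one: "prob (X j -` (- {Ham, Chs}) \<inter> space M) = p" for j
    proof -
      have "X j -` (- {Ham, Chs}) \<inter> space M = space M - ({\<omega> \<in> space M. X j \<omega> = Ham} \<union> {\<omega> \<in> space M. X j \<omega> = Chs})"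
        by auto
      also have "prob \<dots> = 1 - prob ({\<omega> \<in> space M. X j \<omega> = Ham} \<union> {\<omega> \<in> space M. X j \<omega> = Chs})"
        by (rule prob_compl) measurable
      also have "prob ({\<omega> \<in> space M. X j \<omega> = Ham} \<union> {\<omega> \<in> space M. X j \<omega> = Chs}) =
          prob {\<omega> \<in> space M. X j \<omega> = Ham} + prob {\<omega> \<in> space M. X j \<omega> = Chs}"
        by (rule finite_measure_Union) auto
      finally show ?thesis by (simp add: prob_symbol p_def)
    qed
    let ?N = "{\<omega> \<in> space M. \<not> (\<exists>j\<le>k. X j \<omega> \<in> {Ham, Chs})}"
    have N: "?N \<in> events" by measurable
    have "prob ?N \<le> p ^ n" for n
    proof (cases "n = 0")
      case False
      have "prob ?N \<le> prob (\<Inter>j\<in>{k - int n + 1..k}. X j -` (- {Ham, Chs}) \<inter> space M)"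
        using False by (intro finite_measure_mono) auto
      also have "\<dots> = (\<Prod>j\<in>{k - int n + 1..k}. prob (X j -` (- {Ham, Chs}) \<inter> space M))"
        using False by (intro indep_varsD[OF indep]) auto
      also have "\<dots> = p ^ n" unfolding one by simp
      finally show ?thesis .
    qed simp
    moreover have "(\<lambda>n. p ^ n) \<longlonglongrightarrow> 0" using p by (intro LIMSEQ_realpow_zero) auto
    ultimately have "prob ?N \<le> 0" by (intro LIMSEQ_le_const) auto
    then have "prob ?N = 0" using measure_nonneg[of M ?N] by linarith
    then show ?thesis using N by (subst AE_iff_measurable[OF N]) (auto simp: emeasure_eq_measure)
  qed
  have "AE \<omega> in M. \<forall>i. X i \<omega> \<in> stale_symbols" "AE \<omega> in M. \<forall>k. \<exists>j\<le>k. X j \<omega> \<in> {Ham, Chs}"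
    unfolding AE_all_countable using 1 2 by auto
  then show ?thesis by eventually_elim (simp add: good_word_def)
qed

lemma indep_past:
  assumes Y: "Y \<in> measurable (past k) N" and g: "\<And>s. g s \<in> space N"
  shows "indep_var N Y N (\<lambda>\<omega>. g (X (k + 1) \<omega>))"
proof -
  let ?R = "\<lambda>A \<omega>. restrict (\<lambda>i. X i \<omega>) A" and ?P = "\<lambda>A. PiM A (\<lambda>_. count_space (UNIV :: symbol set))"
  have "indep_var (?P {..k}) (?R {..k}) (?P {k + 1}) (?R {k + 1})"
    using indep by (rule indep_var_restrict) auto
  then have ind: "indep_set (sigma_sets (space M) {?R {..k} -` A \<inter> space M |A. A \<in> sets (?P {..k})})
      (sigma_sets (space M) {?R {k + 1} -` A \<inter> space M |A. A \<in> sets (?P {k + 1})})"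
    unfolding indep_var_eq by blast
  have 1: "sigma_sets (space M) {Y -` A \<inter> space M |A. A \<in> sets N} \<subseteq>
      sigma_sets (space M) {?R {..k} -` A \<inter> space M |A. A \<in> sets (?P {..k})}"
  proof (rule sigma_sets_mono, safe)
    fix A assume "A \<in> sets N"
    then have "Y -` A \<inter> space (past k) \<in> sets (past k)" by (rule measurable_sets[OF Y])
    then show "Y -` A \<inter> space M \<in> sigma_sets (space M) {?R {..k} -` A \<inter> space M |A. A \<in> sets (?P {..k})}"
      unfolding past_def sets_vimage_algebra space_vimage_algebra .
  qed
  have 2: "sigma_sets (space M) {(\<lambda>\<omega>. g (X (k + 1) \<omega>)) -` A \<inter> space M |A. A \<in> sets N} \<subseteq>
      sigma_sets (space M) {?R {k + 1} -` A \<inter> space M |A. A \<in> sets (?P {k + 1})}"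
  proof (rule sigma_sets_mono, safe)
    fix A :: "'b set"
    let ?B = "(\<lambda>f. f (k + 1)) -` (g -` A) \<inter> space (?P {k + 1})"
    have "?B \<in> sets (?P {k + 1})"
      by (rule measurable_sets[OF measurable_component_singleton]) auto
    moreover have "(\<lambda>\<omega>. g (X (k + 1) \<omega>)) -` A \<inter> space M = ?R {k + 1} -` ?B \<inter> space M" by (auto simp: space_PiM)
    ultimately show "(\<lambda>\<omega>. g (X (k + 1) \<omega>)) -` A \<inter> space M \<in>
        sigma_sets (space M) {?R {k + 1} -` A \<inter> space M |A. A \<in> sets (?P {k + 1})}"
      by (intro sigma_sets.Basic) blast
  qed
  have "Y \<in> measurable M N" by (rule measurable_from_subalg[OF past_subalgebra Y])
  moreover have "(\<lambda>\<omega>. g (X (k + 1) \<omega>)) \<in> measurable M N"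
    by (rule measurable_compose[OF X_measurable]) (use g in auto)
  moreover have "indep_set (sigma_sets (space M) {Y -` A \<inter> space M |A. A \<in> sets N})
      (sigma_sets (space M) {(\<lambda>\<omega>. g (X (k + 1) \<omega>)) -` A \<inter> space M |A. A \<in> sets N})"
    using ind unfolding indep_set_def by (rule indep_sets_mono_sets) (use 1 2 in \<open>auto split: bool.split\<close>)
  ultimately show ?thesis unfolding indep_var_eq by simp
qed

section \<open>The Markov property of the sign\<close>

text \<open>Freezing: after splitting by the next symbol, each \<open>Y s\<close> belongs to the
  past and is independent of the event that s comes next.\<close>

lemma expectation_next_symbol:
  fixes Y :: "symbol \<Rightarrow> 'a \<Rightarrow> complex"
  assumes Y: "\<And>s. Y s \<in> borel_measurable (past k)" and C: "\<And>s \<omega>. \<omega> \<in> space M \<Longrightarrow> cmod (Y s \<omega>) \<le> C"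
  shows "expectation (\<lambda>\<omega>. Y (X (k + 1) \<omega>) \<omega>) =
    expectation (\<lambda>\<omega>. \<Sum>s\<in>UNIV. of_real (symbol_prob (0, 1, pd, pe) s) * Y s \<omega>)"
proof -
  define I where "I s \<omega> = (indicator {s} (X (k + 1) \<omega>) :: complex)" for s \<omega>
  have YM: "Y s \<in> borel_measurable M" for s by (rule measurable_from_subalg[OF past_subalgebra Y])
  have intY: "integrable M (Y s)" for s by (rule integrable_const_bound[where B=C]) (use C YM in auto)
  have intI: "integrable M (I s)" for s
    unfolding I_def by (rule integrable_const_bound[where B=1]) (auto simp: indicator_def)
  have ind: "indep_var borel (Y s) borel (I s)" for s
    unfolding I_def by (rule indep_past[OF Y]) simp
  have EI: "expectation (I s) = of_real (symbol_prob (0, 1, pd, pe) s)" for s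
  proof -
    have "expectation (I s) = expectation (\<lambda>\<omega>. of_real (indicator {\<omega> \<in> space M. X (k + 1) \<omega> = s} \<omega>))"
      by (intro Bochner_Integration.integral_cong) (auto simp: I_def indicator_def)
    also have "\<dots> = of_real (prob {\<omega> \<in> space M. X (k + 1) \<omega> = s})"
      unfolding integral_complex_of_real by simp
    finally show ?thesis by (simp only: prob_symbol)
  qed
  have "Y (X (k + 1) \<omega>) \<omega> = (\<Sum>s\<in>UNIV. Y s \<omega> * I s \<omega>)" for \<omega>
    using finite_symbol by (simp add: I_def indicator_def if_distrib sum.delta cong: if_cong)
  then have "expectation (\<lambda>\<omega>. Y (X (k + 1) \<omega>) \<omega>) = expectation (\<lambda>\<omega>. \<Sum>s\<in>UNIV. Y s \<omega> * I s \<omega>)" by simp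
  also have "\<dots> = (\<Sum>s\<in>UNIV. expectation (\<lambda>\<omega>. Y s \<omega> * I s \<omega>))"
    by (intro Bochner_Integration.integral_sum indep_var_integrable[OF ind intY intI])
  also have "\<dots> = (\<Sum>s\<in>UNIV. expectation (\<lambda>\<omega>. of_real (symbol_prob (0, 1, pd, pe) s) * Y s \<omega>))"
  proof (rule sum.cong[OF refl])
    show "expectation (\<lambda>\<omega>. Y s \<omega> * I s \<omega>) = expectation (\<lambda>\<omega>. of_real (symbol_prob (0, 1, pd, pe) s) * Y s \<omega>)" for s
      unfolding indep_var_lebesgue_integral[OF ind intY intI] EI by simp
  qed
  also have "\<dots> = expectation (\<lambda>\<omega>. \<Sum>s\<in>UNIV. of_real (symbol_prob (0, 1, pd, pe) s) * Y s \<omega>)"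
    using intY by (intro Bochner_Integration.integral_sum[symmetric]) auto
  finally show ?thesis .
qed

text \<open>The conditional probability, given a burger symbol, that the top type survives: d keeps
  it, e flips it, and a fresh h or c agrees with it half of the time. Thus z is
  \<open>retention / (1 - retention)\<close>.\<close>

definition retention :: real where "retention = (1 + pd - pe) / 2"

text \<open>The top type satisfies its recursion almost surely, so the next symbol acts through
  \<open>symbol_type\<close> and \<open>top_step\<close>, and its probabilities group into the three
  weights. Measurability and boundedness of the terms with g come from its four values at
  signs.\<close>

lemma retention_step:
  fixes Y :: "'a \<Rightarrow> complex" and g :: "real \<Rightarrow> real \<Rightarrow> complex"
  assumes Y: "Y \<in> borel_measurable (past k)" and C: "\<And>\<omega>. \<omega> \<in> space M \<Longrightarrow> cmod (Y \<omega>) \<le> C"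
  shows "expectation (\<lambda>\<omega>. Y \<omega> * g (kind_of (k + 1) \<omega>) (type_of (k + 1) \<omega>)) =
    expectation (\<lambda>\<omega>. Y \<omega> * (1 / 2 * g (- 1) (type_of k \<omega>) + retention / 2 * g 1 (type_of k \<omega>)
      + (1 - retention) / 2 * g 1 (- type_of k \<omega>)))"
proof -
  define W where "W s \<omega> = Y \<omega> * g (symbol_type s) (top_step s (type_of k \<omega>))" for s \<omega>
  have type: "type_of k \<omega> = 1 \<or> type_of k \<omega> = - 1" for \<omega> unfolding type_of_def by (rule top_type_cases)
  define B where "B = (\<Sum>x\<in>{-1,1}. \<Sum>y\<in>{-1,1}. cmod (g x y))"
  have gB: "cmod (g (symbol_type s) (top_step s (type_of k \<omega>))) \<le> B" for s \<omega>
    using type[of \<omega>] by (cases s) (auto simp: B_def symbol_type_def top_step_def)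
  have B0: "B \<ge> 0" unfolding B_def by (intro sum_nonneg) auto
  have Wm: "W s \<in> borel_measurable (past k)" for s
  proof -
    note [measurable] = type_adapted[of k] Y
    have "(\<lambda>\<omega>. if type_of k \<omega> = 1 then g (symbol_type s) (top_step s 1) else g (symbol_type s) (top_step s (- 1)))
        \<in> borel_measurable (past k)" by measurable
    also have "(\<lambda>\<omega>. if type_of k \<omega> = 1 then g (symbol_type s) (top_step s 1) else g (symbol_type s) (top_step s (- 1))) =
        (\<lambda>\<omega>. g (symbol_type s) (top_step s (type_of k \<omega>)))"
    proof
      show "(if type_of k \<omega> = 1 then g (symbol_type s) (top_step s 1) else g (symbol_type s) (top_step s (- 1))) =
          g (symbol_type s) (top_step s (type_of k \<omega>))" for \<omega> using type[of \<omega>] by auto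
    qed
    finally show ?thesis unfolding W_def by (intro borel_measurable_times Y)
  qed
  have WC: "cmod (W s \<omega>) \<le> C * B" if "\<omega> \<in> space M" for s \<omega>
    unfolding W_def norm_mult using C[OF that] gB B0 by (intro mult_mono) (auto intro: order_trans[OF norm_ge_zero])
  have "expectation (\<lambda>\<omega>. Y \<omega> * g (kind_of (k + 1) \<omega>) (type_of (k + 1) \<omega>)) = expectation (\<lambda>\<omega>. W (X (k + 1) \<omega>) \<omega>)"
  proof (rule integral_cong_AE)
    show "AE \<omega> in M. Y \<omega> * g (kind_of (k + 1) \<omega>) (type_of (k + 1) \<omega>) = W (X (k + 1) \<omega>) \<omega>"
      using AE_good_word by eventually_elim (simp add: W_def kind_of_def type_of_def good_word_top_type_step)
    have "W s \<in> borel_measurable M" for s by (rule measurable_from_subalg[OF past_subalgebra Wm])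
    then show "(\<lambda>\<omega>. W (X (k + 1) \<omega>) \<omega>) \<in> borel_measurable M"
      by (rule measurable_compose_countable'[where f=W and g="X (k + 1)", OF _ X_measurable countable_finite[OF finite_symbol]])
    note [measurable] = measurable_from_subalg[OF past_subalgebra type_adapted[of "k + 1"]]
      measurable_from_subalg[OF past_subalgebra kind_adapted[of "k + 1"]]
    have cases: "kind_of (k + 1) \<omega> = 1 \<or> kind_of (k + 1) \<omega> = - 1" "type_of (k + 1) \<omega> = 1 \<or> type_of (k + 1) \<omega> = - 1" for \<omega>
      unfolding kind_of_def symbol_type_def type_of_def by (simp, rule top_type_cases)
    let ?G = "\<lambda>\<omega>. if kind_of (k + 1) \<omega> = 1 then (if type_of (k + 1) \<omega> = 1 then g 1 1 else g 1 (- 1))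
          else (if type_of (k + 1) \<omega> = 1 then g (- 1) 1 else g (- 1) (- 1))"
    have "?G \<in> borel_measurable M" by measurable
    also have "?G = (\<lambda>\<omega>. g (kind_of (k + 1) \<omega>) (type_of (k + 1) \<omega>))"
    proof
      show "?G \<omega> = g (kind_of (k + 1) \<omega>) (type_of (k + 1) \<omega>)" for \<omega> using cases[of \<omega>] by auto
    qed
    finally show "(\<lambda>\<omega>. Y \<omega> * g (kind_of (k + 1) \<omega>) (type_of (k + 1) \<omega>)) \<in> borel_measurable M"
      by (intro borel_measurable_times measurable_from_subalg[OF past_subalgebra Y])
  qed
  also have "\<dots> = expectation (\<lambda>\<omega>. \<Sum>s\<in>UNIV. of_real (symbol_prob (0, 1, pd, pe) s) * W s \<omega>)"
    by (rule expectation_next_symbol[OF Wm WC])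
  also have "\<dots> = expectation (\<lambda>\<omega>. Y \<omega> * (1 / 2 * g (- 1) (type_of k \<omega>) + retention / 2 * g 1 (type_of k \<omega>)
      + (1 - retention) / 2 * g 1 (- type_of k \<omega>)))"
  proof (intro arg_cong[where f=expectation] ext)
    fix \<omega>
    show "(\<Sum>s\<in>UNIV. of_real (symbol_prob (0, 1, pd, pe) s) * W s \<omega>) =
      Y \<omega> * (1 / 2 * g (- 1) (type_of k \<omega>) + retention / 2 * g 1 (type_of k \<omega>)
      + (1 - retention) / 2 * g 1 (- type_of k \<omega>))"
      using type[of \<omega>]
      by (auto simp: sum_symbol W_def symbol_type_def top_step_def retention_def field_simps)
  qed
  finally show ?thesis .
qed

sublocale chain: sign_chain M past kind_of type_of retention
proof
  show "kind_of k \<omega> = 1 \<or> kind_of k \<omega> = - 1" for k \<omega> by (auto simp: kind_of_def symbol_type_def)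
  show "type_of k \<omega> = 1 \<or> type_of k \<omega> = - 1" for k \<omega> by (simp add: type_of_def top_type_cases)
  show "0 \<le> retention" "retention < 1" using p_nonneg by (auto simp: retention_def)
qed (rule past_subalgebra past_mono kind_adapted type_adapted retention_step; assumption)+

end

section \<open>Interpolated walks\<close>

lemma interpolate_eq:
  assumes "of_int k \<le> x" "x \<le> of_int k + 1"
  shows "interpolate f x = (1 - (x - of_int k)) * of_int (f k) + (x - of_int k) * of_int (f (k + 1))"
proof (cases "x = of_int k + 1")
  case True
  then have "\<lfloor>x\<rfloor> = k + 1" "frac x = 0" by (simp_all add: frac_eq_0_iff floor_eq_iff)
  with True show ?thesis by (simp add: interpolate_def)
next
  case False
  then have "\<lfloor>x\<rfloor> = k" using assms by (simp add: floor_eq_iff)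
  then show ?thesis by (simp add: interpolate_def frac_def)
qed

lemma interpolate_of_int [simp]: "interpolate f (of_int k) = of_int (f k)"
  by (simp add: interpolate_def)

text \<open>Around any point two adjacent closed cells form a neighbourhood, and on each of them the
  interpolation is affine up to and including both ends.\<close>

lemma continuous_interpolate: "continuous_on UNIV (interpolate f)"
proof -
  have piece: "continuous_on {of_int k..of_int k + 1} (interpolate f)" for k :: int
  proof (rule continuous_on_eq)
    show "continuous_on {of_int k..of_int k + 1} (\<lambda>x :: real. (1 - (x - of_int k)) * of_int (f k) + (x - of_int k) * of_int (f (k + 1)))"
      by (intro continuous_intros)
  qed (simp add: interpolate_eq[symmetric])
  have "isCont (interpolate f) x" for x
  proof -
    define k where "k = \<lfloor>x\<rfloor>"
    have "continuous_on ({of_int (k - 1)..of_int (k - 1) + 1} \<union> {of_int k..of_int k + 1}) (interpolate f)"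
      by (intro continuous_on_closed_Un piece) auto
    moreover have "{of_int (k - 1)..of_int (k - 1) + 1} \<union> {of_int k..of_int k + 1} = {of_int k - 1..of_int k + 1 :: real}"
      by auto
    ultimately have "continuous_on {of_int k - 1..of_int k + 1} (interpolate f)" by simp
    then have "continuous_on {of_int k - 1<..<of_int k + 1} (interpolate f)"
      by (rule continuous_on_subset) auto
    moreover have "x \<in> {of_int k - 1<..<of_int k + 1}" unfolding k_def greaterThanLessThan_iff by linarith
    ultimately show ?thesis by (meson continuous_on_eq_continuous_at open_greaterThanLessThan)
  qed
  then show ?thesis by (simp add: continuous_at_imp_continuous_on)
qed

lemma continuous_scaled_walk: "continuous_on UNIV (scaled_walk n x)"
proof -
  have "continuous_on UNIV (\<lambda>t. interpolate f (real n * t))" for f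
    by (rule continuous_on_compose2[OF continuous_interpolate]) (auto intro: continuous_intros)
  then show ?thesis unfolding scaled_walk_def by (intro continuous_intros)
qed

lemma convex_combination_close:
  fixes p q w \<eta> a :: real
  assumes "\<bar>p - w\<bar> \<le> \<eta>" "\<bar>q - w\<bar> \<le> \<eta>" "0 \<le> a" "a \<le> 1"
  shows "\<bar>(1 - a) * p + a * q - w\<bar> \<le> \<eta>"
proof -
  have "(1 - a) * p + a * q - w = (1 - a) * (p - w) + a * (q - w)" by (simp add: algebra_simps)
  also have "\<bar>\<dots>\<bar> \<le> (1 - a) * \<bar>p - w\<bar> + a * \<bar>q - w\<bar>"
    using assms(3,4) by (intro order_trans[OF abs_triangle_ineq]) (simp add: abs_mult)
  also have "\<dots> \<le> (1 - a) * \<eta> + a * \<eta>" using assms by (intro add_mono mult_left_mono) auto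
  finally show ?thesis by (simp add: algebra_simps)
qed

lemma interpolate_floor_close:
  assumes "\<And>i. \<bar>of_int (f (i + 1)) - of_int (f i)\<bar> \<le> (1 :: real)"
  shows "\<bar>interpolate f x - of_int (f \<lfloor>x\<rfloor>)\<bar> \<le> 1"
  unfolding interpolate_def
  by (rule convex_combination_close) (use assms[of "\<lfloor>x\<rfloor>"] frac_ge_0[of x] frac_lt_1[of x] in auto)

text \<open>The value at each point is within \<eta> of that at the left end of its cell. Points at
  distance at most L lie in equal or adjacent cells, whose left ends differ by at most \<eta> in
  value, as k = L is allowed.\<close>

lemma interpolate_modulus:
  fixes f :: "int \<Rightarrow> int" and L A :: int and \<eta> :: real
  assumes L: "L > 0" and A: "A > 0"
    and cell: "\<And>a k. - A \<le> a \<Longrightarrow> a < A \<Longrightarrow> 0 \<le> k \<Longrightarrow> k \<le> L \<Longrightarrow> \<bar>of_int (f (a * L + k)) - of_int (f (a * L))\<bar> \<le> \<eta>"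
    and x: "\<bar>x\<bar> \<le> of_int (A * L)" and y: "\<bar>y\<bar> \<le> of_int (A * L)" and xy: "\<bar>x - y\<bar> \<le> of_int L"
  shows "\<bar>interpolate f x - interpolate f y\<bar> \<le> 3 * \<eta>"
proof -
  \<comment> \<open>The right end of the range is put into the last cell, since the floor would give
    a cell beyond the range.\<close>
  define c where "c z = (if z = of_int (A * L) then A - 1 else \<lfloor>z / of_int L\<rfloor>)" for z :: real
  have c: "- A \<le> c z" "c z < A" "of_int (c z * L) \<le> z" "z \<le> of_int (c z * L + L)"
    "z \<noteq> of_int (A * L) \<Longrightarrow> z < of_int (c z * L + L)" if z: "\<bar>z\<bar> \<le> of_int (A * L)" for z
  proof -
    have "- A \<le> c z \<and> c z < A \<and> of_int (c z * L) \<le> z \<and> z \<le> of_int (c z * L + L) \<and> (z \<noteq> of_int (A * L) \<longrightarrow> z < of_int (c z * L + L))"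
    proof (cases "z = of_int (A * L)")
      case True
      then show ?thesis using A L by (simp add: c_def algebra_simps)
    next
      case False
      then have zl: "z < of_int A * of_int L" "- (of_int A * of_int L) \<le> z" using z by auto
      have cz: "c z = \<lfloor>z / of_int L\<rfloor>" using False by (simp add: c_def)
      have rL: "(of_int L :: real) > 0" using L by simp
      have "- of_int A \<le> z / of_int L" "z / of_int L < of_int A"
        using zl rL by (simp_all add: field_simps)
      then have "- A \<le> c z" "c z < A" unfolding cz by (simp_all add: le_floor_iff floor_less_iff)
      moreover have "of_int (c z) \<le> z / of_int L" "z / of_int L < of_int (c z) + 1" unfolding cz by linarith+
      then have "of_int (c z * L) \<le> z" "z < of_int (c z * L + L)" using rL by (simp_all add: field_simps)
      ultimately show ?thesis by simp
    qed
    then show "- A \<le> c z" "c z < A" "of_int (c z * L) \<le> z" "z \<le> of_int (c z * L + L)"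
      "z \<noteq> of_int (A * L) \<Longrightarrow> z < of_int (c z * L + L)" by auto
  qed
  have near: "\<bar>interpolate f z - of_int (f (c z * L))\<bar> \<le> \<eta>" if z: "\<bar>z\<bar> \<le> of_int (A * L)" for z
  proof -
    have k: "\<bar>of_int (f m) - of_int (f (c z * L))\<bar> \<le> \<eta>" if "c z * L \<le> m" "m \<le> c z * L + L" for m
      using cell[OF c(1,2)[OF z], of "m - c z * L"] that by simp
    show ?thesis
    proof (cases "z = of_int (c z * L + L)")
      case True
      then show ?thesis using k[of "c z * L + L"] L by (metis interpolate_of_int add_increasing2 less_imp_le order_refl)
    next
      case False
      then have "z < of_int (c z * L + L)" using c(4)[OF z] by simp
      then have "\<lfloor>z\<rfloor> < c z * L + L" by (simp only: floor_less_iff)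
      moreover have "c z * L \<le> \<lfloor>z\<rfloor>" using c(3)[OF z] by (simp only: le_floor_iff)
      ultimately show ?thesis unfolding interpolate_def
        using frac_ge_0[of z] frac_lt_1[of z] by (intro convex_combination_close k) auto
    qed
  qed
  have main: "\<bar>interpolate f x - interpolate f y\<bar> \<le> 3 * \<eta>"
    if x: "\<bar>x\<bar> \<le> of_int (A * L)" and y: "\<bar>y\<bar> \<le> of_int (A * L)" and xy: "x \<le> y" "y \<le> x + of_int L" for x y
  proof -
    have up: "c y \<le> c x + 1"
    proof (cases "x = of_int (A * L)")
      case True then show ?thesis using c(2)[OF y] by (simp add: c_def)
    next
      case False
      have "of_int (c y * L) < (of_int ((c x + 2) * L) :: real)"
        using c(3)[OF y] c(5)[OF x False] xy(2) by (simp add: algebra_simps)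
      then have "c y * L < (c x + 2) * L" by (simp only: of_int_less_iff)
      then show ?thesis using L by simp
    qed
    have lo: "c x \<le> c y"
    proof (cases "y = of_int (A * L)")
      case True then show ?thesis using c(2)[OF x] by (simp add: c_def)
    next
      case False
      have "of_int (c x * L) < (of_int ((c y + 1) * L) :: real)"
        using c(3)[OF x] c(5)[OF y False] xy(1) by (simp add: algebra_simps)
      then have "c x * L < (c y + 1) * L" by (simp only: of_int_less_iff)
      then show ?thesis using L by simp
    qed
    have "\<bar>of_int (f (c y * L)) - of_int (f (c x * L))\<bar> \<le> \<eta>"
    proof (cases "c y = c x")
      case True
      then show ?thesis using cell[OF c(1,2)[OF x], of 0] L by simp
    next
      case False
      then have "c y = c x + 1" using up lo by simp
      then show ?thesis using cell[OF c(1,2)[OF x], of L] L by (simp add: distrib_right)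
    qed
    with near[OF x] near[OF y] show ?thesis by linarith
  qed
  show ?thesis
  proof (cases "x \<le> y")
    case True then show ?thesis using main[OF x y] xy by simp
  next
    case False then show ?thesis using main[OF y x] xy by (simp add: abs_minus_commute)
  qed
qed

text \<open>The walk of the theorem adds up the steps of the identified word with a positive sign on both
  sides of the origin, so its increments change sign there.\<close>

lemma two_sided_sum_diff:
  fixes e :: "int \<Rightarrow> real"
  defines "W \<equiv> \<lambda>i. \<Sum>k\<in>{1..i} \<union> {i+1..0}. e k"
  shows "0 \<le> i \<Longrightarrow> i \<le> j \<Longrightarrow> W j - W i = (\<Sum>k\<in>{i+1..j}. e k)"
    and "i \<le> j \<Longrightarrow> j \<le> 0 \<Longrightarrow> W j - W i = - (\<Sum>k\<in>{i+1..j}. e k)"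
proof -
  assume ij: "0 \<le> i" "i \<le> j"
  then have "{1..j} \<union> {j+1..0} = ({1..i} \<union> {i+1..0}) \<union> {i+1..j}" by auto
  moreover have "({1..i} \<union> {i+1..0}) \<inter> {i+1..j} = {}" using ij by auto
  ultimately show "W j - W i = (\<Sum>k\<in>{i+1..j}. e k)" unfolding W_def by (simp add: sum.union_disjoint)
next
  assume ij: "i \<le> j" "j \<le> 0"
  then have "{1..i} \<union> {i+1..0} = ({1..j} \<union> {j+1..0}) \<union> {i+1..j}" by auto
  moreover have "({1..j} \<union> {j+1..0}) \<inter> {i+1..j} = {}" using ij by auto
  ultimately show "W j - W i = - (\<Sum>k\<in>{i+1..j}. e k)" unfolding W_def by (simp add: sum.union_disjoint)
qed

section \<open>Linear functionals as combinations of increments\<close>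

text \<open>For paths that start at 0 a combination of evaluations becomes one of successive
  increments over a grid, the form in which the Gaussian characteristic function factorises.\<close>

definition increment_form :: "(nat \<Rightarrow> real) \<Rightarrow> nat \<Rightarrow> ((real \<Rightarrow> real \<times> real) \<Rightarrow> real) \<Rightarrow> bool" where
  "increment_form t r L \<longleftrightarrow> (\<exists>u v. \<forall>f. f 0 = 0 \<longrightarrow>
    L f = (\<Sum>j<r. u j * fst (f (t (Suc j)) - f (t j)) + v j * snd (f (t (Suc j)) - f (t j))))"

text \<open>The path vanishes at the grid time \<open>t p = 0\<close>, so its value at
  \<open>t m\<close> is the telescoping sum from p to m, with reversed sign when m lies before
  p.\<close>

lemma increment_form_eval:
  assumes "m \<le> r" "p \<le> r" "t p = 0"
  shows "increment_form t r (\<lambda>f. a * fst (f (t m)) + b * snd (f (t m)))"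
proof -
  define s where "s j = (if p \<le> j \<and> j < m then 1 else if m \<le> j \<and> j < p then - 1 else 0 :: real)" for j
  have tele: "(\<Sum>j<r. s j * (g (Suc j) - g j)) = g m - g p" for g :: "nat \<Rightarrow> real"
  proof (cases "p \<le> m")
    case True
    have "(\<Sum>j<r. s j * (g (Suc j) - g j)) = (\<Sum>j\<in>{p..<m}. g (Suc j) - g j)"
      using assms(1) True by (intro sum.mono_neutral_cong_right) (auto simp: s_def)
    then show ?thesis using True by (simp add: sum_Suc_diff')
  next
    case False
    have "(\<Sum>j<r. s j * (g (Suc j) - g j)) = (\<Sum>j\<in>{m..<p}. - (g (Suc j) - g j))"
      using assms(2) False by (intro sum.mono_neutral_cong_right) (auto simp: s_def)
    also have "\<dots> = - (g p - g m)" unfolding sum_negf using False by (simp add: sum_Suc_diff')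
    finally show ?thesis by simp
  qed
  have eq: "a * fst (f (t m)) + b * snd (f (t m)) =
      (\<Sum>j<r. (a * s j) * fst (f (t (Suc j)) - f (t j)) + (b * s j) * snd (f (t (Suc j)) - f (t j)))"
    if "f 0 = 0" for f
    using tele[of "\<lambda>j. fst (f (t j))"] tele[of "\<lambda>j. snd (f (t j))"] that assms(3)
    by (simp add: sum.distrib mult.assoc sum_distrib_left[symmetric])
  show ?thesis unfolding increment_form_def
    by (intro exI[of _ "\<lambda>j. a * s j"] exI[of _ "\<lambda>j. b * s j"] allI impI) (rule eq)
qed

lemma increment_form_add:
  assumes "increment_form t r L" "increment_form t r L'"
  shows "increment_form t r (\<lambda>f. L f + L' f)"
proof -
  obtain u v where 1: "\<And>f. f 0 = 0 \<Longrightarrow> L f = (\<Sum>j<r. u j * fst (f (t (Suc j)) - f (t j)) + v j * snd (f (t (Suc j)) - f (t j)))"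
    using assms(1) unfolding increment_form_def by blast
  obtain u' v' where 2: "\<And>f. f 0 = 0 \<Longrightarrow> L' f = (\<Sum>j<r. u' j * fst (f (t (Suc j)) - f (t j)) + v' j * snd (f (t (Suc j)) - f (t j)))"
    using assms(2) unfolding increment_form_def by blast
  have eq: "L f + L' f = (\<Sum>j<r. (u j + u' j) * fst (f (t (Suc j)) - f (t j)) + (v j + v' j) * snd (f (t (Suc j)) - f (t j)))"
    if "f 0 = 0" for f
    unfolding 1[of f, OF that] 2[of f, OF that] sum.distrib[symmetric] by (intro sum.cong refl) (simp only: distrib_right add_ac)
  show ?thesis unfolding increment_form_def
    by (intro exI[of _ "\<lambda>j. u j + u' j"] exI[of _ "\<lambda>j. v j + v' j"] allI impI) (rule eq)
qed

lemma linear_eval_increment_form: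
  assumes "linear_eval L"
  obtains t r p where "p \<le> r" "t p = 0" "\<And>j. j < r \<Longrightarrow> t j < t (Suc j)" "increment_form t r L"
proof -
  \<comment> \<open>The claim is made for every grid containing a finite set T of times, so that the
    sets of two summands can simply be united. The grid finally used lists T and 0 in increasing
    order.\<close>
  have *: "\<exists>T. finite T \<and> (\<forall>(t :: nat \<Rightarrow> real) r p. T \<subseteq> t ` {..r} \<longrightarrow> p \<le> r \<longrightarrow> t p = 0 \<longrightarrow> increment_form t r L)"
    using assms
  proof induction
    case (eval a s b)
    show ?case
    proof (intro exI[of _ "{s}"] conjI allI impI)
      fix t :: "nat \<Rightarrow> real" and r p assume "{s} \<subseteq> t ` {..r}" and p: "p \<le> r" "t p = (0 :: real)"
      then obtain m where "m \<le> r" "s = t m" by auto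
      then show "increment_form t r (\<lambda>f. a * fst (f s) + b * snd (f s))" using increment_form_eval p by simp
    qed simp
  next
    case (add L L')
    then obtain T T' where T: "finite T" "finite T'"
      "\<And>(t :: nat \<Rightarrow> real) r p. T \<subseteq> t ` {..r} \<Longrightarrow> p \<le> r \<Longrightarrow> t p = 0 \<Longrightarrow> increment_form t r L"
      "\<And>(t :: nat \<Rightarrow> real) r p. T' \<subseteq> t ` {..r} \<Longrightarrow> p \<le> r \<Longrightarrow> t p = 0 \<Longrightarrow> increment_form t r L'" by blast
    show ?case
      by (intro exI[of _ "T \<union> T'"] conjI allI impI increment_form_add) (use T in auto)
  qed
  then obtain T where T: "finite T" "\<And>(t :: nat \<Rightarrow> real) r p. T \<subseteq> t ` {..r} \<Longrightarrow> p \<le> r \<Longrightarrow> t p = 0 \<Longrightarrow> increment_form t r L" by blast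
  define xs where "xs = sorted_list_of_set (insert 0 T)"
  have xs: "set xs = insert 0 T" "sorted_wrt (<) xs" 
    unfolding xs_def using T(1)
    by (simp_all only: set_sorted_list_of_set finite_insert strict_sorted_list_of_set)
  have ne: "xs \<noteq> []" using xs(1) by auto
  define r where "r = length xs - 1"
  have len: "length xs = Suc r" using ne by (simp add: r_def)
  have im: "(!) xs ` {..r} = insert 0 T"
    unfolding xs(1)[symmetric] set_conv_nth len by (auto simp: less_Suc_eq_le)
  then obtain p where p: "p \<le> r" "xs ! p = 0" by (metis atMost_iff image_iff insertI1)
  show thesis
  proof (rule that[of p r "(!) xs", OF p])
    show "xs ! j < xs ! Suc j" if "j < r" for j
      using that len by (intro sorted_wrt_nth_less[OF xs(2)]) auto
    show "increment_form ((!) xs) r L" using p im by (intro T(2)[of _ _ p]) auto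
  qed
qed

lemma cmod_cis_diff_le: "cmod (cis a - cis b) \<le> \<bar>a - b\<bar>"
proof -
  have "cis a - cis b = cis b * (cis (a - b) - 1)" by (simp add: right_diff_distrib cis_mult)
  then have "cmod (cis a - cis b) = cmod (cis (a - b) - 1)" by (simp add: norm_mult)
  also have "\<dots> \<le> \<bar>a - b\<bar>" using iexp_approx1[of "a - b" 0] by (simp add: cis_conv_exp)
  finally show ?thesis .
qed

section \<open>Convergence of the walk\<close>

context stale_word
begin

definition path :: "nat \<Rightarrow> 'a \<Rightarrow> real \<Rightarrow> real \<times> real" where
  "path n \<omega> = scaled_walk n (identified_word (\<lambda>i. X i \<omega>))"

lemma identified_measurable: "(\<lambda>\<omega>. identified_word (\<lambda>i. X i \<omega>) i) \<in> measurable M (count_space UNIV)"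
  unfolding identified_word_def
proof (rule measurable_THE[where I=UNIV])
  fix s
  have [measurable]: "Measurable.pred M (\<lambda>\<omega>. identification (map (\<lambda>i. X i \<omega>) [- int m..i - 1]) (X i \<omega>) = Some s)" for m
    using measurable_word_function[of "[- int m..i - 1] @ [i]" X M "\<lambda>w. identification (butlast w) (last w) = Some s" "count_space UNIV"]
    by simp
  show "Measurable.pred M (\<lambda>\<omega>. \<forall>\<^sub>F m in sequentially. identification (map (\<lambda>i. X i \<omega>) [- int m..i - 1]) (X i \<omega>) = Some s)"
    unfolding eventually_sequentially by measurable
next
  show "countable (UNIV :: symbol set)" by (rule countable_finite[OF finite_symbol])
next
  fix \<omega> s t
  assume "\<forall>\<^sub>F m in sequentially. identification (map (\<lambda>i. X i \<omega>) [- int m..i - 1]) (X i \<omega>) = Some s"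
    "\<forall>\<^sub>F m in sequentially. identification (map (\<lambda>i. X i \<omega>) [- int m..i - 1]) (X i \<omega>) = Some t"
  then have "\<forall>\<^sub>F m :: nat in sequentially. s = t" by eventually_elim simp
  then show "s = t" by simp
qed simp

lemma walk_measurable: "(\<lambda>\<omega>. walk D (identified_word (\<lambda>i. X i \<omega>)) i) \<in> measurable M (count_space UNIV)"
proof -
  have "(\<lambda>\<omega>. D (reduce (map (\<lambda>j. identified_word (\<lambda>i. X i \<omega>) j) xs))) \<in> measurable M (count_space UNIV)" for xs
    by (rule measurable_word_function[where X="\<lambda>j \<omega>. identified_word (\<lambda>i. X i \<omega>) j" and g="\<lambda>w. D (reduce w)"])
      (auto intro: identified_measurable)
  then show ?thesis unfolding walk_def by (cases "i \<ge> 1"; cases "i = 0") simp_all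
qed

lemma path_measurable: "(\<lambda>\<omega>. path n \<omega> t) \<in> borel_measurable M"
proof -
  have [measurable]: "(\<lambda>\<omega>. real_of_int (walk D (identified_word (\<lambda>i. X i \<omega>)) i)) \<in> borel_measurable M" for D i
    by (rule measurable_compose[OF walk_measurable]) simp
  have "(\<lambda>\<omega>. path n \<omega> t) \<in> measurable M (borel \<Otimes>\<^sub>M borel)"
    unfolding path_def scaled_walk_def interpolate_def by measurable
  then show ?thesis by (simp add: borel_prod)
qed

lemma path_continuous: "continuous_on UNIV (path n \<omega>)"
  unfolding path_def by (rule continuous_scaled_walk)

lemma path_0: "path n \<omega> 0 = 0"
  using interpolate_of_int[of "walk ham_count (identified_word (\<lambda>i. X i \<omega>))" 0]
    interpolate_of_int[of "walk chs_count (identified_word (\<lambda>i. X i \<omega>))" 0]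
  by (simp add: path_def scaled_walk_def walk_def zero_prod_def)

definition good :: "'a \<Rightarrow> bool" where "good \<omega> \<longleftrightarrow> good_word (\<lambda>i. X i \<omega>)"

lemma ham_step_eq: "ham_step (\<lambda>i. X i \<omega>) k = (kind_of k \<omega> + type_of k \<omega>) / 2"
  and chs_step_eq: "chs_step (\<lambda>i. X i \<omega>) k = (kind_of k \<omega> - type_of k \<omega>) / 2"
  by (simp_all add: ham_step_def chs_step_def kind_of_def type_of_def)

abbreviation ham_walk :: "'a \<Rightarrow> int \<Rightarrow> int" where
  "ham_walk \<omega> \<equiv> walk ham_count (identified_word (\<lambda>i. X i \<omega>))"

abbreviation chs_walk :: "'a \<Rightarrow> int \<Rightarrow> int" where
  "chs_walk \<omega> \<equiv> walk chs_count (identified_word (\<lambda>i. X i \<omega>))"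

lemma walk_increments:
  assumes "good \<omega>" "i \<le> j" "0 \<le> i \<or> j \<le> 0"
  defines "sg \<equiv> (if 0 \<le> i then 1 else - 1 :: real)"
  shows "of_int (ham_walk \<omega> j) - of_int (ham_walk \<omega> i) = sg * (\<Sum>k\<in>{i+1..j}. (kind_of k \<omega> + type_of k \<omega>) / 2)"
    and "of_int (chs_walk \<omega> j) - of_int (chs_walk \<omega> i) = sg * (\<Sum>k\<in>{i+1..j}. (kind_of k \<omega> - type_of k \<omega>) / 2)"
  unfolding good_word_walk[OF assms(1)[unfolded good_def]] ham_step_eq chs_step_eq sg_def
proof -
  have "(\<Sum>k\<in>{1..j} \<union> {j+1..0}. e k) - (\<Sum>k\<in>{1..i} \<union> {i+1..0}. e k) = (if 0 \<le> i then 1 else - 1) * (\<Sum>k\<in>{i+1..j}. e k)"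
    for e :: "int \<Rightarrow> real"
  proof (cases "0 \<le> i")
    case True
    then show ?thesis using two_sided_sum_diff(1)[OF True assms(2), of e] by (simp only: if_True mult_1_left)
  next
    case False
    then have "j \<le> 0" using assms(3) by simp
    with False two_sided_sum_diff(2)[OF assms(2) this, of e] show ?thesis by (simp only: if_False mult_minus1)
  qed
  from this[of "\<lambda>k. (kind_of k \<omega> + type_of k \<omega>) / 2"] this[of "\<lambda>k. (kind_of k \<omega> - type_of k \<omega>) / 2"]
  show "(\<Sum>k\<in>{1..j} \<union> {j+1..0}. (kind_of k \<omega> + type_of k \<omega>) / 2) - (\<Sum>k\<in>{1..i} \<union> {i+1..0}. (kind_of k \<omega> + type_of k \<omega>) / 2)
      = (if 0 \<le> i then 1 else - 1) * (\<Sum>k\<in>{i+1..j}. (kind_of k \<omega> + type_of k \<omega>) / 2)"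
    "(\<Sum>k\<in>{1..j} \<union> {j+1..0}. (kind_of k \<omega> - type_of k \<omega>) / 2) - (\<Sum>k\<in>{1..i} \<union> {i+1..0}. (kind_of k \<omega> - type_of k \<omega>) / 2)
      = (if 0 \<le> i then 1 else - 1) * (\<Sum>k\<in>{i+1..j}. (kind_of k \<omega> - type_of k \<omega>) / 2)" .
qed

lemma walk_step_le_1:
  assumes "good \<omega>"
  shows "\<bar>of_int (ham_walk \<omega> (i + 1)) - of_int (ham_walk \<omega> i)\<bar> \<le> (1 :: real)"
    and "\<bar>of_int (chs_walk \<omega> (i + 1)) - of_int (chs_walk \<omega> i)\<bar> \<le> (1 :: real)"
proof -
  have *: "{i + 1..i + 1} = {i + 1}" by simp
  have c: "kind_of (i + 1) \<omega> = 1 \<or> kind_of (i + 1) \<omega> = - 1" "type_of (i + 1) \<omega> = 1 \<or> type_of (i + 1) \<omega> = - 1"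
    by (rule chain.b_cases, rule chain.\<sigma>_cases)
  have "0 \<le> i \<or> i + 1 \<le> 0" by linarith
  note inc = walk_increments[OF assms _ this, unfolded *]
  show "\<bar>of_int (ham_walk \<omega> (i + 1)) - of_int (ham_walk \<omega> i)\<bar> \<le> (1 :: real)"
    using inc(1) c by (auto split: if_splits)
  show "\<bar>of_int (chs_walk \<omega> (i + 1)) - of_int (chs_walk \<omega> i)\<bar> \<le> (1 :: real)"
    using inc(2) c by (auto split: if_splits)
qed

text \<open>Change of coordinates: each step is the half-sum and half-difference of kind and type,
  so a and c become (a + c)/2 on kinds and (a - c)/2 on signs. Left of the origin both are
  negated.\<close>

lemma drift_sum_walk:
  assumes "good \<omega>" "i \<le> j" "0 \<le> i \<or> j \<le> 0"
  defines "sg \<equiv> (if 0 \<le> i then 1 else - 1 :: real)"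
  shows "chain.drift_sum (sg * ((a + c) / 2)) (sg * ((a - c) / 2)) i j \<omega> =
    a * (of_int (ham_walk \<omega> j) - of_int (ham_walk \<omega> i)) + c * (of_int (chs_walk \<omega> j) - of_int (chs_walk \<omega> i))"
  unfolding walk_increments[OF assms(1-3)] sg_def[symmetric] chain.drift_sum_def sum_distrib_left sum.distrib[symmetric]
  by (intro sum.cong refl) (simp add: field_simps)

text \<open>The walk moves by at most 1 per step, so rounding a time down changes each coordinate by
  at most 1. Two ends per coordinate give 2 |a| + 2 |c| before scaling.\<close>

lemma path_increment_close:
  fixes n :: nat
  assumes "good \<omega>" "s \<le> t" "0 \<le> s \<or> t \<le> 0"
  defines "sg \<equiv> (if 0 \<le> s then 1 else - 1 :: real)" and "h \<equiv> real n powr (- 1 / 2)"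
  shows "\<bar>a * fst (path n \<omega> t - path n \<omega> s) + c * snd (path n \<omega> t - path n \<omega> s) -
    h * chain.drift_sum (sg * ((a + c) / 2)) (sg * ((a - c) / 2)) \<lfloor>real n * s\<rfloor> \<lfloor>real n * t\<rfloor> \<omega>\<bar>
    \<le> (2 * \<bar>a\<bar> + 2 * \<bar>c\<bar>) * h"
proof -
  let ?i = "\<lfloor>real n * s\<rfloor>" and ?j = "\<lfloor>real n * t\<rfloor>"
  have ij: "?i \<le> ?j" using assms(2) by (intro floor_mono mult_left_mono) auto
  have sgn: "0 \<le> ?i \<or> ?j \<le> 0"
    using assms(3) by (auto simp: floor_le_iff mult_le_0_iff intro: order.strict_trans1[of _ 0])
  \<comment> \<open>The sign is read off the real time s, the walk from its index. They agree when s
    >= 0 or n > 0; for n = 0 both indices are 0 and the sum is empty.\<close>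
  have sg: "sg = (if 0 \<le> ?i then 1 else - 1) \<or> ?i = ?j"
  proof (cases "0 \<le> s")
    case True then show ?thesis by (simp add: sg_def)
  next
    case False
    show ?thesis
    proof (cases "n = 0")
      case neq: False
      then have "real n * s < 0" using False by (simp add: mult_less_0_iff)
      then have "?i < 0" by (simp add: floor_less_iff)
      with False show ?thesis by (simp add: sg_def)
    qed simp
  qed
  have D: "chain.drift_sum (sg * ((a + c) / 2)) (sg * ((a - c) / 2)) ?i ?j \<omega> =
      a * (of_int (ham_walk \<omega> ?j) - of_int (ham_walk \<omega> ?i)) + c * (of_int (chs_walk \<omega> ?j) - of_int (chs_walk \<omega> ?i))"
    using sg drift_sum_walk[OF assms(1) ij sgn, of a c] by (auto simp: chain.drift_sum_def)
  have h: "h \<ge> 0" by (simp add: h_def)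
  let ?P = "interpolate (ham_walk \<omega>)" and ?Q = "interpolate (chs_walk \<omega>)"
  have close: "\<bar>?P x - of_int (ham_walk \<omega> \<lfloor>x\<rfloor>)\<bar> \<le> 1" "\<bar>?Q x - of_int (chs_walk \<omega> \<lfloor>x\<rfloor>)\<bar> \<le> 1" for x
    by (rule interpolate_floor_close, rule walk_step_le_1[OF assms(1)])+
  have "a * fst (path n \<omega> t - path n \<omega> s) + c * snd (path n \<omega> t - path n \<omega> s) -
      h * (a * (of_int (ham_walk \<omega> ?j) - of_int (ham_walk \<omega> ?i)) + c * (of_int (chs_walk \<omega> ?j) - of_int (chs_walk \<omega> ?i))) =
      h * (a * ((?P (real n * t) - of_int (ham_walk \<omega> ?j)) - (?P (real n * s) - of_int (ham_walk \<omega> ?i))) +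
        c * ((?Q (real n * t) - of_int (chs_walk \<omega> ?j)) - (?Q (real n * s) - of_int (chs_walk \<omega> ?i))))"
  proof -
    have "fst (path n \<omega> x) = h * ?P (real n * x)" "snd (path n \<omega> x) = h * ?Q (real n * x)" for x
      by (simp_all only: path_def scaled_walk_def h_def fst_conv snd_conv)
    then show ?thesis by (simp only: fst_diff snd_diff) (simp add: algebra_simps)
  qed
  also have "\<bar>\<dots>\<bar> \<le> h * (\<bar>a\<bar> * 2 + \<bar>c\<bar> * 2)"
    unfolding abs_mult abs_of_nonneg[OF h]
  proof (intro mult_left_mono h order_trans[OF abs_triangle_ineq] add_mono)
    have "\<bar>(?P (real n * t) - of_int (ham_walk \<omega> ?j)) - (?P (real n * s) - of_int (ham_walk \<omega> ?i))\<bar> \<le> 2"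
      using close(1)[of "real n * t"] close(1)[of "real n * s"] by linarith
    then show "\<bar>a * ((?P (real n * t) - of_int (ham_walk \<omega> ?j)) - (?P (real n * s) - of_int (ham_walk \<omega> ?i)))\<bar> \<le> \<bar>a\<bar> * 2"
      unfolding abs_mult by (intro mult_left_mono) auto
    have "\<bar>(?Q (real n * t) - of_int (chs_walk \<omega> ?j)) - (?Q (real n * s) - of_int (chs_walk \<omega> ?i))\<bar> \<le> 2"
      using close(2)[of "real n * t"] close(2)[of "real n * s"] by linarith
    then show "\<bar>c * ((?Q (real n * t) - of_int (chs_walk \<omega> ?j)) - (?Q (real n * s) - of_int (chs_walk \<omega> ?i)))\<bar> \<le> \<bar>c\<bar> * 2"
      unfolding abs_mult by (intro mult_left_mono) auto
  qed
  finally show ?thesis unfolding D by (simp add: algebra_simps)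
qed

text \<open>The sign drops out of the quadratic form, and the factor in \<open>var_rate\<close> is 1
  + 2 z. Expanding ((a + c)/2)^2 + (1 + 2 z) ((a - c)/2)^2 gives the stated matrix.\<close>

lemma var_rate_eq:
  assumes "sg = 1 \<or> sg = - 1"
  shows "chain.var_rate (sg * ((a + c) / 2)) (sg * ((a - c) / 2)) =
    a\<^sup>2 * ((1 + z_param pd pe) / 2) + 2 * a * c * (- (z_param pd pe / 2)) + c\<^sup>2 * ((1 + z_param pd pe) / 2)"
proof -
  have pos: "1 - pd + pe > 0" using p_nonneg by simp
  have z: "(1 + retention) / (1 - retention) = 1 + 2 * z_param pd pe"
    using pos by (simp add: retention_def z_param_def field_simps)
  have sq: "(sg * x)\<^sup>2 = x\<^sup>2" for x using assms by auto
  show ?thesis unfolding chain.var_rate_def z sq by (simp add: power2_eq_square field_simps)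
qed

text \<open>Almost surely the path increments differ from the scaled drift sums by C h in the phase,
  and \<open>cis\<close> is 1-Lipschitz, so the limit for the chain carries over.\<close>

lemma path_char_limit:
  fixes t u v :: "nat \<Rightarrow> real"
  assumes t: "\<And>j. j < r \<Longrightarrow> t j < t (Suc j)" and p: "p \<le> r" "t p = 0"
  shows "(\<lambda>n. expectation (\<lambda>\<omega>. cis (\<Sum>j<r. u j * fst (path n \<omega> (t (Suc j)) - path n \<omega> (t j)) +
      v j * snd (path n \<omega> (t (Suc j)) - path n \<omega> (t j)))))
    \<longlonglongrightarrow> of_real (\<Prod>j<r. exp (- ((u j)\<^sup>2 * ((1 + z_param pd pe) / 2) + 2 * u j * v j * (- (z_param pd pe / 2))
      + (v j)\<^sup>2 * ((1 + z_param pd pe) / 2)) * (t (Suc j) - t j) / 2))"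
proof -
  define sg where "sg j = (if 0 \<le> t j then 1 else - 1 :: real)" for j
  define d where "d n j \<omega> = chain.drift_sum (sg j * ((u j + v j) / 2)) (sg j * ((u j - v j) / 2))
      \<lfloor>real n * t j\<rfloor> \<lfloor>real n * t (Suc j)\<rfloor> \<omega>" for n j \<omega>
  define h where "h n = real n powr (- 1 / 2)" for n :: nat
  define C where "C = (\<Sum>j<r. 2 * \<bar>u j\<bar> + 2 * \<bar>v j\<bar>)"
  let ?inc = "\<lambda>n \<omega> j. u j * fst (path n \<omega> (t (Suc j)) - path n \<omega> (t j)) + v j * snd (path n \<omega> (t (Suc j)) - path n \<omega> (t j))"
  have mono: "t i \<le> t j" if "i \<le> j" "j \<le> r" for i j
    using that
  proof (induction j rule: dec_induct)
    case (step m)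
    then have "t m < t (Suc m)" by (intro t) simp
    with step show ?case by simp
  qed simp
  \<comment> \<open>As 0 is the grid point \<open>t p\<close>, no interval of the grid has it in its
    interior.\<close>
  have side: "0 \<le> t j \<or> t (Suc j) \<le> 0" if "j < r" for j
    using that mono[of p j] mono[of "Suc j" p] p by (cases "p \<le> j") auto
  have lim: "(\<lambda>n. expectation (\<lambda>\<omega>. \<Prod>j<r. cis (h n * d n j \<omega>))) \<longlonglongrightarrow>
      of_real (\<Prod>j<r. exp (- chain.var_rate (sg j * ((u j + v j) / 2)) (sg j * ((u j - v j) / 2)) * (t (Suc j) - t j) / 2))"
    unfolding h_def d_def by (rule chain.joint_char_limit) (use t in \<open>auto intro: less_imp_le\<close>)
  have vr: "chain.var_rate (sg j * ((u j + v j) / 2)) (sg j * ((u j - v j) / 2)) =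
      (u j)\<^sup>2 * ((1 + z_param pd pe) / 2) + 2 * u j * v j * (- (z_param pd pe / 2)) + (v j)\<^sup>2 * ((1 + z_param pd pe) / 2)" for j
    by (rule var_rate_eq) (simp add: sg_def)
  have prod_cis: "(\<Prod>j<m. cis (f j)) = cis (\<Sum>j<m. f j)" for f and m :: nat
    by (induction m) (simp_all add: cis_mult)
  have dm: "d n j \<in> borel_measurable M" for n j
    unfolding d_def by (rule chain.adapted_M[OF chain.drift_sum_adapted])
  have pm: "(\<lambda>\<omega>. ?inc n \<omega> j) \<in> borel_measurable M" for n j
  proof -
    have [measurable]: "(\<lambda>\<omega>. fst (path n \<omega> s)) \<in> borel_measurable M" "(\<lambda>\<omega>. snd (path n \<omega> s)) \<in> borel_measurable M" for s
      using path_measurable[of n s] unfolding borel_prod[symmetric] by (auto intro: measurable_compose measurable_fst measurable_snd)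
    show ?thesis unfolding fst_diff snd_diff by measurable
  qed
  have "cmod (expectation (\<lambda>\<omega>. cis (\<Sum>j<r. ?inc n \<omega> j)) - expectation (\<lambda>\<omega>. \<Prod>j<r. cis (h n * d n j \<omega>))) \<le> C * h n" for n
  proof -
    have m1: "(\<lambda>\<omega>. cis (\<Sum>j<r. ?inc n \<omega> j)) \<in> borel_measurable M"
      by (intro chain.cis_measurable borel_measurable_sum pm)
    have m2: "(\<lambda>\<omega>. cis (\<Sum>j<r. h n * d n j \<omega>)) \<in> borel_measurable M"
      using dm by (intro chain.cis_measurable borel_measurable_sum borel_measurable_times) auto
    have i1: "integrable M (\<lambda>\<omega>. cis (\<Sum>j<r. ?inc n \<omega> j))" "integrable M (\<lambda>\<omega>. cis (\<Sum>j<r. h n * d n j \<omega>))"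
      using m1 m2 by (auto intro!: integrable_const_bound[where B=1])
    have eq: "expectation (\<lambda>\<omega>. cis (\<Sum>j<r. ?inc n \<omega> j)) - expectation (\<lambda>\<omega>. \<Prod>j<r. cis (h n * d n j \<omega>)) =
        expectation (\<lambda>\<omega>. cis (\<Sum>j<r. ?inc n \<omega> j) - cis (\<Sum>j<r. h n * d n j \<omega>))"
      unfolding prod_cis using i1 by simp
    have "cmod (expectation (\<lambda>\<omega>. cis (\<Sum>j<r. ?inc n \<omega> j)) - expectation (\<lambda>\<omega>. \<Prod>j<r. cis (h n * d n j \<omega>))) \<le>
        expectation (\<lambda>\<omega>. cmod (cis (\<Sum>j<r. ?inc n \<omega> j) - cis (\<Sum>j<r. h n * d n j \<omega>)))"
      unfolding eq by (rule integral_norm_bound)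
    also have "\<dots> \<le> expectation (\<lambda>_. C * h n)"
    proof (rule integral_mono_AE)
      show "integrable M (\<lambda>\<omega>. cmod (cis (\<Sum>j<r. ?inc n \<omega> j) - cis (\<Sum>j<r. h n * d n j \<omega>)))"
        using i1 by (intro integrable_norm Bochner_Integration.integrable_diff)
      show "AE \<omega> in M. cmod (cis (\<Sum>j<r. ?inc n \<omega> j) - cis (\<Sum>j<r. h n * d n j \<omega>)) \<le> C * h n"
      proof (rule eventually_mono[OF AE_good_word])
        fix \<omega> assume "good_word (\<lambda>i. X i \<omega>)"
        then have g: "good \<omega>" by (simp add: good_def)
        have "cmod (cis (\<Sum>j<r. ?inc n \<omega> j) - cis (\<Sum>j<r. h n * d n j \<omega>)) \<le> \<bar>\<Sum>j<r. ?inc n \<omega> j - h n * d n j \<omega>\<bar>"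
          using cmod_cis_diff_le unfolding sum_subtractf by blast
        also have "\<dots> \<le> (\<Sum>j<r. \<bar>?inc n \<omega> j - h n * d n j \<omega>\<bar>)" by (rule sum_abs)
        also have "\<dots> \<le> (\<Sum>j<r. (2 * \<bar>u j\<bar> + 2 * \<bar>v j\<bar>) * h n)"
          unfolding h_def d_def sg_def
          by (intro sum_mono path_increment_close[OF g]) (use t side in \<open>auto intro: less_imp_le\<close>)
        finally show "cmod (cis (\<Sum>j<r. ?inc n \<omega> j) - cis (\<Sum>j<r. h n * d n j \<omega>)) \<le> C * h n"
          by (simp add: C_def sum_distrib_right)
      qed
    qed simp
    finally show ?thesis by (simp add: prob_space)
  qed
  then have "\<forall>\<^sub>F n in sequentially. cmod (expectation (\<lambda>\<omega>. cis (\<Sum>j<r. ?inc n \<omega> j)) - expectation (\<lambda>\<omega>. \<Prod>j<r. cis (h n * d n j \<omega>))) \<le> C * h n"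
    by simp
  moreover have "(\<lambda>n. C * h n) \<longlonglongrightarrow> 0"
  proof -
    have "h \<longlonglongrightarrow> 0" unfolding h_def
      by (rule tendsto_neg_powr) (auto intro: filterlim_real_sequentially)
    from tendsto_mult_right_zero[OF this] show ?thesis .
  qed
  ultimately have "(\<lambda>n. expectation (\<lambda>\<omega>. cis (\<Sum>j<r. ?inc n \<omega> j)) - expectation (\<lambda>\<omega>. \<Prod>j<r. cis (h n * d n j \<omega>))) \<longlonglongrightarrow> 0"
    by (rule Lim_null_comparison)
  from tendsto_add[OF this lim] show ?thesis
    unfolding vr by (simp only: diff_add_cancel add_0_left)
qed

end

section \<open>A modulus of continuity uniform in n\<close>

context stale_word
begin

text \<open>The window is cut into about 2 R / \<open>\<delta>0\<close> blocks of about
  \<open>\<delta>0\<close> n steps. A block fails with probability of order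
  (\<open>\<delta>0\<close> n)^2 / (c sqrt n)^4, that is \<open>\<delta>0\<close>^2 / c^4, so all of
  them together with probability of order \<open>\<delta>0\<close>. This holds for large n; each of
  the finitely many others is a single continuous process.\<close>

lemma path_modulus:
  assumes R: "R > 0" and c: "c > 0" and \<zeta>: "\<zeta> > 0"
  shows "\<exists>\<delta>>0. \<forall>n. \<exists>E\<in>events. prob E \<le> \<zeta> \<and> (\<forall>\<omega>\<in>space M - E. \<forall>s\<in>{-R..R}. \<forall>t\<in>{-R..R}. \<bar>s - t\<bar> \<le> \<delta> \<longrightarrow>
    dist (path n \<omega> s) (path n \<omega> t) \<le> c)"
proof -
  obtain K m0 x0 where K: "K \<ge> 0" "x0 > 0" and max: "\<And>i m x. m0 \<le> m \<Longrightarrow> x0 \<le> x \<Longrightarrow>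
    prob {\<omega> \<in> space M. \<exists>k\<le>m. x \<le> \<bar>\<Sum>l\<in>{i+1..i + int k}. kind_of l \<omega>\<bar> \<or> x \<le> \<bar>\<Sum>l\<in>{i+1..i + int k}. type_of l \<omega>\<bar>}
      \<le> K * (real m)\<^sup>2 / x ^ 4" using chain.walk_maximal by blast
  \<comment> \<open>The factor 10368 is 2 * 5184, for the blocks on both sides of 0. In 5184 = 4 *
    6^4 the 4 comes from L <= 2 \<open>\<delta>0\<close> n and the 6^4 from the denominator of
    \<eta>.\<close>
  define D where "D = 10368 * (R + 1) * K / c ^ 4"
  have D: "D \<ge> 0" using R K(1) c by (simp add: D_def)
  define \<delta>0 where "\<delta>0 = min 1 (\<zeta> / (D + 1))"
  have \<delta>0: "\<delta>0 > 0" "\<delta>0 \<le> 1" using \<zeta> D by (auto simp: \<delta>0_def)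
  have D\<delta>: "D * \<delta>0 \<le> \<zeta>"
  proof -
    have "D * \<delta>0 \<le> D * (\<zeta> / (D + 1))" using D by (intro mult_left_mono) (auto simp: \<delta>0_def)
    also have "\<dots> \<le> \<zeta>" using D \<zeta> by (simp add: field_simps)
    finally show ?thesis .
  qed
  \<comment> \<open>Large enough for \<open>\<delta>0\<close> n to be at least 1 and
    \<open>m0\<close>, and for \<eta> to be at least \<open>x0\<close>.\<close>
  define n0 where "n0 = nat \<lceil>1 / \<delta>0\<rceil> + nat \<lceil>real m0 / \<delta>0\<rceil> + nat \<lceil>(6 * x0 / c)\<^sup>2\<rceil> + 1"
  obtain N0 where N0: "{\<omega> \<in> space M. \<not> good_word (\<lambda>i. X i \<omega>)} \<subseteq> N0" "emeasure M N0 = 0" "N0 \<in> events"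
    using AE_good_word by (rule AE_E)
  have large: "\<exists>E\<in>events. prob E \<le> \<zeta> \<and> (\<forall>\<omega>\<in>space M - E. \<forall>s\<in>{-R..R}. \<forall>t\<in>{-R..R}. \<bar>s - t\<bar> \<le> \<delta>0 \<longrightarrow>
      dist (path n \<omega> s) (path n \<omega> t) \<le> c)" if n: "n \<ge> n0" for n
  proof -
    have n1: "1 / \<delta>0 \<le> real n" "real m0 / \<delta>0 \<le> real n" "(6 * x0 / c)\<^sup>2 \<le> real n" "n \<ge> 1"
    proof -
      have rn: "real n0 \<le> real n" using n by simp
      have "1 / \<delta>0 \<le> real (nat \<lceil>1 / \<delta>0\<rceil>)" "real m0 / \<delta>0 \<le> real (nat \<lceil>real m0 / \<delta>0\<rceil>)"
        "(6 * x0 / c)\<^sup>2 \<le> real (nat \<lceil>(6 * x0 / c)\<^sup>2\<rceil>)" by (rule real_nat_ceiling_ge)+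
      moreover have "real n0 = real (nat \<lceil>1 / \<delta>0\<rceil>) + real (nat \<lceil>real m0 / \<delta>0\<rceil>) + real (nat \<lceil>(6 * x0 / c)\<^sup>2\<rceil>) + 1"
        by (simp add: n0_def)
      ultimately show "1 / \<delta>0 \<le> real n" "real m0 / \<delta>0 \<le> real n" "(6 * x0 / c)\<^sup>2 \<le> real n"
        using rn by linarith+
      show "n \<ge> 1" using n by (simp add: n0_def)
    qed
    \<comment> \<open>An oscillation of \<eta> per block becomes 3 \<eta> for the interpolation,
      hence c/2 per coordinate after scaling, and the two coordinates add up to c.\<close>
    define \<eta> where "\<eta> = c * sqrt (real n) / 6"
    define L where "L = nat \<lceil>\<delta>0 * real n\<rceil>"
    define A where "A = nat \<lceil>R / \<delta>0\<rceil>"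
    have dn: "\<delta>0 * real n \<ge> 1" "\<delta>0 * real n \<ge> real m0" using n1(1,2) \<delta>0(1) by (simp_all add: divide_le_eq mult.commute)
    have L: "\<delta>0 * real n \<le> real L" "real L \<le> 2 * (\<delta>0 * real n)"
    proof -
      show "\<delta>0 * real n \<le> real L" unfolding L_def by (rule real_nat_ceiling_ge)
      have "real L = of_int \<lceil>\<delta>0 * real n\<rceil>" using dn(1) unfolding L_def by simp
      then show "real L \<le> 2 * (\<delta>0 * real n)" using dn(1) by linarith
    qed
    have L0: "L > 0" "m0 \<le> L" using L(1) dn by linarith+
    have A: "R / \<delta>0 \<le> real A" "real A \<le> (R + 1) / \<delta>0"
    proof -
      show "R / \<delta>0 \<le> real A" unfolding A_def by (rule real_nat_ceiling_ge)
      have "R / \<delta>0 > 0" using R \<delta>0 by simp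
      then have "real A = of_int \<lceil>R / \<delta>0\<rceil>" unfolding A_def by simp
      then have "real A \<le> R / \<delta>0 + 1" by linarith
      also have "\<dots> \<le> (R + 1) / \<delta>0" using \<delta>0 by (simp add: field_simps)
      finally show "real A \<le> (R + 1) / \<delta>0" .
    qed
    have A0: "A > 0"
    proof -
      have "0 < R / \<delta>0" using R \<delta>0 by simp
      with A(1) have "0 < real A" by linarith
      then show ?thesis by simp
    qed
    have \<eta>: "\<eta> > 0" "x0 \<le> \<eta>"
    proof -
      show "\<eta> > 0" using c n1(4) by (simp add: \<eta>_def)
      have "6 * x0 / c \<le> sqrt (real n)" using n1(3) by (rule real_le_rsqrt)
      then show "x0 \<le> \<eta>" using c by (simp add: \<eta>_def field_simps)
    qed
    define B where "B a = {\<omega> \<in> space M. \<exists>k\<le>L. \<eta> \<le> \<bar>\<Sum>l\<in>{a * int L + 1..a * int L + int k}. kind_of l \<omega>\<bar> \<or>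
        \<eta> \<le> \<bar>\<Sum>l\<in>{a * int L + 1..a * int L + int k}. type_of l \<omega>\<bar>}" for a
    note [measurable] = chain.adapted_M[OF kind_adapted] chain.adapted_M[OF type_adapted]
    have BM: "B a \<in> events" for a unfolding B_def by measurable
    have Bp: "prob (B a) \<le> 5184 * K * \<delta>0\<^sup>2 / c ^ 4" for a
    proof -
      have "prob (B a) \<le> K * (real L)\<^sup>2 / \<eta> ^ 4" unfolding B_def by (rule max[OF L0(2) \<eta>(2)])
      also have "\<dots> \<le> K * (2 * (\<delta>0 * real n))\<^sup>2 / \<eta> ^ 4"
        using K(1) L(2) \<eta>(1) by (intro divide_right_mono mult_left_mono power_mono) auto
      also have "\<eta> ^ 4 = c ^ 4 * (real n)\<^sup>2 / 1296"
      proof -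
        have "sqrt (real n) ^ 4 = (sqrt (real n) ^ 2) ^ 2" by (simp only: power_mult[symmetric]) simp
        then show ?thesis by (simp add: \<eta>_def power_divide power_mult_distrib)
      qed
      also have "K * (2 * (\<delta>0 * real n))\<^sup>2 / (c ^ 4 * (real n)\<^sup>2 / 1296) = 5184 * K * \<delta>0\<^sup>2 / c ^ 4"
        using n1(4) by (simp add: power_mult_distrib field_simps)
      finally show ?thesis .
    qed
    define E where "E = N0 \<union> (\<Union>a\<in>{- int A..<int A}. B a)"
    have EM: "E \<in> events" unfolding E_def using N0(3) BM by auto
    have "prob E \<le> prob N0 + prob (\<Union>a\<in>{- int A..<int A}. B a)"
      unfolding E_def using N0(3) BM by (intro measure_Un_le) auto
    also have "\<dots> \<le> 0 + (\<Sum>a\<in>{- int A..<int A}. prob (B a))"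
      using N0(2) BM by (intro add_mono measure_UNION_le) (auto simp: measure_def)
    also have "\<dots> \<le> 0 + (\<Sum>a\<in>{- int A..<int A}. 5184 * K * \<delta>0\<^sup>2 / c ^ 4)"
      by (intro add_left_mono sum_mono Bp)
    also have "\<dots> = 2 * real A * (5184 * K * \<delta>0\<^sup>2 / c ^ 4)" by simp
    also have "\<dots> \<le> 2 * ((R + 1) / \<delta>0) * (5184 * K * \<delta>0\<^sup>2 / c ^ 4)"
      using A(2) K(1) c by (intro mult_right_mono mult_left_mono) auto
    also have "\<dots> = D * \<delta>0" using \<delta>0(1) c by (simp add: D_def power2_eq_square field_simps)
    also have "\<dots> \<le> \<zeta>" by (rule D\<delta>)
    finally have Ep: "prob E \<le> \<zeta>" .
    have "dist (path n \<omega> s) (path n \<omega> t) \<le> c"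
      if w: "\<omega> \<in> space M - E" and s: "s \<in> {-R..R}" and t: "t \<in> {-R..R}" and st: "\<bar>s - t\<bar> \<le> \<delta>0" for \<omega> s t
    proof -
      have g: "good \<omega>" using w N0(1) by (auto simp: good_def E_def)
      have cells: "\<bar>of_int (ham_walk \<omega> (a * int L + k)) - of_int (ham_walk \<omega> (a * int L))\<bar> \<le> \<eta>"
        "\<bar>of_int (chs_walk \<omega> (a * int L + k)) - of_int (chs_walk \<omega> (a * int L))\<bar> \<le> \<eta>"
        if a: "- int A \<le> a" "a < int A" and k: "0 \<le> k" "k \<le> int L" for a k
      proof -
        let ?S = "\<Sum>l\<in>{a * int L + 1..a * int L + k}. kind_of l \<omega>" and ?T = "\<Sum>l\<in>{a * int L + 1..a * int L + k}. type_of l \<omega>"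
        have "\<omega> \<notin> B a" using w a by (auto simp: E_def)
        moreover have "nat k \<le> L" "int (nat k) = k" using k by auto
        ultimately have ST: "\<bar>?S\<bar> < \<eta>" "\<bar>?T\<bar> < \<eta>" using w unfolding B_def
          by (metis (mono_tags, lifting) DiffD1 mem_Collect_eq not_le)+
        \<comment> \<open>Blocks start at multiples of L, so none straddles the origin, where the
          increments change sign.\<close>
        have side: "0 \<le> a * int L \<or> a * int L + k \<le> 0"
        proof (cases "0 \<le> a")
          case False
          then have "(a + 1) * int L \<le> 0" by (intro mult_nonpos_nonneg) auto
          with k(2) show ?thesis by (simp add: algebra_simps)
        qed simp
        have le: "a * int L \<le> a * int L + k" using k(1) by simp
        have H: "(\<Sum>l\<in>{a * int L + 1..a * int L + k}. (kind_of l \<omega> + type_of l \<omega>) / 2) = (?S + ?T) / 2"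
          "(\<Sum>l\<in>{a * int L + 1..a * int L + k}. (kind_of l \<omega> - type_of l \<omega>) / 2) = (?S - ?T) / 2"
          by (simp_all add: sum_divide_distrib[symmetric] sum.distrib sum_subtractf)
        have avg: "\<bar>(x + y) / 2\<bar> \<le> \<eta>" "\<bar>(x - y) / 2\<bar> \<le> \<eta>" if "\<bar>x\<bar> < \<eta>" "\<bar>y\<bar> < \<eta>" for x y :: real
        proof -
          have "\<bar>x + y\<bar> \<le> 2 * \<eta>" "\<bar>x - y\<bar> \<le> 2 * \<eta>" using that by linarith+
          then show "\<bar>(x + y) / 2\<bar> \<le> \<eta>" "\<bar>(x - y) / 2\<bar> \<le> \<eta>" by simp_all
        qed
        have sgn: "\<bar>(if 0 \<le> a * int L then 1 else - 1) * x\<bar> = \<bar>x\<bar>" for x :: real by simp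
        show "\<bar>of_int (ham_walk \<omega> (a * int L + k)) - of_int (ham_walk \<omega> (a * int L))\<bar> \<le> \<eta>"
          unfolding walk_increments[OF g le side] sgn H by (rule avg[OF ST])
        show "\<bar>of_int (chs_walk \<omega> (a * int L + k)) - of_int (chs_walk \<omega> (a * int L))\<bar> \<le> \<eta>"
          unfolding walk_increments[OF g le side] sgn H by (rule avg[OF ST])
      qed
      have scaled: "\<bar>real n * x\<bar> \<le> of_int (int A * int L)" if "x \<in> {-R..R}" for x
      proof -
        have "real n * \<bar>x\<bar> \<le> real n * R" using that by (intro mult_left_mono) auto
        also have "\<dots> = (R / \<delta>0) * (\<delta>0 * real n)" using \<delta>0(1) by simp
        also have "\<dots> \<le> real A * real L" using A(1) L(1) dn(1) by (intro mult_mono) auto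
        finally show ?thesis by (simp add: abs_mult)
      qed
      have diff: "\<bar>real n * s - real n * t\<bar> \<le> of_int (int L)"
      proof -
        have "\<bar>real n * s - real n * t\<bar> = real n * \<bar>s - t\<bar>" by (simp add: abs_mult right_diff_distrib[symmetric])
        also have "\<dots> \<le> real n * \<delta>0" using st by (intro mult_left_mono) auto
        also have "\<dots> \<le> real L" using L(1) by (simp add: mult.commute)
        finally show ?thesis by simp
      qed
      have LA: "int L > 0" "int A > 0" using L0(1) A0 by simp_all
      have mod: "\<bar>interpolate (ham_walk \<omega>) (real n * s) - interpolate (ham_walk \<omega>) (real n * t)\<bar> \<le> 3 * \<eta>"
        "\<bar>interpolate (chs_walk \<omega>) (real n * s) - interpolate (chs_walk \<omega>) (real n * t)\<bar> \<le> 3 * \<eta>"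
        by (rule interpolate_modulus[OF LA _ scaled[OF s] scaled[OF t] diff]; rule cells; assumption)+
      define h where "h = real n powr (- 1 / 2)"
      have h: "h \<ge> 0" "h * \<eta> = c / 6"
      proof -
        have "h = 1 / sqrt (real n)" using n1(4) by (simp add: h_def powr_minus_divide powr_half_sqrt)
        then show "h * \<eta> = c / 6" "h \<ge> 0" using n1(4) by (simp_all add: \<eta>_def)
      qed
      have half: "\<bar>h * x - h * y\<bar> \<le> c / 2" if "\<bar>x - y\<bar> \<le> 3 * \<eta>" for x y
      proof -
        have "\<bar>h * x - h * y\<bar> = h * \<bar>x - y\<bar>" using h(1) by (simp add: abs_mult right_diff_distrib[symmetric])
        also have "\<dots> \<le> h * (3 * \<eta>)" using h(1) that by (rule mult_left_mono[rotated])
        also have "\<dots> = c / 2" using h(2) by simp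
        finally show ?thesis .
      qed
      have "dist (path n \<omega> s) (path n \<omega> t) \<le> dist (fst (path n \<omega> s)) (fst (path n \<omega> t)) + dist (snd (path n \<omega> s)) (snd (path n \<omega> t))"
        unfolding dist_prod_def by (rule sqrt_sum_squares_le_sum) auto
      also have "\<dots> \<le> c / 2 + c / 2"
        unfolding path_def scaled_walk_def fst_conv snd_conv dist_real_def h_def[symmetric]
        by (intro add_mono half mod)
      finally show ?thesis by simp
    qed
    then show ?thesis using EM Ep by (intro bexI[of _ E]) auto
  qed
  have "\<forall>n. \<exists>\<delta>>0. \<exists>E\<in>events. prob E \<le> \<zeta> \<and> (\<forall>\<omega>\<in>space M - E. \<forall>s\<in>{-R..R}. \<forall>t\<in>{-R..R}. \<bar>s - t\<bar> \<le> \<delta> \<longrightarrow>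
      dist (path n \<omega> s) (path n \<omega> t) \<le> c)"
    by (intro allI continuous_process_modulus path_measurable path_continuous R c \<zeta>)
  from choice[OF this] obtain d where d: "\<And>n. d n > 0" "\<And>n. \<exists>E\<in>events. prob E \<le> \<zeta> \<and> (\<forall>\<omega>\<in>space M - E. \<forall>s\<in>{-R..R}. \<forall>t\<in>{-R..R}. \<bar>s - t\<bar> \<le> d n \<longrightarrow>
      dist (path n \<omega> s) (path n \<omega> t) \<le> c)" by blast
  \<comment> \<open>A minimum over finitely many positive moduli, one for all large n and one for
    each small n.\<close>
  define \<delta> where "\<delta> = Min (insert \<delta>0 (d ` {..<n0}))"
  have \<delta>: "\<delta> > 0" "\<delta> \<le> \<delta>0" "\<And>n. n < n0 \<Longrightarrow> \<delta> \<le> d n"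
    using \<delta>0(1) d(1) unfolding \<delta>_def by (auto simp: Min_gr_iff)
  have shrink: "\<exists>E\<in>events. prob E \<le> \<zeta> \<and> (\<forall>\<omega>\<in>space M - E. \<forall>s\<in>{-R..R}. \<forall>t\<in>{-R..R}. \<bar>s - t\<bar> \<le> \<delta> \<longrightarrow>
      dist (path n \<omega> s) (path n \<omega> t) \<le> c)"
    if "\<delta> \<le> \<delta>'" "\<exists>E\<in>events. prob E \<le> \<zeta> \<and> (\<forall>\<omega>\<in>space M - E. \<forall>s\<in>{-R..R}. \<forall>t\<in>{-R..R}. \<bar>s - t\<bar> \<le> \<delta>' \<longrightarrow>
      dist (path n \<omega> s) (path n \<omega> t) \<le> c)" for \<delta>' n
    using that by (meson order_trans)
  have "\<exists>E\<in>events. prob E \<le> \<zeta> \<and> (\<forall>\<omega>\<in>space M - E. \<forall>s\<in>{-R..R}. \<forall>t\<in>{-R..R}. \<bar>s - t\<bar> \<le> \<delta> \<longrightarrow>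
      dist (path n \<omega> s) (path n \<omega> t) \<le> c)" for n
  proof (cases "n < n0")
    case True then show ?thesis by (intro shrink[OF \<delta>(3) d(2)])
  next
    case False then show ?thesis by (intro shrink[OF \<delta>(2) large]) simp
  qed
  with \<delta>(1) show ?thesis by blast
qed

end

theorem theorem1p14:
  fixes M :: "'a measure" and X :: "int \<Rightarrow> 'a \<Rightarrow> symbol"
    and N :: "'b measure" and Z :: "'b \<Rightarrow> real \<Rightarrow> real \<times> real"
    and pF pS pd pe :: real
  assumes "(pF, pS, pd, pe) \<in> param_set"
    and "pF = 0" and "pS = 1"
    and "iid_word M (pF, pS, pd, pe) X"
    and "two_sided_BM2 N Z"
    and "\<forall>\<omega>\<in>space N. Z \<omega> 0 = 0"
    and "\<forall>t. prob_space.variance N (\<lambda>\<omega>. fst (Z \<omega> t)) = (1 + z_param pd pe) * \<bar>t\<bar> / 2"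
    and "\<forall>t. prob_space.variance N (\<lambda>\<omega>. snd (Z \<omega> t)) = (1 + z_param pd pe) * \<bar>t\<bar> / 2"
    and "\<forall>t. covariance N (\<lambda>\<omega>. fst (Z \<omega> t)) (\<lambda>\<omega>. snd (Z \<omega> t)) = - (z_param pd pe * \<bar>t\<bar> / 2)"
  shows "converges_in_law compact_convergence M
           (\<lambda>n \<omega>. scaled_walk n (identified_word (\<lambda>i. X i \<omega>))) N Z"
proof -
  have "prob_space M" using assms(4) by (simp add: iid_word_def)
  then interpret stale_word M X pd pe
    using assms(1-4) by (simp add: stale_word_def stale_word_axioms_def)
  interpret N: prob_space N using assms(5) by (simp add: two_sided_BM2_def)
  have Zm: "(\<lambda>\<omega>. Z \<omega> t) \<in> borel_measurable N" for t using assms(5) by (simp add: two_sided_BM2_def)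
  have Zc: "continuous_on UNIV (Z \<omega>)" if "\<omega> \<in> space N" for \<omega> using assms(5) that by (simp add: two_sided_BM2_def)
  \<comment> \<open>The moments at time 1 identify the covariance matrix of the increments.\<close>
  have V: "N.variance (\<lambda>\<omega>. fst (Z \<omega> 1)) = (1 + z_param pd pe) / 2" "N.variance (\<lambda>\<omega>. snd (Z \<omega> 1)) = (1 + z_param pd pe) / 2"
    "covariance N (\<lambda>\<omega>. fst (Z \<omega> 1)) (\<lambda>\<omega>. snd (Z \<omega> 1)) = - (z_param pd pe / 2)"
    using assms(7-9)[rule_format, of 1] by simp_all
  have "converges_in_law compact_convergence M path N Z"
  proof (rule converges_in_law_criterion[OF \<open>prob_space M\<close> N.prob_space_axioms path_measurable path_continuous Zm Zc])
    fix L assume "linear_eval L"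
    then obtain t r p where t: "p \<le> r" "t p = 0" "\<And>j. j < r \<Longrightarrow> t j < t (Suc j)" "increment_form t r L"
      by (rule linear_eval_increment_form) blast
    then obtain u v where L: "\<And>f. f 0 = 0 \<Longrightarrow> L f = (\<Sum>j<r. u j * fst (f (t (Suc j)) - f (t j)) + v j * snd (f (t (Suc j)) - f (t j)))"
      unfolding increment_form_def by blast
    have prod_cis: "cis (\<Sum>j<m. f j) = (\<Prod>j<m. cis (f j))" for f and m :: nat
      by (induction m) (simp_all add: cis_mult[symmetric])
    have "N.expectation (\<lambda>\<omega>. cis (L (Z \<omega>))) = N.expectation (\<lambda>\<omega>. \<Prod>j<r. cis (u j * fst (Z \<omega> (t (Suc j)) - Z \<omega> (t j)) +
        v j * snd (Z \<omega> (t (Suc j)) - Z \<omega> (t j))))"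
      using assms(6) by (intro Bochner_Integration.integral_cong refl) (simp only: L prod_cis)
    also have "\<dots> = of_real (\<Prod>j<r. exp (- ((u j)\<^sup>2 * ((1 + z_param pd pe) / 2) + 2 * u j * v j * (- (z_param pd pe / 2))
        + (v j)\<^sup>2 * ((1 + z_param pd pe) / 2)) * (t (Suc j) - t j) / 2))"
      by (rule two_sided_BM2_joint_char[where t=t and r=r, OF assms(5,6) V t(3)])
    finally have EZ: "N.expectation (\<lambda>\<omega>. cis (L (Z \<omega>))) = \<dots>" .
    have Lp: "L (path n \<omega>) = (\<Sum>j<r. u j * fst (path n \<omega> (t (Suc j)) - path n \<omega> (t j)) +
        v j * snd (path n \<omega> (t (Suc j)) - path n \<omega> (t j)))" for n \<omega> by (rule L) (rule path_0)
    show "(\<lambda>n. expectation (\<lambda>\<omega>. cis (L (path n \<omega>)))) \<longlonglongrightarrow> N.expectation (\<lambda>\<omega>. cis (L (Z \<omega>)))"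
      unfolding EZ Lp by (rule path_char_limit[OF t(3,1,2)])
  next
    fix \<eta> :: real assume \<eta>: "\<eta> > 0"
    show "\<exists>\<delta>. (\<forall>j. \<delta> j > 0) \<and> (\<forall>n. \<exists>E\<in>events. prob E \<le> \<eta> \<and> (\<forall>\<omega>\<in>space M - E. path n \<omega> \<in> equicontinuous_paths \<delta>))"
    proof (rule tight_from_modulus[OF _ \<eta>])
      fix j :: nat and \<zeta> :: real assume "\<zeta> > 0"
      from path_modulus[OF _ _ this, of "real (Suc j)" "1 / real (Suc j)"]
      show "\<exists>\<delta>>0. \<forall>n. \<exists>E\<in>events. prob E \<le> \<zeta> \<and> (\<forall>\<omega>\<in>space M - E. path n \<omega> 0 = 0 \<and>
        (\<forall>s\<in>{-real (Suc j)..real (Suc j)}. \<forall>t\<in>{-real (Suc j)..real (Suc j)}. \<bar>s - t\<bar> \<le> \<delta> \<longrightarrow>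
          dist (path n \<omega> s) (path n \<omega> t) \<le> 1 / real (Suc j)))"
        by (simp only: path_0 simp_thms of_nat_0_less_iff zero_less_Suc zero_less_divide_1_iff)
    qed
    \<comment> \<open>The limit is viewed as a constant sequence, so that the same union bound over
      levels applies.\<close>
    have "\<exists>\<delta>. (\<forall>j. \<delta> j > 0) \<and> (\<forall>n::nat. \<exists>E\<in>N.events. N.prob E \<le> \<eta> \<and> (\<forall>\<omega>\<in>space N - E. Z \<omega> \<in> equicontinuous_paths \<delta>))"
    proof (rule N.tight_from_modulus[OF _ \<eta>])
      fix j :: nat and \<zeta> :: real assume \<zeta>: "\<zeta> > 0"
      have "real (Suc j) > 0" "1 / real (Suc j) > 0" by simp_all
      from N.continuous_process_modulus[OF Zm Zc this \<zeta>] obtain \<delta> E where E: "\<delta> > 0" "E \<in> N.events" "N.prob E \<le> \<zeta>"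
        "\<forall>\<omega>\<in>space N - E. \<forall>s\<in>{-real (Suc j)..real (Suc j)}. \<forall>t\<in>{-real (Suc j)..real (Suc j)}. \<bar>s - t\<bar> \<le> \<delta> \<longrightarrow>
          dist (Z \<omega> s) (Z \<omega> t) \<le> 1 / real (Suc j)" by blast
      then show "\<exists>\<delta>>0. \<forall>n::nat. \<exists>E\<in>N.events. N.prob E \<le> \<zeta> \<and> (\<forall>\<omega>\<in>space N - E. Z \<omega> 0 = 0 \<and>
        (\<forall>s\<in>{-real (Suc j)..real (Suc j)}. \<forall>t\<in>{-real (Suc j)..real (Suc j)}. \<bar>s - t\<bar> \<le> \<delta> \<longrightarrow>
          dist (Z \<omega> s) (Z \<omega> t) \<le> 1 / real (Suc j)))"
        using assms(6) by (intro exI[of _ \<delta>] conjI allI bexI[of _ E]) auto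
    qed
    then show "\<exists>\<delta>. (\<forall>j. \<delta> j > 0) \<and> (\<exists>E\<in>N.events. N.prob E \<le> \<eta> \<and> (\<forall>\<omega>\<in>space N - E. Z \<omega> \<in> equicontinuous_paths \<delta>))"
      by blast
  qed
  then show ?thesis unfolding path_def .
qed

end
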